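(* Let $Q$ be a quasigroup, $H=\{H_p\}_{p\in Q}$ a $Q$-graded Hopf quasigroup, and $A$ an $H$-quasimodule Hopf quasigroup such that $$h_{(1)}\otimes h_{(2)}\cdot a=h_{(2)}\otimes h_{(1)}\cdot a\qquad\text{for all } p\in Q,\ h\in H_p,\ a\in A.$$ Then the following statements are equivalent: (1) The family $A\rtimes H=\{A\otimes H_p\}_{p\in Q}$, with the structure given by - product $(a\otimes h)(b\otimes g)=a(h_{(1)}\cdot b)\otimes h_{(2)}g$ for $p,q\in Q$, $h\in H_p$, $g\in H_q$, $a,b\in A$, - unit $1\otimes 1$, - coproduct $\Delta^*_p(a\otimes h)=(a_1\otimes h_{(1)})\otimes(a_2\otimes h_{(2)})$, - counit $\epsilon^*_p(a\otimes h)=\epsilon(a)\epsilon_p(h)$, - antipode $S^*_p(a\otimes h)=S_p(h_{(2)})\cdot S(a)\otimes S_p(h_{(1)})$, is a $Q$-graded Hopf quasigroup. (2) $g\cdot(S_p(h)\cdot a)=(gS_p(h))\cdot a$ for all $p,q\in Q$, $h\in H_p$, $g\in H_q$, $a\in A$.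
   Context: Fix a field $k$; all vector spaces, linear maps and tensor products are over $k$. A quasigroup is a set $Q$ with a (not necessarily associative) product and a two-sided identity $e$ such that for each $p\in Q$ there is $p^{-1}\in Q$ with $p^{-1}(pq)=q$ and $(qp)p^{-1}=q$ for all $q\in Q$ (then inverses are unique, $(p^{-1})^{-1}=p$ and $(pq)^{-1}=q^{-1}p^{-1}$). Graded components whose indices are equal in $Q$ are the same space. A $Q$-graded Hopf quasigroup $H$ consists of: a family $\{H_p\}_{p\in Q}$ of vector spaces with linear maps $m_{p,q}:H_p\otimes H_q\to H_{pq}$, written $hg=m_{p,q}(h\otimes g)$ (not assumed associative), and a linear map $\mu:k\to H_e$ with $1=\mu(1_k)$ satisfying $h1=h=1h$; on each $H_p$ a coassociative counital coalgebra structure $(\Delta_p,\epsilon_p)$, written $\Delta_p(h)=h_{(1)}\otimes h_{(2)}$ (summation omitted), such that all $m_{p,q}$ and $\mu$ are coalgebra maps; and linear maps $S_p:H_p\to H_{p^{-1}}$ (antipode) such that for all $p,q\in Q$, $h\in H_p$, $g\in H_q$: $S_p(h_{(1)})(h_{(2)}g)=\epsilon_p(h)g=h_{(1)}(S_p(h_{(2)})g)$ and $(gS_p(h_{(1)}))h_{(2)}=g\epsilon_p(h)=(gh_{(1)})S_p(h_{(2)})$. A Hopf quasigroup $A$ is a (not necessarily associative) unital algebra with a coassociative counital coalgebra structure $\Delta(a)=a_1\otimes a_2$, $\epsilon$, where $\Delta$ and $\epsilon$ are (unital) algebra homomorphisms, and a linear map $S:A\to A$ with $S(a_1)(a_2b)=\epsilon(a)b=a_1(S(a_2)b)$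 and $(ba_1)S(a_2)=b\epsilon(a)=(bS(a_1))a_2$ for all $a,b\in A$. An (ungraded) $H$-quasimodule is a vector space $M$ with linear maps $\varphi_p:H_p\otimes M\to M$ ($p\in Q$), written $h\cdot m$, such that $1\cdot m=m$ and $S_p(h_{(1)})\cdot(h_{(2)}\cdot m)=\epsilon_p(h)m=h_{(1)}\cdot(S_p(h_{(2)})\cdot m)$ for all $p\in Q$, $h\in H_p$, $m\in M$. An $H$-quasimodule Hopf quasigroup is a Hopf quasigroup $A$ that is an $H$-quasimodule such that for all $p\in Q$, $h\in H_p$, $a,b\in A$: $(h_{(1)}\cdot a)(h_{(2)}\cdot b)=h\cdot(ab)$, $h\cdot 1=\epsilon_p(h)1$, $\Delta(h\cdot a)=h_{(1)}\cdot a_1\otimes h_{(2)}\cdot a_2$, and $\epsilon(h\cdot a)=\epsilon_p(h)\epsilon(a)$. *)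

theory Defs
  imports Complex_Main
begin

section \<open>Linear and bilinear maps between subspaces\<close>

text \<open>
  A vector space over the field \<open>'k\<close> is a subspace of a type carrying a \<^locale>\<open>vector_space\<close>
  structure.  A family of vector spaces is a family of subspaces of one ambient space; nothing is
  required of the ambient space (no independence or spanning), so every family is of this form up
  to isomorphism (embed it in its direct sum).  Values of maps outside the given subspaces are
  irrelevant.
\<close>

definition linear_on ::
  "('k::field \<Rightarrow> 'u::ab_group_add \<Rightarrow> 'u) \<Rightarrow> ('k \<Rightarrow> 'w::ab_group_add \<Rightarrow> 'w)
    \<Rightarrow> 'u set \<Rightarrow> 'w set \<Rightarrow> ('u \<Rightarrow> 'w) \<Rightarrow> bool" where
  "linear_on s t U W f \<longleftrightarrow>
     (\<forall>x\<in>U. f x \<in> W) \<and>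
     (\<forall>x\<in>U. \<forall>y\<in>U. f (x + y) = f x + f y) \<and>
     (\<forall>c. \<forall>x\<in>U. f (s c x) = t c (f x))"

definition bilinear_on ::
  "('k::field \<Rightarrow> 'u::ab_group_add \<Rightarrow> 'u) \<Rightarrow> ('k \<Rightarrow> 'v::ab_group_add \<Rightarrow> 'v)
    \<Rightarrow> ('k \<Rightarrow> 'w::ab_group_add \<Rightarrow> 'w)
    \<Rightarrow> 'u set \<Rightarrow> 'v set \<Rightarrow> 'w set \<Rightarrow> ('u \<Rightarrow> 'v \<Rightarrow> 'w) \<Rightarrow> bool" where
  "bilinear_on s1 s2 t U V W f \<longleftrightarrow>
     (\<forall>x\<in>U. linear_on s2 t V W (f x)) \<and> (\<forall>y\<in>V. linear_on s1 t U W (\<lambda>x. f x y))"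


section \<open>Tensor products\<close>

text \<open>
  The pure tensor \<open>u \<otimes> v\<close> is the evaluation functional \<open>\<beta> \<mapsto> \<beta> u v\<close> on bilinear forms, and
  \<open>U \<otimes> V\<close> is the span of the pure tensors with factors in \<open>U\<close> and \<open>V\<close>.  Over a field this is
  the tensor product; its universal property is proved below (\<open>tensor_lift_tensor\<close>,
  \<open>linear_on_tensor_lift\<close>, \<open>tensor_lift_unique\<close>).  The forms are bilinear on the ambient
  spaces; this loses nothing, as bilinear forms on \<open>U \<times> V\<close> extend.
\<close>

typedef ('u, 'v, 'k) tensor = "UNIV :: (('u \<Rightarrow> 'v \<Rightarrow> 'k) \<Rightarrow> 'k) set"
  morphisms teval Functional by simp

lemma teval_Functional [simp]: "teval (Functional F) = F"
  by (simp add: Functional_inverse)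

lemma tensor_eq_iff: "x = y \<longleftrightarrow> (\<forall>\<beta>. teval x \<beta> = teval y \<beta>)"
  by (metis teval_inject ext)

instantiation tensor :: (type, type, ab_group_add) ab_group_add
begin

definition "0 = Functional (\<lambda>\<beta>. 0)"
definition "x + y = Functional (\<lambda>\<beta>. teval x \<beta> + teval y \<beta>)"
definition "x - y = Functional (\<lambda>\<beta>. teval x \<beta> - teval y \<beta>)"
definition "- x = Functional (\<lambda>\<beta>. - teval x \<beta>)"

instance
  by standard
    (simp_all add: tensor_eq_iff zero_tensor_def plus_tensor_def minus_tensor_def
      uminus_tensor_def algebra_simps)

end

lemma teval_zero [simp]: "teval 0 \<beta> = 0"
  and teval_plus [simp]: "teval (x + y) \<beta> = teval x \<beta> + teval y \<beta>"
  by (simp_all add: zero_tensor_def plus_tensor_def)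

definition tensor_scale :: "'k::field \<Rightarrow> ('u, 'v, 'k) tensor \<Rightarrow> ('u, 'v, 'k) tensor" where
  "tensor_scale c t = Functional (\<lambda>\<beta>. c * teval t \<beta>)"

definition tensor ::
  "('k::field \<Rightarrow> 'u::ab_group_add \<Rightarrow> 'u) \<Rightarrow> ('k \<Rightarrow> 'v::ab_group_add \<Rightarrow> 'v)
    \<Rightarrow> 'u \<Rightarrow> 'v \<Rightarrow> ('u, 'v, 'k) tensor" where
  "tensor s1 s2 u v =
     Functional (\<lambda>\<beta>. if bilinear_on s1 s2 (*) UNIV UNIV UNIV \<beta> then \<beta> u v else 0)"

definition tensor_space ::
  "('k::field \<Rightarrow> 'u::ab_group_add \<Rightarrow> 'u) \<Rightarrow> ('k \<Rightarrow> 'v::ab_group_add \<Rightarrow> 'v)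
    \<Rightarrow> 'u set \<Rightarrow> 'v set \<Rightarrow> ('u, 'v, 'k) tensor set" where
  "tensor_space s1 s2 U V = module.span tensor_scale {tensor s1 s2 u v | u v. u \<in> U \<and> v \<in> V}"

text \<open>
  The linear map on \<open>U \<otimes> V\<close> induced by a bilinear map \<open>f\<close>: write \<open>t\<close> as a sum of pure
  tensors \<open>\<Sum> u\<^sub>i \<otimes> v\<^sub>i\<close> and take \<open>\<Sum> f u\<^sub>i v\<^sub>i\<close>.
\<close>

definition tensor_lift ::
  "('k::field \<Rightarrow> 'u::ab_group_add \<Rightarrow> 'u) \<Rightarrow> ('k \<Rightarrow> 'v::ab_group_add \<Rightarrow> 'v)
    \<Rightarrow> 'u set \<Rightarrow> 'v set \<Rightarrow> ('u \<Rightarrow> 'v \<Rightarrow> 'w::ab_group_add) \<Rightarrow> ('u, 'v, 'k) tensor \<Rightarrow> 'w" where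
  "tensor_lift s1 s2 U V f t =
     (let xs = (SOME xs. set xs \<subseteq> U \<times> V \<and> t = (\<Sum>(u, v)\<leftarrow>xs. tensor s1 s2 u v))
      in \<Sum>(u, v)\<leftarrow>xs. f u v)"

lemma vector_space_tensor_scale: "vector_space tensor_scale"
  by unfold_locales (auto simp: tensor_scale_def tensor_eq_iff algebra_simps)

lemma vector_space_field_mult: "vector_space ((*) :: 'k::field \<Rightarrow> 'k \<Rightarrow> 'k)"
  by unfold_locales (auto simp: algebra_simps)

lemma linear_on_iff_linear:
  assumes "vector_space s" "vector_space t"
  shows "linear_on s t UNIV UNIV f \<longleftrightarrow> Vector_Spaces.linear s t f"
  using assms by (auto simp: linear_on_def Vector_Spaces.linear_iff)

lemma bilinear_on_tensor:
  "bilinear_on s1 s2 tensor_scale U V (tensor_space s1 s2 U V) (tensor s1 s2)"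
proof -
  interpret T: vector_space tensor_scale by (rule vector_space_tensor_scale)
  have mem: "tensor s1 s2 x y \<in> tensor_space s1 s2 U V" if "x \<in> U" "y \<in> V" for x y
    unfolding tensor_space_def by (rule T.span_base) (use that in blast)
  show ?thesis
    unfolding bilinear_on_def linear_on_def
    using mem
    by (auto simp: tensor_def tensor_scale_def tensor_eq_iff bilinear_on_def linear_on_def)
qed

lemma tensor_space_sum_list:
  assumes "vector_space s1" "module.subspace s1 U" and t: "t \<in> tensor_space s1 s2 U V"
  shows "\<exists>xs. set xs \<subseteq> U \<times> V \<and> t = (\<Sum>(u, v)\<leftarrow>xs. tensor s1 s2 u v)"
proof -
  interpret T: vector_space tensor_scale by (rule vector_space_tensor_scale)
  interpret V1: vector_space s1 by fact
  show ?thesis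
    using t unfolding tensor_space_def
  proof (induction rule: T.span_induct_alt)
    case base
    show ?case by (rule exI[of _ "[]"]) simp
  next
    case (step c x y)
    then obtain u v xs where x: "x = tensor s1 s2 u v" "u \<in> U" "v \<in> V"
      and y: "set xs \<subseteq> U \<times> V" "y = (\<Sum>(u, v)\<leftarrow>xs. tensor s1 s2 u v)" by blast
    have "tensor_scale c x = tensor s1 s2 (s1 c u) v"
      using bilinear_on_tensor[of s1 s2 UNIV UNIV]
      by (simp add: x bilinear_on_def linear_on_def)
    moreover have "s1 c u \<in> U"
      using assms(2) x(2) by (rule V1.subspace_scale)
    ultimately show ?case
      using x y by (intro exI[of _ "(s1 c u, v) # xs"]) auto
  qed
qed

lemma functional_separates:
  assumes "vector_space t" and d: "d \<noteq> 0"
  shows "\<exists>\<phi>. linear_on t (*) UNIV UNIV \<phi> \<and> \<phi> d \<noteq> (0 :: 'k::field)"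
proof -
  interpret V: vector_space t by fact
  interpret P: vector_space_pair t "(*) :: 'k \<Rightarrow> 'k \<Rightarrow> 'k"
    using assms vector_space_field_mult by (simp add: vector_space_pair_def)
  have "V.independent {d}" using d by simp
  then obtain \<phi> where "Vector_Spaces.linear t (*) \<phi>" "\<phi> d = (1 :: 'k)"
    using P.linear_independent_extend[of "{d}" "\<lambda>_. 1"] by auto
  then show ?thesis
    by (intro exI[of _ \<phi>]) (simp add: linear_on_iff_linear[OF assms(1) vector_space_field_mult])
qed

lemma subspace_projection:
  assumes "vector_space s" "module.subspace s U"
  shows "\<exists>\<pi>. linear_on s s UNIV U \<pi> \<and> (\<forall>u\<in>U. \<pi> u = u)"
proof -
  interpret V: vector_space s by fact
  interpret P: vector_space_pair s s
    using assms by (simp add: vector_space_pair_def)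
  have "Vector_Spaces.linear s s (\<lambda>x. x)"
    using assms(1) by (simp add: Vector_Spaces.linear_iff)
  from P.linear_exists_left_inverse_on[OF this assms(2)]
  obtain g where "range g \<subseteq> U" "Vector_Spaces.linear s s g" "\<forall>v\<in>U. g v = v" by auto
  then show ?thesis
    by (intro exI[of _ g]) (auto simp: Vector_Spaces.linear_iff linear_on_def)
qed

lemma sum_list_tensor_determines:
  fixes f :: "'u::ab_group_add \<Rightarrow> 'v::ab_group_add \<Rightarrow> 'w::ab_group_add"
    and s1 :: "'k::field \<Rightarrow> 'u \<Rightarrow> 'u"
  assumes vs: "vector_space s1" "vector_space s2" "vector_space t"
    and sub: "module.subspace s1 U" "module.subspace s2 V"
    and f: "bilinear_on s1 s2 t U V W f"
    and xs: "set xs \<subseteq> U \<times> V" and ys: "set ys \<subseteq> U \<times> V"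
    and eq: "(\<Sum>(u, v)\<leftarrow>xs. tensor s1 s2 u v) = (\<Sum>(u, v)\<leftarrow>ys. tensor s1 s2 u v)"
  shows "(\<Sum>(u, v)\<leftarrow>xs. f u v) = (\<Sum>(u, v)\<leftarrow>ys. f u v)"
proof (rule ccontr)
  let ?d = "(\<Sum>(u, v)\<leftarrow>xs. f u v) - (\<Sum>(u, v)\<leftarrow>ys. f u v)"
  assume "\<not> ?thesis"
  then have "?d \<noteq> 0" by simp
  from functional_separates[OF vs(3) this] obtain \<phi>
    where \<phi>: "linear_on t (*) UNIV UNIV \<phi>" "\<phi> ?d \<noteq> (0 :: 'k)" by blast
  from \<phi>(1) have \<phi>_add: "\<phi> (x + y) = \<phi> x + \<phi> y" for x y
    by (simp add: linear_on_def)
  have \<phi>0: "\<phi> 0 = 0" using \<phi>_add[of 0 0] by (metis add.right_neutral add_left_cancel)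
  have \<phi>_diff: "\<phi> (x - y) = \<phi> x - \<phi> y" for x y
    using \<phi>_add[of "x - y" y] by simp
  obtain \<pi>1 where \<pi>1: "linear_on s1 s1 UNIV U \<pi>1" "\<And>u. u \<in> U \<Longrightarrow> \<pi>1 u = u"
    using subspace_projection[OF vs(1) sub(1)] by blast
  obtain \<pi>2 where \<pi>2: "linear_on s2 s2 UNIV V \<pi>2" "\<And>u. u \<in> V \<Longrightarrow> \<pi>2 u = u"
    using subspace_projection[OF vs(2) sub(2)] by blast
  define \<beta> where "\<beta> = (\<lambda>u v. \<phi> (f (\<pi>1 u) (\<pi>2 v)))"
  have \<beta>: "bilinear_on s1 s2 (*) UNIV UNIV UNIV \<beta>"
    using \<phi>(1) \<pi>1(1) \<pi>2(1) f
    by (simp add: \<beta>_def bilinear_on_def linear_on_def)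
  have ev: "teval (\<Sum>(u, v)\<leftarrow>zs. tensor s1 s2 u v) \<beta> = \<phi> (\<Sum>(u, v)\<leftarrow>zs. f u v)"
    if "set zs \<subseteq> U \<times> V" for zs
    using that
  proof (induction zs)
    case Nil
    then show ?case by (simp add: \<phi>0)
  next
    case (Cons z zs)
    then show ?case
      using \<beta> by (cases z) (auto simp: \<phi>_add tensor_def \<beta>_def \<pi>1(2) \<pi>2(2))
  qed
  have "\<phi> ?d = 0"
    using ev[OF xs] ev[OF ys] eq by (simp add: \<phi>_diff)
  with \<phi>(2) show False by simp
qed

lemma tensor_lift_sum_list:
  assumes vs: "vector_space s1" "vector_space s2" "vector_space t"
    and sub: "module.subspace s1 U" "module.subspace s2 V"
    and f: "bilinear_on s1 s2 t U V W f"
    and xs: "set xs \<subseteq> U \<times> V"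
  shows "tensor_lift s1 s2 U V f (\<Sum>(u, v)\<leftarrow>xs. tensor s1 s2 u v) = (\<Sum>(u, v)\<leftarrow>xs. f u v)"
proof -
  let ?P = "\<lambda>ys. set ys \<subseteq> U \<times> V \<and>
    (\<Sum>(u, v)\<leftarrow>xs. tensor s1 s2 u v) = (\<Sum>(u, v)\<leftarrow>ys. tensor s1 s2 u v)"
  define zs where "zs = (SOME ys. ?P ys)"
  have "?P zs"
    unfolding zs_def by (rule someI[of ?P xs]) (use xs in simp)
  then have "(\<Sum>(u, v)\<leftarrow>xs. f u v) = (\<Sum>(u, v)\<leftarrow>zs. f u v)"
    by (intro sum_list_tensor_determines[OF vs sub f xs]) simp_all
  then show ?thesis
    by (simp add: tensor_lift_def zs_def)
qed

lemma tensor_lift_tensor: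
  assumes "vector_space s1" "vector_space s2" "vector_space t"
    and "module.subspace s1 U" "module.subspace s2 V"
    and "bilinear_on s1 s2 t U V W f" and "u \<in> U" "v \<in> V"
  shows "tensor_lift s1 s2 U V f (tensor s1 s2 u v) = f u v"
  using tensor_lift_sum_list[OF assms(1-6), of "[(u, v)]"] assms(7,8) by simp

lemma linear_on_tensor_lift:
  assumes vs: "vector_space s1" "vector_space s2" "vector_space t"
    and sub: "module.subspace s1 U" "module.subspace s2 V" "module.subspace t W"
    and f: "bilinear_on s1 s2 t U V W f"
  shows "linear_on tensor_scale t (tensor_space s1 s2 U V) W (tensor_lift s1 s2 U V f)"
proof -
  interpret V1: vector_space s1 by fact
  interpret V3: vector_space t by fact
  note lift = tensor_lift_sum_list[OF vs sub(1,2) f]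
  note rep = tensor_space_sum_list[OF vs(1) sub(1)]
  have mem: "(\<Sum>(u, v)\<leftarrow>xs. f u v) \<in> W" if "set xs \<subseteq> U \<times> V" for xs
    using that
  proof (induction xs)
    case Nil
    then show ?case using V3.subspace_0[OF sub(3)] by simp
  next
    case (Cons x xs)
    then show ?case
      using f by (cases x) (auto simp: bilinear_on_def linear_on_def intro!: V3.subspace_add[OF sub(3)])
  qed
  have scale: "tensor_scale c (\<Sum>(u, v)\<leftarrow>xs. tensor s1 s2 u v)
        = (\<Sum>(u, v)\<leftarrow>map (\<lambda>(u, v). (s1 c u, v)) xs. tensor s1 s2 u v)" for c xs
    using bilinear_on_tensor[of s1 s2 UNIV UNIV]
    by (induction xs)
      (auto simp: bilinear_on_def linear_on_def tensor_scale_def tensor_eq_iff algebra_simps)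
  have scale_f: "t c (\<Sum>(u, v)\<leftarrow>xs. f u v)
        = (\<Sum>(u, v)\<leftarrow>map (\<lambda>(u, v). (s1 c u, v)) xs. f u v)" if "set xs \<subseteq> U \<times> V" for c xs
    using that f
    by (induction xs) (auto simp: bilinear_on_def linear_on_def V3.scale_right_distrib)
  have sub_scale: "set (map (\<lambda>(u, v). (s1 c u, v)) xs) \<subseteq> U \<times> V"
    if "set xs \<subseteq> U \<times> V" for c xs
    using that V1.subspace_scale[OF sub(1)] by auto
  show ?thesis
    unfolding linear_on_def
  proof (intro conjI ballI allI)
    fix x assume "x \<in> tensor_space s1 s2 U V"
    from rep[OF this] obtain xs where xs: "set xs \<subseteq> U \<times> V"
      "x = (\<Sum>(u, v)\<leftarrow>xs. tensor s1 s2 u v)" by blast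
    show "tensor_lift s1 s2 U V f x \<in> W"
      using mem xs lift by simp
    show "tensor_lift s1 s2 U V f (tensor_scale c x) = t c (tensor_lift s1 s2 U V f x)" for c
      using lift[OF sub_scale[OF xs(1)], of c] lift[OF xs(1)] scale[of c xs] scale_f[OF xs(1), of c]
      by (simp add: xs(2))
    fix y assume "y \<in> tensor_space s1 s2 U V"
    from rep[OF this] obtain ys where ys: "set ys \<subseteq> U \<times> V"
      "y = (\<Sum>(u, v)\<leftarrow>ys. tensor s1 s2 u v)" by blast
    show "tensor_lift s1 s2 U V f (x + y) = tensor_lift s1 s2 U V f x + tensor_lift s1 s2 U V f y"
      using lift[of "xs @ ys"] lift[of xs] lift[of ys] xs ys by simp
  qed
qed

lemma tensor_lift_unique:
  assumes vs: "vector_space s1" "vector_space s2" "vector_space t"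
    and sub: "module.subspace s1 U" "module.subspace s2 V"
    and f: "bilinear_on s1 s2 t U V W f"
    and g: "linear_on tensor_scale t (tensor_space s1 s2 U V) W g"
    and eq: "\<And>u v. u \<in> U \<Longrightarrow> v \<in> V \<Longrightarrow> g (tensor s1 s2 u v) = f u v"
    and x: "x \<in> tensor_space s1 s2 U V"
  shows "g x = tensor_lift s1 s2 U V f x"
proof -
  interpret T: vector_space tensor_scale by (rule vector_space_tensor_scale)
  have zero: "0 \<in> tensor_space s1 s2 U V"
    unfolding tensor_space_def by (rule T.span_zero)
  have g_add: "g (y + z) = g y + g z"
    if "y \<in> tensor_space s1 s2 U V" "z \<in> tensor_space s1 s2 U V" for y z
    using g that by (simp add: linear_on_def)
  have "(\<Sum>(u, v)\<leftarrow>xs. tensor s1 s2 u v) \<in> tensor_space s1 s2 U V \<and>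
      g (\<Sum>(u, v)\<leftarrow>xs. tensor s1 s2 u v) = (\<Sum>(u, v)\<leftarrow>xs. f u v)"
    if "set xs \<subseteq> U \<times> V" for xs
    using that
  proof (induction xs)
    case Nil
    show ?case using g_add[OF zero zero] zero by simp
  next
    case (Cons z zs)
    obtain u v where z: "z = (u, v)" "u \<in> U" "v \<in> V" using Cons.prems by auto
    have uv: "tensor s1 s2 u v \<in> tensor_space s1 s2 U V"
      using bilinear_on_tensor[of s1 s2 U V] z by (simp add: bilinear_on_def linear_on_def)
    show ?case
      using Cons z uv g_add[OF uv] eq[OF z(2,3)] T.span_add
      by (auto simp: tensor_space_def)
  qed
  moreover obtain xs where "set xs \<subseteq> U \<times> V" "x = (\<Sum>(u, v)\<leftarrow>xs. tensor s1 s2 u v)"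
    using tensor_space_sum_list[OF vs(1) sub(1) x] by blast
  ultimately show ?thesis
    using tensor_lift_sum_list[OF vs sub f] by simp
qed


section \<open>Coalgebras\<close>

text \<open>
  \<open>sweedler s C \<Delta> h f\<close> is the Sweedler sum \<open>f h\<^sub>(\<^sub>1\<^sub>) h\<^sub>(\<^sub>2\<^sub>)\<close> where \<open>\<Delta> h = h\<^sub>(\<^sub>1\<^sub>) \<otimes> h\<^sub>(\<^sub>2\<^sub>)\<close>.
\<close>

definition sweedler ::
  "('k::field \<Rightarrow> 'v::ab_group_add \<Rightarrow> 'v) \<Rightarrow> 'v set \<Rightarrow> ('v \<Rightarrow> ('v, 'v, 'k) tensor)
    \<Rightarrow> 'v \<Rightarrow> ('v \<Rightarrow> 'v \<Rightarrow> 'w::ab_group_add) \<Rightarrow> 'w" where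
  "sweedler s C \<Delta> h f = tensor_lift s s C C f (\<Delta> h)"

text \<open>Both sides of coassociativity are expressed in \<open>C \<otimes> (C \<otimes> C)\<close>.\<close>

locale coalgebra = vector_space s
  for s :: "'k::field \<Rightarrow> 'v::ab_group_add \<Rightarrow> 'v" +
  fixes C :: "'v set"
    and \<Delta> :: "'v \<Rightarrow> ('v, 'v, 'k) tensor"
    and \<epsilon> :: "'v \<Rightarrow> 'k"
  assumes subspace_C: "module.subspace s C"
    and comul_linear: "linear_on s tensor_scale C (tensor_space s s C C) \<Delta>"
    and counit_linear: "linear_on s (*) C UNIV \<epsilon>"
    and coassoc: "h \<in> C \<Longrightarrow>
      sweedler s C \<Delta> h (\<lambda>x y. sweedler s C \<Delta> x (\<lambda>u v. tensor s tensor_scale u (tensor s s v y)))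
      = sweedler s C \<Delta> h (\<lambda>x y. tensor s tensor_scale x (\<Delta> y))"
    and counit_left: "h \<in> C \<Longrightarrow> sweedler s C \<Delta> h (\<lambda>x y. s (\<epsilon> x) y) = h"
    and counit_right: "h \<in> C \<Longrightarrow> sweedler s C \<Delta> h (\<lambda>x y. s (\<epsilon> y) x) = h"


section \<open>Quasigroups\<close>

record 'q quasigroup_data =
  qmul :: "'q \<Rightarrow> 'q \<Rightarrow> 'q"
  qone :: 'q

definition is_qinv :: "'q quasigroup_data \<Rightarrow> 'q \<Rightarrow> 'q \<Rightarrow> bool" where
  "is_qinv Q p r \<longleftrightarrow> (\<forall>q. qmul Q r (qmul Q p q) = q \<and> qmul Q (qmul Q q p) r = q)"

definition qinv :: "'q quasigroup_data \<Rightarrow> 'q \<Rightarrow> 'q" where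
  "qinv Q p = (THE r. is_qinv Q p r)"

locale quasigroup =
  fixes Q :: "'q quasigroup_data"
  assumes qone_left: "qmul Q (qone Q) q = q"
    and qone_right: "qmul Q q (qone Q) = q"
    and qinv_exists: "\<exists>r. is_qinv Q p r"
begin

lemma is_qinv_unique:
  assumes "is_qinv Q p r" "is_qinv Q p r'"
  shows "r = r'"
proof -
  have "qmul Q r' p = qone Q"
    using assms(2) qone_right unfolding is_qinv_def by metis
  moreover have "qmul Q (qmul Q r' p) r = r'"
    using assms(1) by (simp add: is_qinv_def)
  ultimately show ?thesis by (simp add: qone_left)
qed

lemma is_qinv_qinv: "is_qinv Q p (qinv Q p)"
  unfolding qinv_def using qinv_exists[of p] is_qinv_unique by (blast intro: theI)

end


section \<open>Graded Hopf quasigroups\<close>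

text \<open>
  The component of index \<open>p\<close> is \<open>gspace H p\<close>, in an ambient space with scalar multiplication
  \<open>gscale H\<close>.  A linear map \<open>H\<^sub>p \<otimes> H\<^sub>q \<rightarrow> H\<^sub>p\<^sub>q\<close> is given by the corresponding bilinear map
  \<open>gmult H p q\<close>, and the linear map \<open>\<mu>\<close> by the element \<open>gone H = \<mu> 1\<close>.
\<close>

record ('q, 'k, 'h) graded_data =
  gscale :: "'k \<Rightarrow> 'h \<Rightarrow> 'h"
  gspace :: "'q \<Rightarrow> 'h set"
  gmult :: "'q \<Rightarrow> 'q \<Rightarrow> 'h \<Rightarrow> 'h \<Rightarrow> 'h"
  gone :: 'h
  gcomul :: "'q \<Rightarrow> 'h \<Rightarrow> ('h, 'h, 'k) tensor"
  gcounit :: "'q \<Rightarrow> 'h \<Rightarrow> 'k"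
  gantipode :: "'q \<Rightarrow> 'h \<Rightarrow> 'h"

definition gsweedler ::
  "('q, 'k::field, 'h::ab_group_add) graded_data \<Rightarrow> 'q \<Rightarrow> 'h
    \<Rightarrow> ('h \<Rightarrow> 'h \<Rightarrow> 'w::ab_group_add) \<Rightarrow> 'w" where
  "gsweedler H p h f = sweedler (gscale H) (gspace H p) (gcomul H p) h f"

locale graded_hopf_quasigroup = quasigroup Q
  for Q :: "'q quasigroup_data" +
  fixes H :: "('q, 'k::field, 'h::ab_group_add) graded_data"
  assumes coalg: "coalgebra (gscale H) (gspace H p) (gcomul H p) (gcounit H p)"
    and gmult_bilinear: "bilinear_on (gscale H) (gscale H) (gscale H)
      (gspace H p) (gspace H q) (gspace H (qmul Q p q)) (gmult H p q)"
    and gone_in: "gone H \<in> gspace H (qone Q)"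
    and gone_left: "h \<in> gspace H p \<Longrightarrow> gmult H (qone Q) p (gone H) h = h"
    and gone_right: "h \<in> gspace H p \<Longrightarrow> gmult H p (qone Q) h (gone H) = h"
    and gcomul_gmult: "h \<in> gspace H p \<Longrightarrow> g \<in> gspace H q \<Longrightarrow>
      gcomul H (qmul Q p q) (gmult H p q h g) =
      gsweedler H p h (\<lambda>h1 h2. gsweedler H q g (\<lambda>g1 g2.
        tensor (gscale H) (gscale H) (gmult H p q h1 g1) (gmult H p q h2 g2)))"
    and gcounit_gmult: "h \<in> gspace H p \<Longrightarrow> g \<in> gspace H q \<Longrightarrow>
      gcounit H (qmul Q p q) (gmult H p q h g) = gcounit H p h * gcounit H q g"
    and gcomul_gone: "gcomul H (qone Q) (gone H) = tensor (gscale H) (gscale H) (gone H) (gone H)"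
    and gcounit_gone: "gcounit H (qone Q) (gone H) = 1"
    and gantipode_linear:
      "linear_on (gscale H) (gscale H) (gspace H p) (gspace H (qinv Q p)) (gantipode H p)"
    and antipode1: "h \<in> gspace H p \<Longrightarrow> g \<in> gspace H q \<Longrightarrow>
      gsweedler H p h (\<lambda>h1 h2.
        gmult H (qinv Q p) (qmul Q p q) (gantipode H p h1) (gmult H p q h2 g))
      = gscale H (gcounit H p h) g"
    and antipode2: "h \<in> gspace H p \<Longrightarrow> g \<in> gspace H q \<Longrightarrow>
      gsweedler H p h (\<lambda>h1 h2.
        gmult H p (qmul Q (qinv Q p) q) h1 (gmult H (qinv Q p) q (gantipode H p h2) g))
      = gscale H (gcounit H p h) g"
    and antipode3: "h \<in> gspace H p \<Longrightarrow> g \<in> gspace H q \<Longrightarrow>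
      gsweedler H p h (\<lambda>h1 h2.
        gmult H (qmul Q q (qinv Q p)) p (gmult H q (qinv Q p) g (gantipode H p h1)) h2)
      = gscale H (gcounit H p h) g"
    and antipode4: "h \<in> gspace H p \<Longrightarrow> g \<in> gspace H q \<Longrightarrow>
      gsweedler H p h (\<lambda>h1 h2.
        gmult H (qmul Q q p) (qinv Q p) (gmult H q p g h1) (gantipode H p h2))
      = gscale H (gcounit H p h) g"


section \<open>Hopf quasigroups\<close>

record ('k, 'a) hopf_data =
  ascale :: "'k \<Rightarrow> 'a \<Rightarrow> 'a"
  amult :: "'a \<Rightarrow> 'a \<Rightarrow> 'a"
  aone :: 'a
  acomul :: "'a \<Rightarrow> ('a, 'a, 'k) tensor"
  acounit :: "'a \<Rightarrow> 'k"
  aantipode :: "'a \<Rightarrow> 'a"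

definition asweedler ::
  "('k::field, 'a::ab_group_add) hopf_data \<Rightarrow> 'a \<Rightarrow> ('a \<Rightarrow> 'a \<Rightarrow> 'w::ab_group_add) \<Rightarrow> 'w" where
  "asweedler A a f = sweedler (ascale A) UNIV (acomul A) a f"

locale hopf_quasigroup =
  fixes A :: "('k::field, 'a::ab_group_add) hopf_data"
  assumes acoalg: "coalgebra (ascale A) UNIV (acomul A) (acounit A)"
    and amult_bilinear:
      "bilinear_on (ascale A) (ascale A) (ascale A) UNIV UNIV UNIV (amult A)"
    and aone_left: "amult A (aone A) a = a"
    and aone_right: "amult A a (aone A) = a"
    and acomul_amult: "acomul A (amult A a b) =
      asweedler A a (\<lambda>a1 a2. asweedler A b (\<lambda>b1 b2.
        tensor (ascale A) (ascale A) (amult A a1 b1) (amult A a2 b2)))"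
    and acomul_aone: "acomul A (aone A) = tensor (ascale A) (ascale A) (aone A) (aone A)"
    and acounit_amult: "acounit A (amult A a b) = acounit A a * acounit A b"
    and acounit_aone: "acounit A (aone A) = 1"
    and aantipode_linear: "linear_on (ascale A) (ascale A) UNIV UNIV (aantipode A)"
    and aantipode1: "asweedler A a (\<lambda>a1 a2. amult A (aantipode A a1) (amult A a2 b))
      = ascale A (acounit A a) b"
    and aantipode2: "asweedler A a (\<lambda>a1 a2. amult A a1 (amult A (aantipode A a2) b))
      = ascale A (acounit A a) b"
    and aantipode3: "asweedler A a (\<lambda>a1 a2. amult A (amult A b a1) (aantipode A a2))
      = ascale A (acounit A a) b"
    and aantipode4: "asweedler A a (\<lambda>a1 a2. amult A (amult A b (aantipode A a1)) a2)
      = ascale A (acounit A a) b"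


section \<open>Quasimodules\<close>

text \<open>\<open>act p h m\<close> is \<open>\<phi>\<^sub>p (h \<otimes> m) = h \<cdot> m\<close> for \<open>h\<close> in \<open>H\<^sub>p\<close>.\<close>

locale quasimodule = graded_hopf_quasigroup Q H + vector_space s
  for Q :: "'q quasigroup_data"
    and H :: "('q, 'k::field, 'h::ab_group_add) graded_data"
    and s :: "'k \<Rightarrow> 'm::ab_group_add \<Rightarrow> 'm" +
  fixes act :: "'q \<Rightarrow> 'h \<Rightarrow> 'm \<Rightarrow> 'm"
  assumes act_bilinear: "bilinear_on (gscale H) s s (gspace H p) UNIV UNIV (act p)"
    and act_gone: "act (qone Q) (gone H) m = m"
    and act_antipode1: "h \<in> gspace H p \<Longrightarrow>
      gsweedler H p h (\<lambda>h1 h2. act (qinv Q p) (gantipode H p h1) (act p h2 m))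
      = s (gcounit H p h) m"
    and act_antipode2: "h \<in> gspace H p \<Longrightarrow>
      gsweedler H p h (\<lambda>h1 h2. act p h1 (act (qinv Q p) (gantipode H p h2) m))
      = s (gcounit H p h) m"

locale quasimodule_hopf_quasigroup = hopf_quasigroup A + quasimodule Q H "ascale A" act
  for Q :: "'q quasigroup_data"
    and H :: "('q, 'k::field, 'h::ab_group_add) graded_data"
    and A :: "('k, 'a::ab_group_add) hopf_data"
    and act :: "'q \<Rightarrow> 'h \<Rightarrow> 'a \<Rightarrow> 'a" +
  assumes act_amult: "h \<in> gspace H p \<Longrightarrow>
      gsweedler H p h (\<lambda>h1 h2. amult A (act p h1 a) (act p h2 b)) = act p h (amult A a b)"
    and act_aone: "h \<in> gspace H p \<Longrightarrow> act p h (aone A) = ascale A (gcounit H p h) (aone A)"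
    and acomul_act: "h \<in> gspace H p \<Longrightarrow>
      acomul A (act p h a) =
      gsweedler H p h (\<lambda>h1 h2. asweedler A a (\<lambda>a1 a2.
        tensor (ascale A) (ascale A) (act p h1 a1) (act p h2 a2)))"
    and acounit_act: "h \<in> gspace H p \<Longrightarrow>
      acounit A (act p h a) = gcounit H p h * acounit A a"


section \<open>The smash product\<close>

text \<open>\<open>smash_lift A H p f\<close> is the linear map on \<open>A \<otimes> H\<^sub>p\<close> sending \<open>a \<otimes> h\<close> to \<open>f a h\<close>.\<close>

definition smash_tensor ::
  "('k::field, 'a::ab_group_add) hopf_data \<Rightarrow> ('q, 'k, 'h::ab_group_add) graded_data
    \<Rightarrow> 'a \<Rightarrow> 'h \<Rightarrow> ('a, 'h, 'k) tensor" where
  "smash_tensor A H a h = tensor (ascale A) (gscale H) a h"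

definition smash_lift ::
  "('k::field, 'a::ab_group_add) hopf_data \<Rightarrow> ('q, 'k, 'h::ab_group_add) graded_data \<Rightarrow> 'q
    \<Rightarrow> ('a \<Rightarrow> 'h \<Rightarrow> 'w::ab_group_add) \<Rightarrow> ('a, 'h, 'k) tensor \<Rightarrow> 'w" where
  "smash_lift A H p f x = tensor_lift (ascale A) (gscale H) UNIV (gspace H p) f x"

definition smash_product ::
  "'q quasigroup_data \<Rightarrow> ('q, 'k::field, 'h::ab_group_add) graded_data
    \<Rightarrow> ('k, 'a::ab_group_add) hopf_data \<Rightarrow> ('q \<Rightarrow> 'h \<Rightarrow> 'a \<Rightarrow> 'a)
    \<Rightarrow> ('q, 'k, ('a, 'h, 'k) tensor) graded_data" where
  "smash_product Q H A act = \<lparr>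
     gscale = tensor_scale,
     gspace = (\<lambda>p. tensor_space (ascale A) (gscale H) UNIV (gspace H p)),
     gmult = (\<lambda>p q x y.
       smash_lift A H p (\<lambda>a h.
         smash_lift A H q (\<lambda>b g.
           gsweedler H p h (\<lambda>h1 h2.
             smash_tensor A H (amult A a (act p h1 b)) (gmult H p q h2 g))) y) x),
     gone = smash_tensor A H (aone A) (gone H),
     gcomul = (\<lambda>p.
       smash_lift A H p (\<lambda>a h.
         asweedler A a (\<lambda>a1 a2.
           gsweedler H p h (\<lambda>h1 h2.
             tensor tensor_scale tensor_scale (smash_tensor A H a1 h1) (smash_tensor A H a2 h2))))),
     gcounit = (\<lambda>p. smash_lift A H p (\<lambda>a h. acounit A a * gcounit H p h)),
     gantipode = (\<lambda>p.
       smash_lift A H p (\<lambda>a h.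
         gsweedler H p h (\<lambda>h1 h2.
           smash_tensor A H
             (act (qinv Q p) (gantipode H p h2) (aantipode A a))
             (gantipode H p h1))))
   \<rparr>"

end

theory Submission
  imports Defs
begin

text \<open>
  All identities are checked on pure tensors.  The third antipode law of \<open>A \<rtimes> H\<close> at \<open>b \<otimes> g\<close> and
  \<open>a \<otimes> h\<close> reads
  \<open>(b S(g\<^sub>1 \<cdot> (S(h\<^sub>3) \<cdot> a\<^sub>1))) ((g\<^sub>2 S(h\<^sub>2)) \<cdot> a\<^sub>2) \<otimes> (g\<^sub>3 S(h\<^sub>1)) h\<^sub>4 = \<epsilon>(a) \<epsilon>(h) b \<otimes> g\<close>,
  because \<open>S\<close> reverses \<open>\<Delta>\<close> on \<open>H\<close> and commutes with the action on \<open>A\<close>.  Under (2) the first tensor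
  factor is \<open>(b S(x\<^sub>1)) x\<^sub>2\<close> with \<open>x = g \<cdot> (S(h) \<cdot> a)\<close>, which proves the law.  Conversely, applying the
  counit of \<open>H\<close> with \<open>b = 1\<close> shows that \<open>(g S(h)) \<cdot> a\<close> is a convolution inverse of
  \<open>S(g \<cdot> (S(h) \<cdot> a))\<close>, hence equal to \<open>g \<cdot> (S(h) \<cdot> a)\<close>.  The fourth law follows from (2) in the form
  \<open>(g h\<^sub>1) \<cdot> (S(h\<^sub>2) \<cdot> a) = \<epsilon>(h) g \<cdot> a\<close>, the first two hold unconditionally, and the cocommutativity
  hypothesis is what makes the coproduct multiplicative.
\<close>

section \<open>Multilinear maps\<close>

text \<open>It is replaced by antipode laws carrying a free extra factor, such as S(x1)(x2 b) =
  eps(x) b: an expression is chosen in which such a bracket can be cancelled at two different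
  places, and the two results are equated. Statement (2) is tied to the third and fourth antipode
  laws because only there does a product formed in \<open>H\<close>, g S(h) or g h, act on
  \<open>A\<close>. In the first two laws S(h) and h act one after the other, and the quasimodule
  axioms already cancel them. Every regrouping of Sweedler legs is explicit. A nest of sums records
  a bracketing of the legs; coassociativity moves it until the two legs to be cancelled are the
  coproduct of a single element, and the sum over them then collapses to a counit. Because the
  antipode of \<open>H\<close> reverses legs, the legs of h are grouped from the opposite end to
  those of g and a.\<close>

definition lin ::
  "('k::field \<Rightarrow> 'u::ab_group_add \<Rightarrow> 'u) \<Rightarrow> ('k \<Rightarrow> 'w::ab_group_add \<Rightarrow> 'w) \<Rightarrow> ('u \<Rightarrow> 'w) \<Rightarrow> bool" where
  "lin s t f \<longleftrightarrow> (\<forall>x y. f (x + y) = f x + f y) \<and> (\<forall>c x. f (s c x) = t c (f x))"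

definition bil ::
  "('k::field \<Rightarrow> 'u::ab_group_add \<Rightarrow> 'u) \<Rightarrow> ('k \<Rightarrow> 'v::ab_group_add \<Rightarrow> 'v)
    \<Rightarrow> ('k \<Rightarrow> 'w::ab_group_add \<Rightarrow> 'w) \<Rightarrow> ('u \<Rightarrow> 'v \<Rightarrow> 'w) \<Rightarrow> bool" where
  "bil s1 s2 t f \<longleftrightarrow> (\<forall>y. lin s1 t (\<lambda>x. f x y)) \<and> (\<forall>x. lin s2 t (f x))"

definition tril ::
  "('k::field \<Rightarrow> 'u::ab_group_add \<Rightarrow> 'u) \<Rightarrow> ('k \<Rightarrow> 'v::ab_group_add \<Rightarrow> 'v)
    \<Rightarrow> ('k \<Rightarrow> 'x::ab_group_add \<Rightarrow> 'x) \<Rightarrow> ('k \<Rightarrow> 'w::ab_group_add \<Rightarrow> 'w)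
    \<Rightarrow> ('u \<Rightarrow> 'v \<Rightarrow> 'x \<Rightarrow> 'w) \<Rightarrow> bool" where
  "tril s1 s2 s3 t f \<longleftrightarrow> (\<forall>y z. lin s1 t (\<lambda>x. f x y z)) \<and> (\<forall>x z. lin s2 t (\<lambda>y. f x y z))
     \<and> (\<forall>x y. lin s3 t (f x y))"

lemmas multilin_defs = lin_def bil_def tril_def

lemma lin_0: "lin s t f \<Longrightarrow> f 0 = 0"
  unfolding lin_def by (metis add.right_neutral add_left_cancel)

lemma lin_imp_linear_on: "lin s t f \<Longrightarrow> linear_on s t U UNIV f"
  by (simp add: lin_def linear_on_def)

lemma bil_imp_bilinear_on: "bil s1 s2 t f \<Longrightarrow> bilinear_on s1 s2 t U V UNIV f"
  by (auto simp: bil_def bilinear_on_def lin_imp_linear_on)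

lemma subspace_UNIV: "vector_space s \<Longrightarrow> module.subspace s UNIV"
  by (simp add: module.subspace_def module_iff_vector_space)

lemma linear_on_sum_list:
  assumes "vector_space s" "module.subspace s U" "linear_on s t U W f"
    and "\<And>z. z \<in> set zs \<Longrightarrow> F z \<in> U"
  shows "f (\<Sum>z\<leftarrow>zs. F z) = (\<Sum>z\<leftarrow>zs. f (F z)) \<and> (\<Sum>z\<leftarrow>zs. F z) \<in> U"
proof -
  interpret vector_space s by fact
  have f_add: "f (x + y) = f x + f y" if "x \<in> U" "y \<in> U" for x y
    using assms(3) that by (simp add: linear_on_def)
  have "0 \<in> U" using assms(2) by (rule subspace_0)
  then have "f 0 = 0" using f_add[of 0 0] by simp
  with assms(4) show ?thesis
    by (induction zs) (auto simp: f_add \<open>0 \<in> U\<close> subspace_add[OF assms(2)])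
qed

lemma sum_list_in_subspace:
  assumes "vector_space s" "module.subspace s U"
    and "\<And>z. z \<in> set zs \<Longrightarrow> F z \<in> U"
  shows "(\<Sum>z\<leftarrow>zs. F z) \<in> U"
  using linear_on_sum_list[OF assms(1,2) _ assms(3), of s UNIV "\<lambda>x. x" zs "\<lambda>x. x"]
  by (simp add: linear_on_def)

lemma sum_list_sum_list_commute:
  fixes F :: "'x \<Rightarrow> 'y \<Rightarrow> 'w::comm_monoid_add"
  shows "(\<Sum>x\<leftarrow>xs. \<Sum>y\<leftarrow>ys. F x y) = (\<Sum>y\<leftarrow>ys. \<Sum>x\<leftarrow>xs. F x y)"
  by (induction xs) (simp_all add: sum_list_addf)

lemma tensor_bil: "bil s1 s2 tensor_scale (tensor s1 s2)"
  using bilinear_on_tensor[of s1 s2 UNIV UNIV]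
  by (auto simp: multilin_defs bilinear_on_def linear_on_def)

lemma tensor_linear_simps [simp]:
  "tensor s1 s2 (u + u') v = tensor s1 s2 u v + tensor s1 s2 u' v"
  "tensor s1 s2 u (v + v') = tensor s1 s2 u v + tensor s1 s2 u v'"
  "tensor s1 s2 (s1 c u) v = tensor_scale c (tensor s1 s2 u v)"
  "tensor s1 s2 u (s2 c v) = tensor_scale c (tensor s1 s2 u v)"
  using tensor_bil[of s1 s2] by (simp_all add: multilin_defs)

lemma tensor_scale_simps [simp]:
  "tensor_scale c (x + y) = tensor_scale c x + tensor_scale c y"
  "tensor_scale c (tensor_scale d x) = tensor_scale (c * d) x"
  "tensor_scale 1 x = x"
  "tensor_scale c 0 = 0"
  by (simp_all add: tensor_scale_def tensor_eq_iff algebra_simps)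

lemma tensor_scale_left_distrib: "tensor_scale (c + d) x = tensor_scale c x + tensor_scale d x"
  by (simp add: tensor_scale_def tensor_eq_iff algebra_simps)

lemma tensor_in_tensor_space: "u \<in> U \<Longrightarrow> v \<in> V \<Longrightarrow> tensor s1 s2 u v \<in> tensor_space s1 s2 U V"
  using bilinear_on_tensor[of s1 s2 U V] by (simp add: bilinear_on_def linear_on_def)

lemma subspace_tensor_space: "module.subspace tensor_scale (tensor_space s1 s2 U V)"
proof -
  interpret vector_space tensor_scale by (rule vector_space_tensor_scale)
  show ?thesis unfolding tensor_space_def by (rule subspace_span)
qed

text \<open>Pure tensors span, so they determine a linear map; this is what reduces the axioms of
  the smash product to computations with pure tensors.\<close>

lemma linear_on_tensor_space_eq:
  assumes "vector_space s1" "module.subspace s1 U"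
    and f: "linear_on tensor_scale t (tensor_space s1 s2 U V) W f"
    and g: "linear_on tensor_scale t (tensor_space s1 s2 U V) W' g"
    and eq: "\<And>u v. u \<in> U \<Longrightarrow> v \<in> V \<Longrightarrow> f (tensor s1 s2 u v) = g (tensor s1 s2 u v)"
    and x: "x \<in> tensor_space s1 s2 U V"
  shows "f x = g x"
proof -
  obtain xs where xs: "set xs \<subseteq> U \<times> V" "x = (\<Sum>z\<leftarrow>xs. case z of (u, v) \<Rightarrow> tensor s1 s2 u v)"
    using tensor_space_sum_list[OF assms(1,2) x] by auto
  then have mem: "(case z of (u, v) \<Rightarrow> tensor s1 s2 u v) \<in> tensor_space s1 s2 U V"
    if "z \<in> set xs" for z
    using that by (auto intro!: tensor_in_tensor_space)
  note sum = linear_on_sum_list[OF vector_space_tensor_scale subspace_tensor_space]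
  have "f (case z of (u, v) \<Rightarrow> tensor s1 s2 u v) = g (case z of (u, v) \<Rightarrow> tensor s1 s2 u v)"
    if "z \<in> set xs" for z
    using that xs(1) eq by auto
  then have "(\<Sum>z\<leftarrow>xs. f (case z of (u, v) \<Rightarrow> tensor s1 s2 u v))
      = (\<Sum>z\<leftarrow>xs. g (case z of (u, v) \<Rightarrow> tensor s1 s2 u v))"
    by (simp cong: map_cong)
  with sum[OF f, of xs "\<lambda>(u, v). tensor s1 s2 u v"] sum[OF g, of xs "\<lambda>(u, v). tensor s1 s2 u v"] mem
  show ?thesis by (simp add: xs(2))
qed


section \<open>Sweedler sums\<close>

definition proj :: "('k::field \<Rightarrow> 'v::ab_group_add \<Rightarrow> 'v) \<Rightarrow> 'v set \<Rightarrow> 'v \<Rightarrow> 'v" where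
  "proj s C = (SOME \<pi>. linear_on s s UNIV C \<pi> \<and> (\<forall>u\<in>C. \<pi> u = u))"

text \<open>
  Precomposing every structure map with a projection onto its domain makes it linear on the whole
  ambient space, so that multilinearity of a composite is decided by rewriting alone.
\<close>

context coalgebra
begin

abbreviation \<pi> :: "'v \<Rightarrow> 'v" where "\<pi> \<equiv> proj s C"

lemma proj_linear_on: "linear_on s s UNIV C \<pi>" and proj_id [simp]: "u \<in> C \<Longrightarrow> \<pi> u = u"
  using someI_ex[OF subspace_projection[OF vector_space_axioms subspace_C]]
  by (simp_all add: proj_def)

lemma proj_in [simp]: "\<pi> x \<in> C"
  and proj_add [simp]: "\<pi> (x + y) = \<pi> x + \<pi> y"
  and proj_scale [simp]: "\<pi> (s c x) = s c (\<pi> x)"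
  using proj_linear_on by (simp_all add: linear_on_def)

definition sw :: "'v \<Rightarrow> ('v \<Rightarrow> 'v \<Rightarrow> 'w::ab_group_add) \<Rightarrow> 'w" where
  "sw h f = sweedler s C \<Delta> (\<pi> h) f"

definition cou :: "'v \<Rightarrow> 'k" where
  "cou h = \<epsilon> (\<pi> h)"

text \<open>This is the very list that \<open>tensor_lift\<close> chooses for the coproduct of
  \<open>\<pi> h\<close>, so \<open>sw\<close> becomes a finite sum by mere unfolding. Additivity in
  the summand, congruence on \<open>C\<close> and interchange of sums then hold for arbitrary
  summands; bilinearity is first needed for linearity in \<open>h\<close>.\<close>

definition rep :: "'v \<Rightarrow> ('v \<times> 'v) list" where
  "rep h = (SOME xs. set xs \<subseteq> C \<times> C \<and> \<Delta> (\<pi> h) = (\<Sum>(u, v)\<leftarrow>xs. tensor s s u v))"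

lemma sw_proj [simp]: "sw (\<pi> h) f = sw h f"
  and cou_proj [simp]: "cou (\<pi> h) = cou h"
  by (simp_all add: sw_def cou_def)

lemma sweedler_eq_sw: "h \<in> C \<Longrightarrow> sweedler s C \<Delta> h f = sw h f"
  and counit_eq_cou: "h \<in> C \<Longrightarrow> \<epsilon> h = cou h"
  by (simp_all add: sw_def cou_def)

lemma sw_rep: "sw h f = (\<Sum>z\<leftarrow>rep h. f (fst z) (snd z))"
  by (simp add: sw_def sweedler_def tensor_lift_def rep_def case_prod_unfold)

lemma comul_in: "h \<in> C \<Longrightarrow> \<Delta> h \<in> tensor_space s s C C"
  using comul_linear by (simp add: linear_on_def)

lemma rep_subset: "set (rep h) \<subseteq> C \<times> C"
  and comul_rep: "\<Delta> (\<pi> h) = (\<Sum>(u, v)\<leftarrow>rep h. tensor s s u v)"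
  using someI_ex[OF tensor_space_sum_list[OF vector_space_axioms subspace_C comul_in[OF proj_in]]]
  by (simp_all add: rep_def)

lemma sw_cong:
  assumes "h = h'" "\<And>u v. u \<in> C \<Longrightarrow> v \<in> C \<Longrightarrow> f u v = g u v"
  shows "sw h f = sw h' g"
proof -
  have "f (fst z) (snd z) = g (fst z) (snd z)" if "z \<in> set (rep h')" for z
    using that rep_subset[of h'] assms(2) by auto
  then show ?thesis by (simp add: sw_rep assms(1) cong: map_cong)
qed

lemma sw_add: "sw h (\<lambda>u v. f u v + g u v) = sw h f + sw h g"
  by (simp add: sw_rep sum_list_addf)

lemma sw_scale:
  assumes "vector_space t"
  shows "sw h (\<lambda>u v. t c (f u v)) = t c (sw h f)"
proof -
  interpret t: vector_space t by fact
  have "(\<Sum>z\<leftarrow>zs. t c (f (fst z) (snd z))) = t c (\<Sum>z\<leftarrow>zs. f (fst z) (snd z))" for zs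
    by (induction zs) (simp_all add: t.scale_right_distrib)
  then show ?thesis by (simp add: sw_rep)
qed

lemma sw_in_subspace:
  assumes "vector_space t" "module.subspace t U"
    and "\<And>u v. u \<in> C \<Longrightarrow> v \<in> C \<Longrightarrow> F u v \<in> U"
  shows "sw h F \<in> U"
proof -
  have "F (fst z) (snd z) \<in> U" if "z \<in> set (rep h)" for z
    using that rep_subset[of h] assms(3) by auto
  then show ?thesis
    unfolding sw_rep by (intro sum_list_in_subspace[OF assms(1,2)])
qed

lemma linear_on_sw:
  assumes "vector_space t" "module.subspace t U" "linear_on t r U W f"
    and "\<And>u v. u \<in> C \<Longrightarrow> v \<in> C \<Longrightarrow> F u v \<in> U"
  shows "f (sw h F) = sw h (\<lambda>u v. f (F u v))"
proof -
  have "F (fst z) (snd z) \<in> U" if "z \<in> set (rep h)" for z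
    using that rep_subset[of h] assms(4) by auto
  from linear_on_sum_list[OF assms(1-3), of "rep h" "\<lambda>z. F (fst z) (snd z)", OF this] show ?thesis
    unfolding sw_rep by blast
qed

lemma lin_sw:
  assumes "lin t r f"
  shows "f (sw h F) = sw h (\<lambda>u v. f (F u v))"
proof -
  have "f (\<Sum>z\<leftarrow>zs. F (fst z) (snd z)) = (\<Sum>z\<leftarrow>zs. f (F (fst z) (snd z)))" for zs
    using assms lin_0[OF assms] by (induction zs) (simp_all add: lin_def)
  then show ?thesis by (simp add: sw_rep)
qed

lemma sw_linear:
  assumes "vector_space t" "bil s s t f"
  shows "lin s t (\<lambda>h. sw h f)"
proof -
  interpret t: vector_space t by fact
  have *: "linear_on tensor_scale t (tensor_space s s C C) UNIV (tensor_lift s s C C f)"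
    using linear_on_tensor_lift[OF vector_space_axioms vector_space_axioms assms(1)
        subspace_C subspace_C t.subspace_UNIV bil_imp_bilinear_on[OF assms(2)]] .
  show ?thesis
    using * comul_linear by (simp add: sw_def sweedler_def lin_def linear_on_def)
qed

lemma sw_simps:
  assumes "vector_space t"
  shows "sw h (\<lambda>u v. f u v + g u v) = sw h f + sw h g"
    and "sw h (\<lambda>u v. t c (f u v)) = t c (sw h f)"
    and "bil s s t f \<Longrightarrow> sw (x + y) f = sw x f + sw y f"
    and "bil s s t f \<Longrightarrow> sw (s c x) f = t c (sw x f)"
  using sw_add sw_scale[OF assms] sw_linear[OF assms] by (simp_all add: lin_def)

lemma sw_proj_proj: "sw h (\<lambda>u v. f (\<pi> u) (\<pi> v)) = sw h f"
  by (rule sw_cong) simp_all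

text \<open>The axiom \<open>coassoc\<close> is an equation in the triple tensor product. It is
  transported along the linear map \<open>\<phi>\<close> induced by the trilinear \<open>f\<close>,
  obtained by lifting twice: \<open>L u\<close> lifts \<open>f u\<close>, and \<open>\<phi>\<close>
  lifts \<open>L\<close>.\<close>

lemma sw_coassoc:
  assumes "vector_space t" and f: "tril s s s t f"
  shows "sw h (\<lambda>x y. sw x (\<lambda>u v. f u v y)) = sw h (\<lambda>x y. sw y (\<lambda>u v. f x u v))"
proof -
  interpret t: vector_space t by fact
  let ?CC = "tensor_space s s C C"
  define L where "L = (\<lambda>u. tensor_lift s s C C (f u))"
  have "bil s s t (f u)" for u using f by (simp add: multilin_defs)
  note bf = bil_imp_bilinear_on[OF this]
  have L1: "linear_on tensor_scale t ?CC UNIV (L u)" for u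
    unfolding L_def
    by (rule linear_on_tensor_lift[OF vector_space_axioms vector_space_axioms assms(1)
        subspace_C subspace_C t.subspace_UNIV bf])
  \<comment> \<open>Linearity in \<open>u\<close> survives the choice inside
    \<open>tensor_lift\<close>, since the chosen list depends on \<open>w\<close> alone and is the
    same for all \<open>u\<close>.\<close>
  have L2: "linear_on s t C UNIV (\<lambda>u. L u w)" for w
  proof -
    have add: "f (x + y) u v = f x u v + f y u v" and scale: "f (s c x) u v = t c (f x u v)"
      for x y c u v using f by (simp_all add: multilin_defs)
    have "t c (\<Sum>(u, v)\<leftarrow>zs. f x u v) = (\<Sum>(u, v)\<leftarrow>zs. t c (f x u v))" for c x zs
      by (induction zs) (auto simp: t.scale_right_distrib)
    then show ?thesis
      by (simp add: linear_on_def L_def tensor_lift_def add scale Let_def case_prod_unfold sum_list_addf)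
  qed
  have bL: "bilinear_on s tensor_scale t C ?CC UNIV L"
    using L1 L2 by (simp add: bilinear_on_def)
  define \<phi> where "\<phi> = tensor_lift s tensor_scale C ?CC L"
  let ?T = "tensor_space s tensor_scale C ?CC"
  have \<phi>: "linear_on tensor_scale t ?T UNIV \<phi>"
    unfolding \<phi>_def
    by (rule linear_on_tensor_lift[OF vector_space_axioms vector_space_tensor_scale assms(1)
        subspace_C subspace_tensor_space t.subspace_UNIV bL])
  have \<phi>t: "\<phi> (tensor s tensor_scale u w) = L u w" if "u \<in> C" "w \<in> ?CC" for u w
    unfolding \<phi>_def
    by (rule tensor_lift_tensor[OF vector_space_axioms vector_space_tensor_scale assms(1)
        subspace_C subspace_tensor_space bL that])
  have Lt: "L x (tensor s s u v) = f x u v" if "u \<in> C" "v \<in> C" for x u v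
    unfolding L_def
    by (rule tensor_lift_tensor[OF vector_space_axioms vector_space_axioms assms(1)
        subspace_C subspace_C bf that])
  note sub = vector_space_tensor_scale subspace_tensor_space
  have eq: "sw h (\<lambda>x y. sw x (\<lambda>u v. tensor s tensor_scale u (tensor s s v y)))
      = sw h (\<lambda>x y. tensor s tensor_scale x (\<Delta> y))"
    using coassoc[of "\<pi> h"] by (simp add: sweedler_eq_sw cong: sw_cong)
  have "\<phi> (sw h (\<lambda>x y. sw x (\<lambda>u v. tensor s tensor_scale u (tensor s s v y))))
      = sw h (\<lambda>x y. \<phi> (sw x (\<lambda>u v. tensor s tensor_scale u (tensor s s v y))))"
    by (intro linear_on_sw[OF sub \<phi>] sw_in_subspace[OF sub] tensor_in_tensor_space)
  also have "\<dots> = sw h (\<lambda>x y. sw x (\<lambda>u v. f u v y))"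
    by (simp add: linear_on_sw[OF sub \<phi>] tensor_in_tensor_space \<phi>t Lt cong: sw_cong)
  finally have 1: "\<phi> (sw h (\<lambda>x y. sw x (\<lambda>u v. tensor s tensor_scale u (tensor s s v y))))
    = sw h (\<lambda>x y. sw x (\<lambda>u v. f u v y))" .
  have "\<phi> (sw h (\<lambda>x y. tensor s tensor_scale x (\<Delta> y)))
     = sw h (\<lambda>x y. \<phi> (tensor s tensor_scale x (\<Delta> y)))"
    by (intro linear_on_sw[OF sub \<phi>] tensor_in_tensor_space comul_in)
  also have "\<dots> = sw h (\<lambda>x y. L x (\<Delta> y))"
    by (simp add: \<phi>t comul_in cong: sw_cong)
  also have "\<dots> = sw h (\<lambda>x y. sw y (\<lambda>u v. f x u v))"
    by (intro sw_cong refl) (simp add: L_def sw_def sweedler_def)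
  finally show ?thesis using 1 eq by simp
qed

lemma cou_linear [simp]: "cou (x + y) = cou x + cou y" "cou (s c x) = c * cou x"
  using counit_linear by (simp_all add: cou_def linear_on_def)

lemma sw_counit_left:
  assumes "lin s t f"
  shows "sw h (\<lambda>u v. t (cou u) (f v)) = f (\<pi> h)"
proof -
  have "f (\<pi> h) = f (sw h (\<lambda>x y. s (cou x) y))"
    using counit_left[of "\<pi> h"] by (simp add: sweedler_eq_sw counit_eq_cou cong: sw_cong)
  also have "\<dots> = sw h (\<lambda>u v. t (cou u) (f v))"
    unfolding lin_sw[OF assms] using assms by (simp add: lin_def)
  finally show ?thesis ..
qed

lemma sw_counit_right:
  assumes "lin s t f"
  shows "sw h (\<lambda>u v. t (cou v) (f u)) = f (\<pi> h)"
proof -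
  have "f (\<pi> h) = f (sw h (\<lambda>x y. s (cou y) x))"
    using counit_right[of "\<pi> h"] by (simp add: sweedler_eq_sw counit_eq_cou cong: sw_cong)
  also have "\<dots> = sw h (\<lambda>u v. t (cou v) (f u))"
    unfolding lin_sw[OF assms] using assms by (simp add: lin_def)
  finally show ?thesis ..
qed

end

text \<open>Both sides are finite double sums over fixed lists, so the order of summation can be
  exchanged whatever \<open>F\<close> is.\<close>

lemma sw_commute:
  assumes "coalgebra s C \<Delta> \<epsilon>" "coalgebra s' C' \<Delta>' \<epsilon>'"
  shows "coalgebra.sw s C \<Delta> h (\<lambda>u v. coalgebra.sw s' C' \<Delta>' g (F u v))
    = coalgebra.sw s' C' \<Delta>' g (\<lambda>x y. coalgebra.sw s C \<Delta> h (\<lambda>u v. F u v x y))"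
  by (simp add: coalgebra.sw_rep[OF assms(1)] coalgebra.sw_rep[OF assms(2)]
      sum_list_sum_list_commute[of _ "coalgebra.rep s C \<Delta> h"])

section \<open>Graded Hopf quasigroups\<close>

context quasigroup
begin

text \<open>As rewrite rules these do the grading bookkeeping: both sides of each antipode law end
  up in the same component only after such an index has been simplified.\<close>

lemma qinv_simps [simp]:
  shows "qmul Q (qinv Q p) (qmul Q p q) = q"
    and "qmul Q (qmul Q q p) (qinv Q p) = q"
    and "qmul Q p (qinv Q p) = qone Q"
    and "qmul Q (qinv Q p) p = qone Q"
    and "qinv Q (qinv Q p) = p"
    and "qmul Q p (qmul Q (qinv Q p) q) = q"
    and "qmul Q (qmul Q q (qinv Q p)) p = q"
    and "qmul Q (qone Q) q = q"
    and "qmul Q q (qone Q) = q"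
proof -
  show 1: "qmul Q (qinv Q p) (qmul Q p q) = q" "qmul Q (qmul Q q p) (qinv Q p) = q" for p q
    using is_qinv_qinv by (simp_all add: is_qinv_def)
  show 2: "qmul Q p (qinv Q p) = qone Q" "qmul Q (qinv Q p) p = qone Q" for p
    using 1(2)[of "qone Q" p] 1(1)[of p "qone Q"] by (simp_all add: qone_left qone_right)
  show 3: "qinv Q (qinv Q p) = p" for p
    using 1(1)[of "qinv Q p" p] 2(2) by (simp add: qone_right)
  show "qmul Q p (qmul Q (qinv Q p) q) = q" "qmul Q (qmul Q q (qinv Q p)) p = q"
    using 1(1)[of "qinv Q p" q] 1(2)[of q "qinv Q p"] by (simp_all add: 3)
qed (simp_all add: qone_left qone_right)

end

context graded_hopf_quasigroup
begin

sublocale comp: coalgebra "gscale H" "gspace H p" "gcomul H p" "gcounit H p" for p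
  by (rule coalg)

abbreviation pr :: "'q \<Rightarrow> 'h \<Rightarrow> 'h" where "pr p \<equiv> proj (gscale H) (gspace H p)"

definition mu :: "'q \<Rightarrow> 'q \<Rightarrow> 'h \<Rightarrow> 'h \<Rightarrow> 'h" where
  "mu p q x y = gmult H p q (pr p x) (pr q y)"

definition S :: "'q \<Rightarrow> 'h \<Rightarrow> 'h" where
  "S p x = gantipode H p (pr p x)"

abbreviation sw :: "'q \<Rightarrow> 'h \<Rightarrow> ('h \<Rightarrow> 'h \<Rightarrow> 'w::ab_group_add) \<Rightarrow> 'w" where
  "sw p \<equiv> coalgebra.sw (gscale H) (gspace H p) (gcomul H p)"

abbreviation cou :: "'q \<Rightarrow> 'h \<Rightarrow> 'k" where
  "cou p \<equiv> coalgebra.cou (gscale H) (gspace H p) (gcounit H p)"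

lemma vector_space_gscale: "vector_space (gscale H)"
  by (rule comp.vector_space_axioms)

lemma gmult_eq_mu: "x \<in> gspace H p \<Longrightarrow> y \<in> gspace H q \<Longrightarrow> gmult H p q x y = mu p q x y"
  and gantipode_eq_S: "x \<in> gspace H p \<Longrightarrow> gantipode H p x = S p x"
  by (simp_all add: mu_def S_def)

lemma gsweedler_eq_sw: "h \<in> gspace H p \<Longrightarrow> gsweedler H p h f = sw p h f"
  by (simp add: gsweedler_def comp.sweedler_eq_sw)

lemma mu_in: "qmul Q p q = r \<Longrightarrow> mu p q x y \<in> gspace H r"
  and S_in: "S p x \<in> gspace H (qinv Q p)"
  using gmult_bilinear[of p q] gantipode_linear[of p]
  by (auto simp: mu_def S_def bilinear_on_def linear_on_def)

lemma pr_mu [simp]: "qmul Q p q = r \<Longrightarrow> pr r (mu p q x y) = mu p q x y"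
  and pr_S [simp]: "pr (qinv Q p) (S p x) = S p x"
  by (simp_all add: mu_in S_in)

lemma mu_simps [simp]:
  "mu p q (pr p x) y = mu p q x y"
  "mu p q x (pr q y) = mu p q x y"
  "mu p q (x + x') y = mu p q x y + mu p q x' y"
  "mu p q x (y + y') = mu p q x y + mu p q x y'"
  "mu p q (gscale H c x) y = gscale H c (mu p q x y)"
  "mu p q x (gscale H c y) = gscale H c (mu p q x y)"
  using gmult_bilinear[of p q] by (simp_all add: mu_def bilinear_on_def linear_on_def)

lemma S_simps [simp]:
  "S p (pr p x) = S p x"
  "S p (x + x') = S p x + S p x'"
  "S p (gscale H c x) = gscale H c (S p x)"
  using gantipode_linear[of p] by (simp_all add: S_def linear_on_def)

lemma gscale_simps [simp]:
  "gscale H c (x + y) = gscale H c x + gscale H c y"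
  by (rule comp.scale_right_distrib)

lemma pr_gone [simp]: "pr (qone Q) (gone H) = gone H"
  by (simp add: gone_in)

lemma mu_gone [simp]: "mu (qone Q) p (gone H) h = pr p h" "mu p (qone Q) h (gone H) = pr p h"
  by (simp_all add: mu_def gone_left gone_right)

lemma cou_mu [simp]: "qmul Q p q = r \<Longrightarrow> cou r (mu p q x y) = cou p x * cou q y"
  using gcounit_gmult[of "pr p x" p "pr q y" q] mu_in[of p q r x y]
  by (simp add: mu_def comp.counit_eq_cou)

lemma cou_gone [simp]: "cou (qone Q) (gone H) = 1"
  using gcounit_gone by (simp add: comp.counit_eq_cou gone_in)

lemma sw_eq_tensor_lift:
  "h \<in> gspace H p \<Longrightarrow>
    sw p h f = tensor_lift (gscale H) (gscale H) (gspace H p) (gspace H p) f (gcomul H p h)"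
  by (simp add: comp.sw_def sweedler_def)

context
  fixes t :: "'k \<Rightarrow> 'w::ab_group_add \<Rightarrow> 'w"
  assumes t: "vector_space t"
begin

text \<open>The lift of \<open>f\<close> is applied to \<open>gcomul_gmult\<close> and pulled
  through both sums. The index \<open>r\<close> is kept as a variable so that the rule also matches
  once the product index has been rewritten, for instance to \<open>qone Q\<close>.\<close>

lemma sw_mu:
  assumes f: "bil (gscale H) (gscale H) t f" and r: "qmul Q p q = r"
  shows "sw r (mu p q h g) f = sw p h (\<lambda>h1 h2. sw q g (\<lambda>g1 g2. f (mu p q h1 g1) (mu p q h2 g2)))"
proof -
  let ?L = "tensor_lift (gscale H) (gscale H) (gspace H r) (gspace H r) f"
  let ?T = "tensor (gscale H) (gscale H)"
  note bf = bil_imp_bilinear_on[OF f]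
  interpret t: vector_space t by (rule t)
  note sub = vector_space_tensor_scale subspace_tensor_space
  note vs = vector_space_gscale vector_space_gscale t comp.subspace_C comp.subspace_C
  have L: "linear_on tensor_scale t (tensor_space (gscale H) (gscale H) (gspace H r) (gspace H r)) UNIV ?L"
    by (rule linear_on_tensor_lift[OF vs t.subspace_UNIV bf])
  have LT: "?L (?T x y) = f x y" if "x \<in> gspace H r" "y \<in> gspace H r" for x y
    by (rule tensor_lift_tensor[OF vs bf that])
  have "gcomul H r (mu p q h g)
      = sw p h (\<lambda>h1 h2. sw q g (\<lambda>g1 g2. ?T (gmult H p q h1 g1) (gmult H p q h2 g2)))"
    using gcomul_gmult[of "pr p h" p "pr q g" q] r by (simp add: mu_def gsweedler_eq_sw)
  also have "\<dots> = sw p h (\<lambda>h1 h2. sw q g (\<lambda>g1 g2. ?T (mu p q h1 g1) (mu p q h2 g2)))"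
    by (intro comp.sw_cong refl) (simp add: gmult_eq_mu)
  finally have "sw r (mu p q h g) f
      = ?L (sw p h (\<lambda>h1 h2. sw q g (\<lambda>g1 g2. ?T (mu p q h1 g1) (mu p q h2 g2))))"
    by (simp add: sw_eq_tensor_lift mu_in r)
  also have "\<dots> = sw p h (\<lambda>h1 h2. ?L (sw q g (\<lambda>g1 g2. ?T (mu p q h1 g1) (mu p q h2 g2))))"
    by (intro comp.linear_on_sw[OF sub L] comp.sw_in_subspace[OF sub] tensor_in_tensor_space mu_in r)
  also have "\<dots> = sw p h (\<lambda>h1 h2. sw q g (\<lambda>g1 g2. ?L (?T (mu p q h1 g1) (mu p q h2 g2))))"
    by (intro comp.sw_cong refl comp.linear_on_sw[OF sub L] tensor_in_tensor_space mu_in r)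
  also have "\<dots> = sw p h (\<lambda>h1 h2. sw q g (\<lambda>g1 g2. f (mu p q h1 g1) (mu p q h2 g2)))"
    by (simp add: LT mu_in r)
  finally show ?thesis .
qed

lemma sw_gone:
  assumes f: "bil (gscale H) (gscale H) t f"
  shows "sw (qone Q) (gone H) f = f (gone H) (gone H)"
  using tensor_lift_tensor[OF vector_space_gscale vector_space_gscale t comp.subspace_C comp.subspace_C
      bil_imp_bilinear_on[OF f] gone_in gone_in]
  by (simp add: sw_eq_tensor_lift gone_in gcomul_gone)

text \<open>The linear map \<open>f\<close> is the surrounding expression: as the two legs occur
  only inside the bracket, it can be moved out of the sum, where the axiom applies. The other three
  laws are prepared in the same way.\<close>

lemma sw_antipode1:
  assumes "lin (gscale H) t f"
  shows "sw p h (\<lambda>h1 h2. f (mu (qinv Q p) (qmul Q p q) (S p h1) (mu p q h2 g)))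
    = t (cou p h) (f (pr q g))"
proof -
  have "sw p h (\<lambda>h1 h2. mu (qinv Q p) (qmul Q p q) (S p h1) (mu p q h2 g))
      = gscale H (cou p h) (pr q g)"
    using antipode1[of "pr p h" p "pr q g" q]
    by (simp add: gsweedler_eq_sw comp.counit_eq_cou gmult_eq_mu gantipode_eq_S S_in mu_in
        cong: comp.sw_cong)
  then show ?thesis using assms by (simp add: lin_def flip: comp.lin_sw[OF assms])
qed

lemma sw_antipode2:
  assumes "lin (gscale H) t f"
  shows "sw p h (\<lambda>h1 h2. f (mu p (qmul Q (qinv Q p) q) h1 (mu (qinv Q p) q (S p h2) g)))
    = t (cou p h) (f (pr q g))"
proof -
  have "sw p h (\<lambda>h1 h2. mu p (qmul Q (qinv Q p) q) h1 (mu (qinv Q p) q (S p h2) g))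
      = gscale H (cou p h) (pr q g)"
    using antipode2[of "pr p h" p "pr q g" q]
    by (simp add: gsweedler_eq_sw comp.counit_eq_cou gmult_eq_mu gantipode_eq_S S_in mu_in
        cong: comp.sw_cong)
  then show ?thesis using assms by (simp add: lin_def flip: comp.lin_sw[OF assms])
qed

lemma sw_antipode3:
  assumes "lin (gscale H) t f"
  shows "sw p h (\<lambda>h1 h2. f (mu (qmul Q q (qinv Q p)) p (mu q (qinv Q p) g (S p h1)) h2))
    = t (cou p h) (f (pr q g))"
proof -
  have "sw p h (\<lambda>h1 h2. mu (qmul Q q (qinv Q p)) p (mu q (qinv Q p) g (S p h1)) h2)
      = gscale H (cou p h) (pr q g)"
    using antipode3[of "pr p h" p "pr q g" q]
    by (simp add: gsweedler_eq_sw comp.counit_eq_cou gmult_eq_mu gantipode_eq_S S_in mu_in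
        cong: comp.sw_cong)
  then show ?thesis using assms by (simp add: lin_def flip: comp.lin_sw[OF assms])
qed

lemma sw_antipode4:
  assumes "lin (gscale H) t f"
  shows "sw p h (\<lambda>h1 h2. f (mu (qmul Q q p) (qinv Q p) (mu q p g h1) (S p h2)))
    = t (cou p h) (f (pr q g))"
proof -
  have "sw p h (\<lambda>h1 h2. mu (qmul Q q p) (qinv Q p) (mu q p g h1) (S p h2))
      = gscale H (cou p h) (pr q g)"
    using antipode4[of "pr p h" p "pr q g" q]
    by (simp add: gsweedler_eq_sw comp.counit_eq_cou gmult_eq_mu gantipode_eq_S S_in mu_in
        cong: comp.sw_cong)
  then show ?thesis using assms by (simp add: lin_def flip: comp.lin_sw[OF assms])
qed

end

section \<open>Compatibility of the antipode of \<open>H\<close> with counit and coproduct\<close>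

text \<open>Apply the counit to S(h1)(h2 1) = eps(h) 1; multiplicativity of the counit leaves
  eps(S(h1)) eps(h2), which the counit law contracts to eps(S(h)).\<close>

lemma cou_S [simp]: "cou (qinv Q p) (S p h) = cou p h"
proof -
  have "cou p h = sw p h (\<lambda>h1 h2. cou (qone Q) (mu (qinv Q p) p (S p h1) h2))"
    using sw_antipode1[OF vector_space_field_mult, of "cou (qone Q)" p h "qone Q" "gone H"]
    by (simp add: lin_def)
  also have "\<dots> = sw p h (\<lambda>h1 h2. cou p h2 * cou (qinv Q p) (S p h1))"
    by (simp add: mult.commute)
  also have "\<dots> = cou (qinv Q p) (S p h)"
    using comp.sw_counit_right[of "(*)" "\<lambda>x. cou (qinv Q p) (S p x)" p h] by (simp add: lin_def)
  finally show ?thesis ..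
qed

text \<open>Evaluate \<open>(S(h\<^sub>1)\<^sub>1 h\<^sub>2) S(h\<^sub>5) \<otimes> (S(h\<^sub>1)\<^sub>2 h\<^sub>3) S(h\<^sub>4)\<close> in two ways.\<close>

lemma sw_S:
  assumes t: "vector_space t" and f: "bil (gscale H) (gscale H) t f"
  shows "sw (qinv Q p) (S p h) f = sw p h (\<lambda>x y. f (S p y) (S p x))"
proof -
  interpret t: vector_space t by (rule t)
  let ?e = "qone Q" and ?r = "qinv Q p"
  have f_simps: "f (x + y) z = f x z + f y z" "f x (y + z) = f x y + f x z"
    "f (gscale H c x) y = t c (f x y)" "f x (gscale H c y) = t c (f x y)" for x y z c
    using f by (simp_all add: multilin_defs)
  note lins = multilin_defs f_simps comp.sw_simps[OF t] t.scale_right_distrib t.scale_left_distrib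
    mult.commute mult.left_commute
  \<comment> \<open>\<open>a\<close> and \<open>b\<close> hold the partial products in the two
    tensor slots. The reversed order of \<open>h4\<close> and \<open>h5\<close> is the coproduct
    sought for S, and it appears when \<open>a\<close> and \<open>b\<close> are both the
    unit.\<close>
  define G where "G = (\<lambda>a b k. sw p k (\<lambda>h4 h5. f (mu ?e ?r a (S p h5)) (mu ?e ?r b (S p h4))))"
  define X where "X = sw p h (\<lambda>h1 k. sw ?r (S p h1) (\<lambda>a b.
    sw p k (\<lambda>h2 k2. sw p k2 (\<lambda>h3 k3. G (mu ?r p a h2) (mu ?r p b h3) k3))))"
  have anti4: "sw p k (\<lambda>x y. F (mu ?e ?r (mu ?r p b x) (S p y))) = t (cou p k) (F (pr ?r b))"
    if "lin (gscale H) t F" for F k b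
    using sw_antipode4[OF t that, of p k ?r b] by simp
  have anti1: "sw p k (\<lambda>x y. F (mu ?r p (S p x) y)) = t (cou p k) (F (gone H))"
    if "lin (gscale H) t F" for F k
    using sw_antipode1[OF t that, of p k ?e "gone H"] by simp
  \<comment> \<open>First evaluation, from the inside: h3 and S(h4) stand side by side in the second
    slot and cancel by the fourth antipode law. This leaves h2 next to S(h5) in the first slot,
    where the same law cancels them.\<close>
  have "sw p k2 (\<lambda>h3 k3. G a (mu ?r p b h3) k3)
      = f (mu ?e ?r a (S p k2)) (pr ?r b)" for a b k2
  proof -
    have "sw p k2 (\<lambda>h3 k3. G a (mu ?r p b h3) k3)
      = sw p k2 (\<lambda>k3 h5. sw p k3 (\<lambda>h3 h4. f (mu ?e ?r a (S p h5)) (mu ?e ?r (mu ?r p b h3) (S p h4))))"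
      unfolding G_def by (rule comp.sw_coassoc[OF t, symmetric]) (simp add: lins)
    also have "\<dots> = sw p k2 (\<lambda>k3 h5. t (cou p k3) (f (mu ?e ?r a (S p h5)) (pr ?r b)))"
      by (subst anti4) (simp_all add: lins)
    also have "\<dots> = f (mu ?e ?r a (S p k2)) (pr ?r b)"
      by (subst comp.sw_counit_left) (simp_all add: lins)
    finally show ?thesis .
  qed
  then have "X = sw p h (\<lambda>h1 k. sw ?r (S p h1) (\<lambda>a b.
    sw p k (\<lambda>h2 k2. f (mu ?e ?r (mu ?r p a h2) (S p k2)) (pr ?r b))))"
    by (simp add: X_def)
  also have "\<dots> = sw p h (\<lambda>h1 k. sw ?r (S p h1) (\<lambda>a b. t (cou p k) (f (pr ?r a) (pr ?r b))))"
    by (subst anti4[of "\<lambda>x. f x (pr ?r b)" for b]) (simp_all add: lins)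
  also have "\<dots> = sw p h (\<lambda>h1 k. t (cou p k) (sw ?r (S p h1) f))"
    by (simp add: comp.sw_scale[OF t] comp.sw_proj_proj)
  also have "\<dots> = sw ?r (S p h) f"
    using f by (subst comp.sw_counit_right) (simp_all add: lins)
  finally have 1: "X = sw ?r (S p h) f" .
  \<comment> \<open>Second evaluation: h2 and h3 are made the coproduct of one leg \<open>m\<close>.
    Multiplicativity then assembles the coproduct of S(h1) m, and the first antipode law turns S(h1)
    m into the unit.\<close>
  have "X = sw p h (\<lambda>h1 k. sw ?r (S p h1) (\<lambda>a b.
    sw p k (\<lambda>m k3. sw p m (\<lambda>h2 h3. G (mu ?r p a h2) (mu ?r p b h3) k3))))"
    unfolding X_def G_def by (subst comp.sw_coassoc[OF t]) (simp_all add: lins)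
  also have "\<dots> = sw p h (\<lambda>h1 k. sw p k (\<lambda>m k3. sw ?r (S p h1) (\<lambda>a b.
    sw p m (\<lambda>h2 h3. G (mu ?r p a h2) (mu ?r p b h3) k3))))"
    by (subst sw_commute[OF coalg coalg]) (rule refl)
  also have "\<dots> = sw p h (\<lambda>h1 k. sw p k (\<lambda>m k3. sw ?e (mu ?r p (S p h1) m) (\<lambda>x y. G x y k3)))"
    unfolding G_def by (subst sw_mu[OF t]) (simp_all add: lins)
  also have "\<dots> = sw p h (\<lambda>n k3. sw p n (\<lambda>h1 m. sw ?e (mu ?r p (S p h1) m) (\<lambda>x y. G x y k3)))"
    unfolding G_def by (subst comp.sw_coassoc[OF t]) (simp_all add: lins)
  also have "\<dots> = sw p h (\<lambda>n k3. t (cou p n) (sw ?e (gone H) (\<lambda>x y. G x y k3)))"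
    unfolding G_def by (subst anti1) (simp_all add: lins)
  also have "\<dots> = sw p h (\<lambda>n k3. t (cou p n) (G (gone H) (gone H) k3))"
    unfolding G_def by (subst sw_gone[OF t]) (simp_all add: lins)
  also have "\<dots> = G (gone H) (gone H) h"
    unfolding G_def by (subst comp.sw_counit_left) (simp_all add: lins)
  also have "\<dots> = sw p h (\<lambda>x y. f (S p y) (S p x))"
    by (simp add: G_def)
  finally show ?thesis using 1 by simp
qed

end

section \<open>Quasimodule Hopf quasigroups\<close>

context hopf_quasigroup
begin

sublocale aco: coalgebra "ascale A" UNIV "acomul A" "acounit A"
  by (rule acoalg)

abbreviation asw :: "'a \<Rightarrow> ('a \<Rightarrow> 'a \<Rightarrow> 'w::ab_group_add) \<Rightarrow> 'w" where
  "asw \<equiv> coalgebra.sw (ascale A) UNIV (acomul A)"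

abbreviation acou :: "'a \<Rightarrow> 'k" where
  "acou \<equiv> coalgebra.cou (ascale A) UNIV (acounit A)"

lemma vector_space_ascale: "vector_space (ascale A)"
  by (rule aco.vector_space_axioms)

lemma asweedler_eq_asw: "asweedler A a f = asw a f"
  by (simp add: asweedler_def aco.sweedler_eq_sw)

lemma acounit_eq_acou: "acounit A a = acou a"
  by (simp add: aco.counit_eq_cou)

lemma ascale_simps [simp]:
  "ascale A c (x + y) = ascale A c x + ascale A c y"
  by (rule aco.scale_right_distrib)

lemma amult_simps [simp]:
  "amult A (x + x') y = amult A x y + amult A x' y"
  "amult A x (y + y') = amult A x y + amult A x y'"
  "amult A (ascale A c x) y = ascale A c (amult A x y)"
  "amult A x (ascale A c y) = ascale A c (amult A x y)"
  "amult A (aone A) x = x"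
  "amult A x (aone A) = x"
  using amult_bilinear by (simp_all add: bilinear_on_def linear_on_def aone_left aone_right)

lemma aantipode_simps [simp]:
  "aantipode A (x + y) = aantipode A x + aantipode A y"
  "aantipode A (ascale A c x) = ascale A c (aantipode A x)"
  using aantipode_linear by (simp_all add: linear_on_def)

lemma acou_simps [simp]:
  "acou (amult A a b) = acou a * acou b"
  "acou (aone A) = 1"
  using acounit_amult acounit_aone by (simp_all add: acounit_eq_acou)

lemma asw_eq_tensor_lift: "asw a f = tensor_lift (ascale A) (ascale A) UNIV UNIV f (acomul A a)"
  by (simp add: aco.sw_def sweedler_def)

context
  fixes t :: "'k \<Rightarrow> 'w::ab_group_add \<Rightarrow> 'w"
  assumes t: "vector_space t"
begin

lemma asw_lift:
  assumes f: "bil (ascale A) (ascale A) t f"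
  shows "linear_on tensor_scale t (tensor_space (ascale A) (ascale A) UNIV UNIV) UNIV
      (tensor_lift (ascale A) (ascale A) UNIV UNIV f)"
    and "tensor_lift (ascale A) (ascale A) UNIV UNIV f (tensor (ascale A) (ascale A) x y) = f x y"
proof -
  note bf = bil_imp_bilinear_on[OF f]
  interpret t: vector_space t by (rule t)
  note vs = vector_space_ascale vector_space_ascale t aco.subspace_C aco.subspace_C
  show "linear_on tensor_scale t (tensor_space (ascale A) (ascale A) UNIV UNIV) UNIV
      (tensor_lift (ascale A) (ascale A) UNIV UNIV f)"
    by (rule linear_on_tensor_lift[OF vs t.subspace_UNIV bf])
  show "tensor_lift (ascale A) (ascale A) UNIV UNIV f (tensor (ascale A) (ascale A) x y) = f x y"
    by (rule tensor_lift_tensor[OF vs bf]) simp_all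
qed

lemma asw_amult:
  assumes f: "bil (ascale A) (ascale A) t f"
  shows "asw (amult A a b) f
    = asw a (\<lambda>a1 a2. asw b (\<lambda>b1 b2. f (amult A a1 b1) (amult A a2 b2)))"
proof -
  let ?L = "tensor_lift (ascale A) (ascale A) UNIV UNIV f"
  let ?T = "tensor (ascale A) (ascale A)"
  note sub = vector_space_tensor_scale subspace_tensor_space
  note L = asw_lift[OF f]
  have "asw (amult A a b) f
      = ?L (asw a (\<lambda>a1 a2. asw b (\<lambda>b1 b2. ?T (amult A a1 b1) (amult A a2 b2))))"
    by (simp add: asw_eq_tensor_lift[of "amult A a b"] acomul_amult asweedler_eq_asw)
  also have "\<dots> = asw a (\<lambda>a1 a2. ?L (asw b (\<lambda>b1 b2. ?T (amult A a1 b1) (amult A a2 b2))))"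
    by (intro aco.linear_on_sw[OF sub L(1)] aco.sw_in_subspace[OF sub] tensor_in_tensor_space UNIV_I)
  also have "\<dots> = asw a (\<lambda>a1 a2. asw b (\<lambda>b1 b2. ?L (?T (amult A a1 b1) (amult A a2 b2))))"
    by (intro aco.sw_cong refl aco.linear_on_sw[OF sub L(1)] tensor_in_tensor_space UNIV_I)
  finally show ?thesis by (simp add: L(2))
qed

lemma asw_aone:
  assumes f: "bil (ascale A) (ascale A) t f"
  shows "asw (aone A) f = f (aone A) (aone A)"
  by (simp add: asw_eq_tensor_lift acomul_aone asw_lift(2)[OF f])

lemma asw_antipode:
  assumes "lin (ascale A) t f"
  shows "asw a (\<lambda>a1 a2. f (amult A (aantipode A a1) (amult A a2 b))) = t (acou a) (f b)"
    and "asw a (\<lambda>a1 a2. f (amult A a1 (amult A (aantipode A a2) b))) = t (acou a) (f b)"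
    and "asw a (\<lambda>a1 a2. f (amult A (amult A b a1) (aantipode A a2))) = t (acou a) (f b)"
    and "asw a (\<lambda>a1 a2. f (amult A (amult A b (aantipode A a1)) a2)) = t (acou a) (f b)"
  using aantipode1[of a b] aantipode2[of a b] aantipode3[of a b] aantipode4[of a b] assms
  by (simp_all add: lin_def asweedler_eq_asw acounit_eq_acou flip: aco.lin_sw[OF assms])

end

end

context quasimodule
begin

definition ac :: "'q \<Rightarrow> 'h \<Rightarrow> 'm \<Rightarrow> 'm" where
  "ac p x m = act p (pr p x) m"

lemma act_eq_ac: "h \<in> gspace H p \<Longrightarrow> act p h m = ac p h m"
  by (simp add: ac_def)

lemma ac_simps [simp]:
  "ac p (pr p x) m = ac p x m"
  "ac p (x + y) m = ac p x m + ac p y m"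
  "ac p x (m + n) = ac p x m + ac p x n"
  "ac p (gscale H c x) m = s c (ac p x m)"
  "ac p x (s c m) = s c (ac p x m)"
  "ac (qone Q) (gone H) m = m"
  using act_bilinear[of p]
  by (simp_all add: ac_def bilinear_on_def linear_on_def act_gone)

lemma sw_ac_antipode:
  assumes "lin s t f"
  shows "sw p h (\<lambda>h1 h2. f (ac (qinv Q p) (S p h1) (ac p h2 m))) = t (cou p h) (f m)"
    and "sw p h (\<lambda>h1 h2. f (ac p h1 (ac (qinv Q p) (S p h2) m))) = t (cou p h) (f m)"
proof -
  have "sw p h (\<lambda>h1 h2. ac (qinv Q p) (S p h1) (ac p h2 m)) = s (cou p h) m"
    "sw p h (\<lambda>h1 h2. ac p h1 (ac (qinv Q p) (S p h2) m)) = s (cou p h) m"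
    using act_antipode1[of "pr p h" p m] act_antipode2[of "pr p h" p m]
    by (simp_all add: gsweedler_eq_sw comp.counit_eq_cou act_eq_ac gantipode_eq_S S_in
        cong: comp.sw_cong)
  then show "sw p h (\<lambda>h1 h2. f (ac (qinv Q p) (S p h1) (ac p h2 m))) = t (cou p h) (f m)"
    "sw p h (\<lambda>h1 h2. f (ac p h1 (ac (qinv Q p) (S p h2) m))) = t (cou p h) (f m)"
    using assms by (simp_all add: lin_def flip: comp.lin_sw[OF assms])
qed

end

context quasimodule_hopf_quasigroup
begin

lemma sw_asw_commute:
  "sw p h (\<lambda>u v. asw a (F u v)) = asw a (\<lambda>x y. sw p h (\<lambda>u v. F u v x y))"
  by (rule sw_commute[OF coalg acoalg])

lemma sw_sw_commute:
  "sw p h (\<lambda>u v. sw q g (F u v)) = sw q g (\<lambda>x y. sw p h (\<lambda>u v. F u v x y))"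
  by (rule sw_commute[OF coalg coalg])

lemma ac_amult: "ac p h (amult A a b) = sw p h (\<lambda>h1 h2. amult A (ac p h1 a) (ac p h2 b))"
  using act_amult[of "pr p h" p a b]
  by (simp add: gsweedler_eq_sw ac_def cong: comp.sw_cong)

lemma sw_ac_amult:
  assumes "lin (ascale A) t f"
  shows "sw p h (\<lambda>h1 h2. f (amult A (ac p h1 a) (ac p h2 b))) = f (ac p h (amult A a b))"
  by (simp add: ac_amult comp.lin_sw[OF assms])

lemma ac_aone [simp]: "ac p h (aone A) = ascale A (cou p h) (aone A)"
  using act_aone[of "pr p h" p] by (simp add: ac_def comp.counit_eq_cou)

lemma acou_ac [simp]: "acou (ac p h a) = cou p h * acou a"
  using acounit_act[of "pr p h" p a] by (simp add: ac_def comp.counit_eq_cou acounit_eq_acou)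

lemma asw_ac:
  assumes t: "vector_space t" and f: "bil (ascale A) (ascale A) t f"
  shows "asw (ac p h a) f = sw p h (\<lambda>h1 h2. asw a (\<lambda>a1 a2. f (ac p h1 a1) (ac p h2 a2)))"
proof -
  let ?L = "tensor_lift (ascale A) (ascale A) UNIV UNIV f"
  let ?T = "tensor (ascale A) (ascale A)"
  note sub = vector_space_tensor_scale subspace_tensor_space
  note L = asw_lift[OF t f]
  have "asw (ac p h a) f
      = ?L (sw p h (\<lambda>h1 h2. asw a (\<lambda>a1 a2. ?T (ac p h1 a1) (ac p h2 a2))))"
    using acomul_act[of "pr p h" p a]
    by (simp add: asw_eq_tensor_lift[of "ac p h a"] asweedler_eq_asw gsweedler_eq_sw
        act_eq_ac cong: comp.sw_cong)
  also have "\<dots> = sw p h (\<lambda>h1 h2. ?L (asw a (\<lambda>a1 a2. ?T (ac p h1 a1) (ac p h2 a2))))"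
    by (intro comp.linear_on_sw[OF sub L(1)] aco.sw_in_subspace[OF sub] tensor_in_tensor_space UNIV_I)
  also have "\<dots> = sw p h (\<lambda>h1 h2. asw a (\<lambda>a1 a2. ?L (?T (ac p h1 a1) (ac p h2 a2))))"
    by (intro comp.sw_cong refl aco.linear_on_sw[OF sub L(1)] tensor_in_tensor_space UNIV_I)
  finally show ?thesis by (simp add: L(2))
qed

lemmas lins = multilin_defs mult.commute mult.left_commute
lemmas lins_T = lins comp.sw_simps[OF vector_space_tensor_scale]
  aco.sw_simps[OF vector_space_tensor_scale]
lemmas lins_A = lins comp.sw_simps[OF vector_space_ascale] aco.sw_simps[OF vector_space_ascale]

text \<open>Evaluate \<open>S(h\<^sub>1 \<cdot> a\<^sub>1)((h\<^sub>2 \<cdot> a\<^sub>2)(h\<^sub>3 \<cdot> S(a\<^sub>3)))\<close> in two ways.\<close>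

lemma aantipode_ac: "aantipode A (ac p h a) = ac p h (aantipode A a)"
proof -
  note t = vector_space_ascale
  let ?S = "aantipode A" and ?m = "amult A"
  define X where "X = sw p h (\<lambda>x y. asw a (\<lambda>a1 a'.
    sw p y (\<lambda>h2 h3. asw a' (\<lambda>a2 a3. ?m (?S (ac p x a1)) (?m (ac p h2 a2) (ac p h3 (?S a3)))))))"
  \<comment> \<open>Here (h2 a2)(h3 S(a3)) folds into a single action on a2 S(a3), which collapses
    by the third antipode law of \<open>A\<close> with \<open>b = aone A\<close>; only S(h a) is
    left.\<close>
  have "X = sw p h (\<lambda>x y. asw a (\<lambda>a1 a'.
    asw a' (\<lambda>a2 a3. ?m (?S (ac p x a1)) (ac p y (?m a2 (?S a3))))))"
    unfolding X_def by (simp add: sw_asw_commute sw_ac_amult[of "ascale A"] lins_A)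
  also have "\<dots> = sw p h (\<lambda>x y. asw a (\<lambda>a1 a'. ascale A (acou a') (ascale A (cou p y) (?S (ac p x a1)))))"
    using asw_antipode(3)[OF t, where b = "aone A" and f = "\<lambda>z. ?m (?S (ac p x a1)) (ac p y z)" for x y a1]
    by (simp add: lins_A)
  also have "\<dots> = sw p h (\<lambda>x y. ascale A (cou p y) (?S (ac p x a)))"
    by (subst aco.sw_counit_right) (simp_all add: lins_A)
  also have "\<dots> = ?S (ac p h a)"
    by (subst comp.sw_counit_right) (simp_all add: lins_A)
  finally have 1: "X = ?S (ac p h a)" .
  \<comment> \<open>For the other value the first two legs of h and of a are grouped instead: they
    form the coproduct of one element z = h a, and S(z1)(z2 c) = eps(z) c.\<close>
  have "X = sw p h (\<lambda>x y. sw p y (\<lambda>h2 h3. asw a (\<lambda>a1 a'. asw a' (\<lambda>a2 a3.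
    ?m (?S (ac p x a1)) (?m (ac p h2 a2) (ac p h3 (?S a3)))))))"
    unfolding X_def by (simp add: sw_asw_commute)
  also have "\<dots> = sw p h (\<lambda>x y. sw p x (\<lambda>h1 h2. asw a (\<lambda>a1 a'. asw a' (\<lambda>a2 a3.
    ?m (?S (ac p h1 a1)) (?m (ac p h2 a2) (ac p y (?S a3)))))))"
    by (rule comp.sw_coassoc[OF t, symmetric]) (simp add: lins_A)
  also have "\<dots> = sw p h (\<lambda>x y. sw p x (\<lambda>h1 h2. asw a (\<lambda>a' a3. asw a' (\<lambda>a1 a2.
    ?m (?S (ac p h1 a1)) (?m (ac p h2 a2) (ac p y (?S a3)))))))"
    by (subst aco.sw_coassoc[OF t]) (simp_all add: lins_A)
  also have "\<dots> = sw p h (\<lambda>x y. asw a (\<lambda>a' a3. asw (ac p x a') (\<lambda>z1 z2.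
    ?m (?S z1) (?m z2 (ac p y (?S a3))))))"
    by (subst asw_ac[OF t]) (simp_all add: lins_A sw_asw_commute)
  also have "\<dots> = sw p h (\<lambda>x y. asw a (\<lambda>a' a3. ascale A (acou a') (ascale A (cou p x) (ac p y (?S a3)))))"
    using asw_antipode(1)[OF t, where f = "\<lambda>z. z"] by (simp add: lins_A)
  also have "\<dots> = sw p h (\<lambda>x y. ascale A (cou p x) (ac p y (?S a)))"
    by (subst aco.sw_counit_left) (simp_all add: lins_A)
  also have "\<dots> = ac p h (?S a)"
    by (subst comp.sw_counit_left) (simp_all add: lins_A)
  finally show ?thesis using 1 by simp
qed

end

context graded_hopf_quasigroup
begin

text \<open>Of the four legs produced by splitting both halves of h, the two middle ones become the
  coproduct of one element \<open>n\<close>, so that they can be cancelled or exchanged.\<close>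

lemma sw_coassoc4:
  assumes t: "vector_space t"
    and "\<And>z u v. lin (gscale H) t (\<lambda>w. F w z u v)" "\<And>w u v. lin (gscale H) t (\<lambda>z. F w z u v)"
    and "\<And>w z v. lin (gscale H) t (\<lambda>u. F w z u v)" "\<And>w z u. lin (gscale H) t (F w z u)"
  shows "sw p h (\<lambda>x y. sw p x (\<lambda>w z. sw p y (\<lambda>u v. F w z u v)))
    = sw p h (\<lambda>w y. sw p y (\<lambda>n v. sw p n (\<lambda>z u. F w z u v)))"
proof -
  have F_simps: "F (x + y) z = (\<lambda>u v. F x z u v + F y z u v)" "F w (x + y) = (\<lambda>u v. F w x u v + F w y u v)"
    "F (gscale H c x) z = (\<lambda>u v. t c (F x z u v))" "F w (gscale H c x) = (\<lambda>u v. t c (F w x u v))"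
    for x y z w c
    using assms(2,3) by (simp_all add: lin_def fun_eq_iff)
  have "sw p h (\<lambda>x y. sw p x (\<lambda>w z. sw p y (\<lambda>u v. F w z u v)))
      = sw p h (\<lambda>w y. sw p y (\<lambda>z y'. sw p y' (\<lambda>u v. F w z u v)))"
    using assms(2-) by (intro comp.sw_coassoc[OF t]) (simp add: multilin_defs F_simps comp.sw_simps[OF t])
  also have "\<dots> = sw p h (\<lambda>w y. sw p y (\<lambda>n v. sw p n (\<lambda>z u. F w z u v)))"
    using assms(2-)
    by (intro comp.sw_cong refl comp.sw_coassoc[OF t, symmetric])
      (simp add: multilin_defs F_simps comp.sw_simps[OF t])
  finally show ?thesis .
qed

end

section \<open>Products of pure tensors\<close>

context quasimodule_hopf_quasigroup
begin

abbreviation ta :: "'a \<Rightarrow> 'h \<Rightarrow> ('a, 'h, 'k) tensor" where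
  "ta \<equiv> tensor (ascale A) (gscale H)"

abbreviation ts :: "'k \<Rightarrow> ('x, 'y, 'k) tensor \<Rightarrow> ('x, 'y, 'k) tensor" where
  "ts \<equiv> tensor_scale"

definition pmult :: "'q \<Rightarrow> 'q \<Rightarrow> 'a \<Rightarrow> 'h \<Rightarrow> 'a \<Rightarrow> 'h \<Rightarrow> ('a, 'h, 'k) tensor" where
  "pmult p q a h b g = sw p h (\<lambda>x y. ta (amult A a (ac p x b)) (mu p q y g))"

text \<open>S(h2) tensor S(h1) is the coproduct of S(h), so this is the compatibility of the action
  with products, read for the element S(h).\<close>

lemma sw_S_ac_amult:
  assumes f: "lin (ascale A) t f" and t: "vector_space t"
  shows "sw p h (\<lambda>x y. f (amult A (ac (qinv Q p) (S p y) a) (ac (qinv Q p) (S p x) b)))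
    = f (ac (qinv Q p) (S p h) (amult A a b))"
  using f sw_S[OF t, of "\<lambda>x y. f (amult A (ac (qinv Q p) x a) (ac (qinv Q p) y b))" p h]
  by (simp add: multilin_defs ac_amult comp.lin_sw[OF f])

text \<open>Coproduct of g (S(h) a): the legs of g and a keep their order, those of h come
  reversed.\<close>

lemma asw_ac_ac_S:
  assumes t: "vector_space t" and f: "bil (ascale A) (ascale A) t f"
  shows "asw (ac q g (ac (qinv Q p) (S p h) a)) f
    = sw q g (\<lambda>g1 g2. sw p h (\<lambda>h1 h2. asw a (\<lambda>a1 a2.
        f (ac q g1 (ac (qinv Q p) (S p h2) a1)) (ac q g2 (ac (qinv Q p) (S p h1) a2)))))"
  using f
  by (simp add: asw_ac[OF t] sw_S[OF t] multilin_defs comp.sw_simps[OF t] aco.sw_simps[OF t])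

section \<open>The four antipode laws on pure tensors\<close>

text \<open>The cancellations occur in the order \<open>A\<close>, action, \<open>H\<close>. Two
  legs S(h) combine to act on S(a1)(a2 (h b)), where the antipode of \<open>A\<close> disappears;
  then S(h) meets h acting on b; finally S(h)(h g) remains in the second factor.\<close>

lemma pmult_antipode1:
  "asw a (\<lambda>a1 a2. sw p h (\<lambda>x y. sw p x (\<lambda>u v. sw p y (\<lambda>w z.
     pmult (qinv Q p) (qmul Q p q) (ac (qinv Q p) (S p v) (aantipode A a1)) (S p u)
       (amult A a2 (ac p w b)) (mu p q z g)))))
   = ts (acou a * cou p h) (ta b (pr q g))" (is "?E = _")
proof -
  note t = vector_space_tensor_scale
  let ?r = "qinv Q p" and ?S = "aantipode A" and ?m = "amult A"
  let ?M = "\<lambda>i z. mu ?r (qmul Q p q) (S p i) (mu p q z g)"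
  have "?E = asw a (\<lambda>a1 a2. sw p h (\<lambda>x y. sw p x (\<lambda>u v. sw p y (\<lambda>w z. sw p u (\<lambda>i j.
      ta (?m (ac ?r (S p v) (?S a1)) (ac ?r (S p j) (?m a2 (ac p w b)))) (?M i z))))))"
    by (simp add: pmult_def sw_S[OF t] lins_T)
  also have "\<dots> = asw a (\<lambda>a1 a2. sw p h (\<lambda>x y. sw p y (\<lambda>w z. sw p x (\<lambda>u v. sw p u (\<lambda>i j.
      ta (?m (ac ?r (S p v) (?S a1)) (ac ?r (S p j) (?m a2 (ac p w b)))) (?M i z))))))"
    by (intro aco.sw_cong comp.sw_cong refl sw_sw_commute)
  \<comment> \<open>The leg \<open>i\<close> stays with the product in \<open>H\<close>, while
    \<open>j\<close> and \<open>v\<close> are joined into \<open>k\<close>, so that S(k) acts on a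
    whole product of \<open>A\<close>.\<close>
  also have "\<dots> = asw a (\<lambda>a1 a2. sw p h (\<lambda>x y. sw p y (\<lambda>w z. sw p x (\<lambda>i k. sw p k (\<lambda>j v.
      ta (?m (ac ?r (S p v) (?S a1)) (ac ?r (S p j) (?m a2 (ac p w b)))) (?M i z))))))"
    by (intro aco.sw_cong comp.sw_cong refl comp.sw_coassoc[OF t]) (simp add: lins_T)
  also have "\<dots> = asw a (\<lambda>a1 a2. sw p h (\<lambda>x y. sw p y (\<lambda>w z. sw p x (\<lambda>i k.
      ta (ac ?r (S p k) (?m (?S a1) (?m a2 (ac p w b)))) (?M i z)))))"
    using sw_S_ac_amult[OF _ t, of "\<lambda>c. ta c l" for l] by (simp add: lins_T)
  also have "\<dots> = ts (acou a) (sw p h (\<lambda>x y. sw p y (\<lambda>w z. sw p x (\<lambda>i k.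
      ta (ac ?r (S p k) (ac p w b)) (?M i z)))))"
    using asw_antipode(1)[OF t, where f = "\<lambda>c. ta (ac ?r (S p k) c) l" for k l]
    by (simp add: lins_T flip: sw_asw_commute)
  also have "sw p h (\<lambda>x y. sw p y (\<lambda>w z. sw p x (\<lambda>i k. ta (ac ?r (S p k) (ac p w b)) (?M i z))))
      = sw p h (\<lambda>x y. sw p x (\<lambda>i k. sw p y (\<lambda>w z. ta (ac ?r (S p k) (ac p w b)) (?M i z))))"
    by (intro comp.sw_cong refl sw_sw_commute)
  \<comment> \<open>The legs now run in the order i, k, w, z: the middle pair acts on
    \<open>b\<close> and cancels first, the outer pair multiplies \<open>g\<close> and cancels
    afterwards.\<close>
  also have "\<dots> = sw p h (\<lambda>i y. sw p y (\<lambda>n z. sw p n (\<lambda>k w. ta (ac ?r (S p k) (ac p w b)) (?M i z))))"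
    by (rule sw_coassoc4[OF t]) (simp_all add: lins_T)
  also have "\<dots> = sw p h (\<lambda>i y. sw p y (\<lambda>n z. ts (cou p n) (ta b (?M i z))))"
    using sw_ac_antipode(1)[where t = ts and f = "\<lambda>c. ta c l" for l] by (simp add: lins_T)
  also have "\<dots> = sw p h (\<lambda>i y. ta b (?M i y))"
    by (subst comp.sw_counit_left) (simp_all add: lins_T)
  also have "\<dots> = ts (cou p h) (ta b (pr q g))"
    by (subst sw_antipode1[OF t]) (simp_all add: lins_T)
  finally show ?thesis by (simp add: mult.commute)
qed

text \<open>The order of cancellation is the reverse of that in the first law: the middle legs of h
  form h (S(h) g) and vanish in \<open>H\<close>, the outer legs then cancel as successive actions,
  and a1 (S(a2) b) is left for the antipode of \<open>A\<close>.\<close>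

lemma pmult_antipode2:
  "asw a (\<lambda>a1 a2. sw p h (\<lambda>x y. sw p y (\<lambda>u v. sw (qinv Q p) (S p u) (\<lambda>k l.
     pmult p (qmul Q (qinv Q p) q) a1 x
       (amult A (ac (qinv Q p) (S p v) (aantipode A a2)) (ac (qinv Q p) k b)) (mu (qinv Q p) q l g)))))
   = ts (acou a * cou p h) (ta b (pr q g))" (is "?E = _")
proof -
  note t = vector_space_tensor_scale
  let ?r = "qinv Q p" and ?S = "aantipode A" and ?m = "amult A"
  let ?M = "\<lambda>z i. mu p (qmul Q ?r q) z (mu ?r q (S p i) g)"
  have "?E = asw a (\<lambda>a1 a2. sw p h (\<lambda>x y. sw p y (\<lambda>u v. sw p u (\<lambda>i j. sw p x (\<lambda>w z.
      ta (?m a1 (ac p w (?m (ac ?r (S p v) (?S a2)) (ac ?r (S p j) b)))) (?M z i))))))"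
    by (simp add: pmult_def sw_S[OF t] lins_T)
  also have "\<dots> = asw a (\<lambda>a1 a2. sw p h (\<lambda>x y. sw p y (\<lambda>i m. sw p m (\<lambda>j v. sw p x (\<lambda>w z.
      ta (?m a1 (ac p w (?m (ac ?r (S p v) (?S a2)) (ac ?r (S p j) b)))) (?M z i))))))"
    by (intro aco.sw_cong comp.sw_cong refl comp.sw_coassoc[OF t]) (simp add: lins_T)
  also have "\<dots> = asw a (\<lambda>a1 a2. sw p h (\<lambda>x y. sw p y (\<lambda>i m. sw p x (\<lambda>w z.
      ta (?m a1 (ac p w (ac ?r (S p m) (?m (?S a2) b)))) (?M z i)))))"
    using sw_S_ac_amult[OF _ t, of "\<lambda>c. sw p x (\<lambda>w z. ta (?m a1 (ac p w c)) (?M z i))" for x a1 i]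
    by (simp add: lins_T)
  also have "\<dots> = asw a (\<lambda>a1 a2. sw p h (\<lambda>x y. sw p x (\<lambda>w z. sw p y (\<lambda>i m.
      ta (?m a1 (ac p w (ac ?r (S p m) (?m (?S a2) b)))) (?M z i)))))"
    by (intro aco.sw_cong comp.sw_cong refl sw_sw_commute)
  also have "\<dots> = asw a (\<lambda>a1 a2. sw p h (\<lambda>w y. sw p y (\<lambda>n m. sw p n (\<lambda>z i.
      ta (?m a1 (ac p w (ac ?r (S p m) (?m (?S a2) b)))) (?M z i)))))"
    by (intro aco.sw_cong refl sw_coassoc4[OF t]) (simp_all add: lins_T)
  also have "\<dots> = asw a (\<lambda>a1 a2. sw p h (\<lambda>w y. sw p y (\<lambda>n m. ts (cou p n)
      (ta (?m a1 (ac p w (ac ?r (S p m) (?m (?S a2) b)))) (pr q g)))))"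
    using sw_antipode2[OF t, of "ta c" for c] by (simp add: lins_T)
  also have "\<dots> = asw a (\<lambda>a1 a2. sw p h (\<lambda>w y.
      ta (?m a1 (ac p w (ac ?r (S p y) (?m (?S a2) b)))) (pr q g)))"
    by (subst comp.sw_counit_left) (simp_all add: lins_T)
  also have "\<dots> = asw a (\<lambda>a1 a2. ts (cou p h) (ta (?m a1 (?m (?S a2) b)) (pr q g)))"
    using sw_ac_antipode(2)[where t = ts and f = "\<lambda>c. ta (?m a1 c) l" for a1 l] by (simp add: lins_T)
  also have "\<dots> = ts (acou a * cou p h) (ta b (pr q g))"
    using asw_antipode(2)[OF t, where f = "\<lambda>c. ta c l" for l] by (simp add: lins_T)
  finally show ?thesis .
qed

text \<open>The common starting point of both directions, obtained before (2) comes in: the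
  coproduct of g S(h) is multiplied out and the antipode of \<open>A\<close> is moved in front of
  the action.\<close>

lemma pmult_antipode3_expand:
  fixes a b h g p q
  defines "r \<equiv> qinv Q p" and "qr \<equiv> qmul Q q (qinv Q p)"
  shows "asw a (\<lambda>a1 a2. sw p h (\<lambda>x y. sw p x (\<lambda>u v. sw q g (\<lambda>g1 g2.
     pmult qr p (amult A b (ac q g1 (ac r (S p v) (aantipode A a1)))) (mu q r g2 (S p u)) a2 y))))
   = asw a (\<lambda>a1 a2. sw p h (\<lambda>x y. sw p x (\<lambda>u v. sw q g (\<lambda>g1 g2. sw q g2 (\<lambda>i j. sw p u (\<lambda>k l.
     ta (amult A (amult A b (aantipode A (ac q g1 (ac r (S p v) a1)))) (ac qr (mu q r i (S p l)) a2))
       (mu qr p (mu q r j (S p k)) y)))))))"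
  unfolding r_def qr_def
  by (simp add: pmult_def sw_mu[OF vector_space_tensor_scale] sw_S[OF vector_space_tensor_scale]
      lins_T aantipode_ac)

lemma pmult_antipode3:
  assumes act: "\<And>g h a. ac q g (ac (qinv Q p) (S p h) a)
    = ac (qmul Q q (qinv Q p)) (mu q (qinv Q p) g (S p h)) a"
  shows "asw a (\<lambda>a1 a2. sw p h (\<lambda>x y. sw p x (\<lambda>u v. sw q g (\<lambda>g1 g2.
     pmult (qmul Q q (qinv Q p)) p
       (amult A b (ac q g1 (ac (qinv Q p) (S p v) (aantipode A a1)))) (mu q (qinv Q p) g2 (S p u)) a2 y))))
   = ts (acou a * cou p h) (ta b (pr q g))" (is "?E = _")
proof -
  note t = vector_space_tensor_scale
  let ?r = "qinv Q p" and ?qr = "qmul Q q (qinv Q p)" and ?S = "aantipode A" and ?m = "amult A"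
  let ?a = "\<lambda>g h a. ac q g (ac ?r (S p h) a)"
  let ?M = "\<lambda>j k y. mu ?qr p (mu q ?r j (S p k)) y"
  have "?E = asw a (\<lambda>a1 a2. sw p h (\<lambda>x y. sw p x (\<lambda>u v. sw q g (\<lambda>g1 g2. sw q g2 (\<lambda>i j. sw p u (\<lambda>k l.
      ta (?m (?m b (?S (?a g1 v a1))) (?a i l a2)) (?M j k y)))))))"
    unfolding pmult_antipode3_expand by (simp only: act)
  also have "\<dots> = asw a (\<lambda>a1 a2. sw p h (\<lambda>x y. sw p x (\<lambda>u v. sw q g (\<lambda>g' j. sw q g' (\<lambda>g1 i. sw p u (\<lambda>k l.
      ta (?m (?m b (?S (?a g1 v a1))) (?a i l a2)) (?M j k y)))))))"
    by (intro aco.sw_cong comp.sw_cong refl comp.sw_coassoc[OF t, symmetric]) (simp add: lins_T)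
  also have "\<dots> = asw a (\<lambda>a1 a2. sw p h (\<lambda>x y. sw q g (\<lambda>g' j. sw q g' (\<lambda>g1 i. sw p x (\<lambda>u v. sw p u (\<lambda>k l.
      ta (?m (?m b (?S (?a g1 v a1))) (?a i l a2)) (?M j k y)))))))"
    by (simp only: sw_sw_commute[of p _ q])
  also have "\<dots> = asw a (\<lambda>a1 a2. sw p h (\<lambda>x y. sw q g (\<lambda>g' j. sw q g' (\<lambda>g1 i. sw p x (\<lambda>k w. sw p w (\<lambda>l v.
      ta (?m (?m b (?S (?a g1 v a1))) (?a i l a2)) (?M j k y)))))))"
    by (intro aco.sw_cong comp.sw_cong refl comp.sw_coassoc[OF t]) (simp add: lins_T)
  also have "\<dots> = sw p h (\<lambda>x y. sw q g (\<lambda>g' j. sw p x (\<lambda>k w. sw q g' (\<lambda>g1 i. sw p w (\<lambda>l v. asw a (\<lambda>a1 a2.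
      ta (?m (?m b (?S (?a g1 v a1))) (?a i l a2)) (?M j k y)))))))"
    unfolding sw_asw_commute by (intro aco.sw_cong comp.sw_cong refl sw_sw_commute)
  \<comment> \<open>The legs \<open>g1\<close>, \<open>i\<close> of \<open>g'\<close> and
    \<open>l\<close>, \<open>v\<close> of \<open>w\<close>, paired in opposite orders, are exactly
    those in the coproduct of \<open>?a g' w a\<close>.\<close>
  also have "\<dots> = sw p h (\<lambda>x y. sw q g (\<lambda>g' j. sw p x (\<lambda>k w. asw (?a g' w a) (\<lambda>z1 z2.
      ta (?m (?m b (?S z1)) z2) (?M j k y)))))"
    by (subst asw_ac_ac_S[OF t]) (simp_all add: lins_T)
  also have "\<dots> = sw p h (\<lambda>x y. sw q g (\<lambda>g' j. sw p x (\<lambda>k w.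
      ts (acou (?a g' w a)) (ta b (?M j k y)))))"
    using asw_antipode(4)[OF t, where f = "\<lambda>c. ta c l" for l] by (simp add: lins_T)
  also have "\<dots> = ts (acou a) (sw p h (\<lambda>x y. sw q g (\<lambda>g' j. ts (cou q g') (sw p x (\<lambda>k w.
      ts (cou p w) (ta b (?M j k y)))))))"
  proof -
    \<comment> \<open>The scalar is split in the order of the enclosing sums, so that each counit
      can be pulled out to the sum that binds its argument.\<close>
    have "ts (acou (?a g' w a)) X = ts (acou a) (ts (cou q g') (ts (cou p w) X))"
      for g' w and X :: "('a, 'h, 'k) tensor" by (simp add: mult.commute mult.left_commute)
    then show ?thesis by (simp only: comp.sw_scale[OF t])
  qed
  also have "\<dots> = ts (acou a) (sw p h (\<lambda>x y. sw q g (\<lambda>g' j. ts (cou q g') (ta b (?M j x y)))))"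
    by (subst comp.sw_counit_right) (simp_all add: lins_T)
  also have "\<dots> = ts (acou a) (sw p h (\<lambda>x y. ta b (?M g x y)))"
    by (subst comp.sw_counit_left) (simp_all add: lins_T)
  also have "\<dots> = ts (acou a * cou p h) (ta b (pr q g))"
    using sw_antipode3[OF t, of "ta b"] by (simp add: lins_T)
  finally show ?thesis .
qed

text \<open>With g h in place of g, (2) turns (g h)(S(h) c) into an action of (g h) S(h). The fourth
  antipode law of \<open>H\<close> is then used twice, for the middle legs of h in the second tensor
  factor and for the outer legs inside the action. What remains is (b z1) S(z2) with z = g
  a.\<close>

lemma pmult_antipode4:
  assumes act: "\<And>g h a. ac (qmul Q q p) g (ac (qinv Q p) (S p h) a)
    = ac (qmul Q (qmul Q q p) (qinv Q p)) (mu (qmul Q q p) (qinv Q p) g (S p h)) a"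
  shows "asw a (\<lambda>a1 a2. sw p h (\<lambda>x y. sw q g (\<lambda>g1 g2. sw p y (\<lambda>u v.
     pmult (qmul Q q p) (qinv Q p) (amult A b (ac q g1 a1)) (mu q p g2 x)
       (ac (qinv Q p) (S p v) (aantipode A a2)) (S p u)))))
   = ts (acou a * cou p h) (ta b (pr q g))" (is "?E = _")
proof -
  note t = vector_space_tensor_scale
  let ?r = "qinv Q p" and ?qp = "qmul Q q p" and ?S = "aantipode A" and ?m = "amult A"
  let ?M = "\<lambda>j z u. mu ?qp ?r (mu q p j z) (S p u)"
  let ?a = "\<lambda>i w v. ac (qmul Q ?qp ?r) (mu ?qp ?r (mu q p i w) (S p v))"
  have "?E = asw a (\<lambda>a1 a2. sw p h (\<lambda>x y. sw q g (\<lambda>g1 g2. sw p y (\<lambda>u v. sw q g2 (\<lambda>i j. sw p x (\<lambda>w z.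
      ta (?m (?m b (ac q g1 a1)) (?a i w v (?S a2))) (?M j z u)))))))"
    by (simp add: pmult_def sw_mu[OF t] lins_T act)
  also have "\<dots> = asw a (\<lambda>a1 a2. sw q g (\<lambda>g1 g2. sw q g2 (\<lambda>i j. sw p h (\<lambda>x y. sw p x (\<lambda>w z. sw p y (\<lambda>u v.
      ta (?m (?m b (ac q g1 a1)) (?a i w v (?S a2))) (?M j z u)))))))"
    unfolding sw_sw_commute[of p _ q] by (intro aco.sw_cong comp.sw_cong refl sw_sw_commute)
  also have "\<dots> = asw a (\<lambda>a1 a2. sw q g (\<lambda>g1 g2. sw q g2 (\<lambda>i j. sw p h (\<lambda>w y. sw p y (\<lambda>n v. sw p n (\<lambda>z u.
      ta (?m (?m b (ac q g1 a1)) (?a i w v (?S a2))) (?M j z u)))))))"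
    by (intro aco.sw_cong comp.sw_cong refl sw_coassoc4[OF t]) (simp_all add: lins_T)
  also have "\<dots> = asw a (\<lambda>a1 a2. sw q g (\<lambda>g1 g2. sw q g2 (\<lambda>i j. sw p h (\<lambda>w y. sw p y (\<lambda>n v.
      ts (cou p n) (ta (?m (?m b (ac q g1 a1)) (?a i w v (?S a2))) (pr q j)))))))"
    using sw_antipode4[OF t, of "ta c" for c] by (simp add: lins_T)
  also have "\<dots> = asw a (\<lambda>a1 a2. sw q g (\<lambda>g1 g2. sw q g2 (\<lambda>i j. sw p h (\<lambda>w y.
      ta (?m (?m b (ac q g1 a1)) (?a i w y (?S a2))) (pr q j)))))"
    by (subst comp.sw_counit_left) (simp_all add: lins_T)
  also have "\<dots> = asw a (\<lambda>a1 a2. sw q g (\<lambda>g1 g2. sw q g2 (\<lambda>i j.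
      ts (cou p h) (ta (?m (?m b (ac q g1 a1)) (ac q i (?S a2))) (pr q j)))))"
    using sw_antipode4[OF t, of "\<lambda>i. ta (?m c (ac q i d)) (pr q j)" for c d j] by (simp add: lins_T)
  also have "\<dots> = asw a (\<lambda>a1 a2. sw q g (\<lambda>g' j. sw q g' (\<lambda>g1 i.
      ts (cou p h) (ta (?m (?m b (ac q g1 a1)) (?S (ac q i a2))) (pr q j)))))"
    unfolding aantipode_ac
    by (intro aco.sw_cong refl comp.sw_coassoc[OF t, symmetric]) (simp add: lins_T)
  also have "\<dots> = sw q g (\<lambda>g' j. asw (ac q g' a) (\<lambda>z1 z2.
      ts (cou p h) (ta (?m (?m b z1) (?S z2)) (pr q j))))"
    by (subst asw_ac[OF t]) (simp_all add: lins_T sw_asw_commute)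
  also have "\<dots> = sw q g (\<lambda>g' j. ts (cou q g') (ts (acou a * cou p h) (ta b (pr q j))))"
    using asw_antipode(3)[OF t, where f = "\<lambda>c. ta c l" for l] by (simp add: lins_T)
  also have "\<dots> = ts (acou a * cou p h) (ta b (pr q g))"
    by (subst comp.sw_counit_left) (simp_all add: lins_T)
  finally show ?thesis .
qed

section \<open>Multiplicativity of the coproduct on pure tensors\<close>

text \<open>The hypothesis is an equation between tensors; applying the lift of \<open>f\<close>
  makes it usable inside any expression bilinear in the two slots.\<close>

lemma sw_cocommutative:
  assumes coco: "sw p h (\<lambda>h1 h2. tensor (gscale H) (ascale A) h1 (ac p h2 a))
      = sw p h (\<lambda>h1 h2. tensor (gscale H) (ascale A) h2 (ac p h1 a))"
    and t: "vector_space t" and f: "bil (gscale H) (ascale A) t f"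
  shows "sw p h (\<lambda>h1 h2. f h1 (ac p h2 a)) = sw p h (\<lambda>h1 h2. f h2 (ac p h1 a))"
proof -
  let ?L = "tensor_lift (gscale H) (ascale A) UNIV UNIV f"
  note sub = vector_space_tensor_scale subspace_tensor_space
  note bf = bil_imp_bilinear_on[OF f]
  interpret t: vector_space t by (rule t)
  note vs = vector_space_gscale vector_space_ascale t comp.subspace_UNIV aco.subspace_UNIV
  have L: "linear_on tensor_scale t (tensor_space (gscale H) (ascale A) UNIV UNIV) UNIV ?L"
    by (rule linear_on_tensor_lift[OF vs t.subspace_UNIV bf])
  have LT: "?L (tensor (gscale H) (ascale A) x y) = f x y" for x y
    by (rule tensor_lift_tensor[OF vs bf]) simp_all
  show ?thesis
    using arg_cong[OF coco, of ?L]
    by (simp add: comp.linear_on_sw[OF sub L] tensor_in_tensor_space LT)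
qed

text \<open>Multiplying out the coproduct of the product lets h1, h2 act on b1, b2 and puts h3, h4
  in front of g1, g2. The product of coproducts instead uses h1, h2 for b1, g1 and h3, h4 for b2,
  g2. The two differ by exchanging the middle legs, one of which acts on an element of
  \<open>A\<close>; this is the exchange that \<open>coco\<close> permits.\<close>

lemma pmult_comul:
  assumes coco: "\<And>p h a. sw p h (\<lambda>h1 h2. tensor (gscale H) (ascale A) h1 (ac p h2 a))
      = sw p h (\<lambda>h1 h2. tensor (gscale H) (ascale A) h2 (ac p h1 a))"
  defines "T \<equiv> \<lambda>c1 k1 c2 k2. tensor tensor_scale tensor_scale (ta c1 k1) (ta c2 k2)"
  shows "sw p h (\<lambda>x y. asw (amult A a (ac p x b)) (\<lambda>c1 c2. sw (qmul Q p q) (mu p q y g) (\<lambda>k1 k2.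
      T c1 k1 c2 k2)))
    = asw a (\<lambda>a1 a2. sw p h (\<lambda>x y. asw b (\<lambda>b1 b2. sw q g (\<lambda>g1 g2. sw p x (\<lambda>w z. sw p y (\<lambda>u v.
      T (amult A a1 (ac p w b1)) (mu p q z g1) (amult A a2 (ac p u b2)) (mu p q v g2)))))))"
    (is "?E = _")
proof -
  note t = vector_space_tensor_scale
  let ?m = "amult A"
  note [simp] = T_def
  have "?E = sw p h (\<lambda>x y. asw a (\<lambda>a1 a2. sw p x (\<lambda>w z. asw b (\<lambda>b1 b2. sw p y (\<lambda>u v. sw q g (\<lambda>g1 g2.
      T (?m a1 (ac p w b1)) (mu p q u g1) (?m a2 (ac p z b2)) (mu p q v g2)))))))"
    by (simp add: asw_amult[OF t] asw_ac[OF t] sw_mu[OF t] lins_T)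
  also have "\<dots> = asw a (\<lambda>a1 a2. asw b (\<lambda>b1 b2. sw q g (\<lambda>g1 g2. sw p h (\<lambda>x y. sw p x (\<lambda>w z. sw p y (\<lambda>u v.
      T (?m a1 (ac p w b1)) (mu p q u g1) (?m a2 (ac p z b2)) (mu p q v g2)))))))"
    unfolding sw_asw_commute sw_sw_commute[of p _ q] ..
  also have "\<dots> = asw a (\<lambda>a1 a2. asw b (\<lambda>b1 b2. sw q g (\<lambda>g1 g2. sw p h (\<lambda>w y. sw p y (\<lambda>n v. sw p n (\<lambda>z u.
      T (?m a1 (ac p w b1)) (mu p q u g1) (?m a2 (ac p z b2)) (mu p q v g2)))))))"
    by (intro aco.sw_cong comp.sw_cong refl sw_coassoc4[OF t]) (simp_all add: lins_T)
  also have "\<dots> = asw a (\<lambda>a1 a2. asw b (\<lambda>b1 b2. sw q g (\<lambda>g1 g2. sw p h (\<lambda>w y. sw p y (\<lambda>n v. sw p n (\<lambda>z u.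
      T (?m a1 (ac p w b1)) (mu p q z g1) (?m a2 (ac p u b2)) (mu p q v g2)))))))"
    using sw_cocommutative[OF coco t, symmetric,
        of "\<lambda>x c. T c1 (mu p q x g1) (?m a2 c) k2" for c1 g1 a2 k2]
    by (simp add: lins_T)
  also have "\<dots> = asw a (\<lambda>a1 a2. asw b (\<lambda>b1 b2. sw q g (\<lambda>g1 g2. sw p h (\<lambda>x y. sw p x (\<lambda>w z. sw p y (\<lambda>u v.
      T (?m a1 (ac p w b1)) (mu p q z g1) (?m a2 (ac p u b2)) (mu p q v g2)))))))"
    by (intro aco.sw_cong comp.sw_cong refl sw_coassoc4[OF t, symmetric]) (simp_all add: lins_T)
  also have "\<dots> = asw a (\<lambda>a1 a2. sw p h (\<lambda>x y. asw b (\<lambda>b1 b2. sw q g (\<lambda>g1 g2. sw p x (\<lambda>w z. sw p y (\<lambda>u v.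
      T (?m a1 (ac p w b1)) (mu p q z g1) (?m a2 (ac p u b2)) (mu p q v g2)))))))"
    unfolding sw_asw_commute sw_sw_commute[of p _ q] ..
  finally show ?thesis .
qed

text \<open>
  With \<open>f = g \<cdot> (S(h) \<cdot> a)\<close> and \<open>k = (g S(h)) \<cdot> a\<close>, the third antipode law gives \<open>S(f\<^sub>1) k\<^sub>2 = \<epsilon> 1\<close>;
  then \<open>f = k\<close> by evaluating \<open>f\<^sub>1 (S(f\<^sub>2) k\<^sub>3)\<close> in two ways.
\<close>

lemma ac_ac_S_if_pmult_antipode3:
  assumes anti: "\<And>a h g. asw a (\<lambda>a1 a2. sw p h (\<lambda>x y. sw p x (\<lambda>u v. sw q g (\<lambda>g1 g2.
     pmult (qmul Q q (qinv Q p)) p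
       (amult A (aone A) (ac q g1 (ac (qinv Q p) (S p v) (aantipode A a1)))) (mu q (qinv Q p) g2 (S p u)) a2 y))))
   = ts (acou a * cou p h) (ta (aone A) (pr q g))"
  shows "ac q g (ac (qinv Q p) (S p h) a) = ac (qmul Q q (qinv Q p)) (mu q (qinv Q p) g (S p h)) a"
proof -
  note t = vector_space_ascale and sub = vector_space_tensor_scale subspace_tensor_space
  let ?r = "qinv Q p" and ?qr = "qmul Q q (qinv Q p)" and ?S = "aantipode A" and ?m = "amult A"
  let ?f = "\<lambda>g h a. ac q g (ac ?r (S p h) a)" and ?k = "\<lambda>g h a. ac ?qr (mu q ?r g (S p h)) a"
  let ?s = "ascale A"
  \<comment> \<open>\<open>?L\<close> is the identity of \<open>A\<close> tensored with the counit
    of \<open>H\<close>. Erasing the \<open>H\<close> component of the antipode law in this way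
    leaves the relation \<open>inv\<close> inside \<open>A\<close>.\<close>
  let ?L = "tensor_lift (ascale A) (gscale H) UNIV UNIV (\<lambda>c k. ?s (cou q k) c)"
  have f: "bilinear_on ?s (gscale H) ?s UNIV UNIV UNIV (\<lambda>c k. ?s (cou q k) c)"
    by (rule bil_imp_bilinear_on) (simp add: lins_A aco.scale_left_distrib)
  note vs = vector_space_ascale vector_space_gscale t aco.subspace_UNIV comp.subspace_UNIV
  have L: "linear_on ts ?s (tensor_space (ascale A) (gscale H) UNIV UNIV) UNIV ?L"
    by (rule linear_on_tensor_lift[OF vs aco.subspace_UNIV f])
  have L_scale: "?L (ts c x) = ?s c (?L x)" if "x \<in> tensor_space (ascale A) (gscale H) UNIV UNIV" for c x
    using L that by (simp add: linear_on_def)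
  have LT: "?L (ta x y) = ?s (cou q y) x" for x y
    by (rule tensor_lift_tensor[OF vs f]) simp_all
  have inv: "asw a (\<lambda>a1 a2. sw p h (\<lambda>u v. sw q g (\<lambda>g1 g2. ?m (?S (?f g1 v a1)) (?k g2 u a2))))
      = ?s (acou a) (?s (cou p h) (?s (cou q g) (aone A)))" (is "?E = _") for a h g
  proof -
    have "?s (acou a) (?s (cou p h) (?s (cou q g) (aone A))) = ?L (ts (acou a * cou p h) (ta (aone A) (pr q g)))"
      by (simp add: L_scale LT tensor_in_tensor_space)
    also have "\<dots> = asw a (\<lambda>a1 a2. sw p h (\<lambda>x y. sw p x (\<lambda>u v. sw q g (\<lambda>g1 g2. sw q g2 (\<lambda>i j. sw p u (\<lambda>k l.
        ?s (cou q (mu ?qr p (mu q ?r j (S p k)) y)) (?m (?S (?f g1 v a1)) (?k i l a2))))))))"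
      unfolding anti[symmetric] pmult_antipode3_expand
      by (simp add: comp.linear_on_sw[OF sub L] aco.linear_on_sw[OF sub L] tensor_in_tensor_space
          comp.sw_in_subspace[OF sub] LT del: cou_mu)
    also have "\<dots> = asw a (\<lambda>a1 a2. sw p h (\<lambda>x y. ?s (cou p y) (sw p x (\<lambda>u v. sw q g (\<lambda>g1 g2.
        sw q g2 (\<lambda>i j. ?s (cou q j) (sw p u (\<lambda>k l. ?s (cou p k) (?m (?S (?f g1 v a1)) (?k i l a2))))))))))"
    proof -
      have "?s (cou q (mu ?qr p (mu q ?r j (S p k)) y)) X = ?s (cou p y) (?s (cou q j) (?s (cou p k) X))"
        for j k y X by (simp add: mult.commute mult.left_commute)
      then show ?thesis by (simp only: comp.sw_scale[OF t])
    qed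
    also have "\<dots> = asw a (\<lambda>a1 a2. sw p h (\<lambda>x y. ?s (cou p y) (sw p x (\<lambda>u v. sw q g (\<lambda>g1 g2.
        sw q g2 (\<lambda>i j. ?s (cou q j) (?m (?S (?f g1 v a1)) (?k i u a2))))))))"
      by (subst comp.sw_counit_left) (simp_all add: lins_A)
    also have "\<dots> = asw a (\<lambda>a1 a2. sw p h (\<lambda>x y. ?s (cou p y) (sw p x (\<lambda>u v. sw q g (\<lambda>g1 g2.
        ?m (?S (?f g1 v a1)) (?k g2 u a2))))))"
      by (subst comp.sw_counit_right[of _ _ q]) (simp_all add: lins_A)
    also have "\<dots> = ?E"
      by (subst comp.sw_counit_right) (simp_all add: lins_A)
    finally show ?thesis ..
  qed
  define X where "X = asw a (\<lambda>a1 a'. sw p h (\<lambda>h' v1. sw q g (\<lambda>g1 g'. ?m (?f g1 v1 a1)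
    (asw a' (\<lambda>a2 a3. sw p h' (\<lambda>u v. sw q g' (\<lambda>g2 g3. ?m (?S (?f g2 v a2)) (?k g3 u a3))))))))"
  \<comment> \<open>The inner triple sum is an instance of \<open>inv\<close> and becomes a multiple
    of the unit of \<open>A\<close>; the counits created there then absorb the remaining
    legs.\<close>
  have "X = asw a (\<lambda>a1 a'. ?s (acou a') (sw p h (\<lambda>h' v1. ?s (cou p h') (sw q g (\<lambda>g1 g'.
      ?s (cou q g') (?f g1 v1 a1))))))"
    unfolding X_def inv amult_simps comp.sw_scale[OF t] ..
  also have "\<dots> = asw a (\<lambda>a1 a'. ?s (acou a') (sw p h (\<lambda>h' v1. ?s (cou p h') (?f g v1 a1))))"
    by (subst comp.sw_counit_right) (simp_all add: lins_A)
  also have "\<dots> = asw a (\<lambda>a1 a'. ?s (acou a') (?f g h a1))"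
    by (subst comp.sw_counit_left) (simp_all add: lins_A)
  also have "\<dots> = ?f g h a"
    by (subst aco.sw_counit_right) (simp_all add: lins_A)
  finally have 1: "X = ?f g h a" .
  have m_sw: "?m c (sw p' h' F) = sw p' h' (\<lambda>u v. ?m c (F u v))"
    "?m c (asw a' F') = asw a' (\<lambda>u v. ?m c (F' u v))" for c p' h' F a' F'
    using comp.lin_sw[of ?s ?s "?m c"] aco.lin_sw[of ?s ?s "?m c"] by (simp_all add: lin_def)
  \<comment> \<open>For the second value the legs are regrouped from the left for a and g but from
    the right for h. The first two factors then come from the coproduct of one element z = g (S(h)
    a), and z1 (S(z2) c) collapses.\<close>
  have "X = asw a (\<lambda>a1 a'. asw a' (\<lambda>a2 a3. sw p h (\<lambda>h' v1. sw p h' (\<lambda>u v. sw q g (\<lambda>g1 g'. sw q g' (\<lambda>g2 g3.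
      ?m (?f g1 v1 a1) (?m (?S (?f g2 v a2)) (?k g3 u a3))))))))"
    unfolding X_def m_sw sw_asw_commute by (intro aco.sw_cong comp.sw_cong refl sw_sw_commute)
  also have "\<dots> = asw a (\<lambda>a' a3. asw a' (\<lambda>a1 a2. sw p h (\<lambda>h' v1. sw p h' (\<lambda>u v. sw q g (\<lambda>g1 g'. sw q g' (\<lambda>g2 g3.
      ?m (?f g1 v1 a1) (?m (?S (?f g2 v a2)) (?k g3 u a3))))))))"
    by (rule aco.sw_coassoc[OF t, symmetric]) (simp add: lins_A)
  also have "\<dots> = asw a (\<lambda>a' a3. asw a' (\<lambda>a1 a2. sw p h (\<lambda>u w. sw p w (\<lambda>v v1. sw q g (\<lambda>g1 g'. sw q g' (\<lambda>g2 g3.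
      ?m (?f g1 v1 a1) (?m (?S (?f g2 v a2)) (?k g3 u a3))))))))"
    by (intro aco.sw_cong refl comp.sw_coassoc[OF t]) (simp add: lins_A)
  also have "\<dots> = asw a (\<lambda>a' a3. asw a' (\<lambda>a1 a2. sw p h (\<lambda>u w. sw p w (\<lambda>v v1. sw q g (\<lambda>g' g3. sw q g' (\<lambda>g1 g2.
      ?m (?f g1 v1 a1) (?m (?S (?f g2 v a2)) (?k g3 u a3))))))))"
    by (intro aco.sw_cong comp.sw_cong refl comp.sw_coassoc[OF t, symmetric]) (simp add: lins_A)
  also have "\<dots> = asw a (\<lambda>a' a3. sw p h (\<lambda>u w. sw q g (\<lambda>g' g3. sw q g' (\<lambda>g1 g2. sw p w (\<lambda>v v1. asw a' (\<lambda>a1 a2.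
      ?m (?f g1 v1 a1) (?m (?S (?f g2 v a2)) (?k g3 u a3))))))))"
    unfolding sw_sw_commute[of p _ q] sw_asw_commute ..
  also have "\<dots> = asw a (\<lambda>a' a3. sw p h (\<lambda>u w. sw q g (\<lambda>g' g3. asw (?f g' w a') (\<lambda>z1 z2.
      ?m z1 (?m (?S z2) (?k g3 u a3))))))"
    by (subst asw_ac_ac_S[OF t]) (simp_all add: lins_A)
  also have "\<dots> = asw a (\<lambda>a' a3. sw p h (\<lambda>u w. sw q g (\<lambda>g' g3. ?s (acou (?f g' w a')) (?k g3 u a3))))"
    using asw_antipode(2)[OF t, of "\<lambda>z. z"] by (simp add: lins_A)
  also have "\<dots> = asw a (\<lambda>a' a3. ?s (acou a') (sw p h (\<lambda>u w. ?s (cou p w) (sw q g (\<lambda>g' g3.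
      ?s (cou q g') (?k g3 u a3))))))"
  proof -
    have "?s (acou (?f g w a)) X = ?s (acou a) (?s (cou p w) (?s (cou q g) X))" for g w a X
      by (simp add: mult.commute mult.left_commute)
    then show ?thesis by (simp only: comp.sw_scale[OF t])
  qed
  also have "\<dots> = asw a (\<lambda>a' a3. ?s (acou a') (sw p h (\<lambda>u w. ?s (cou p w) (?k g u a3))))"
    by (subst comp.sw_counit_left) (simp_all add: lins_A)
  also have "\<dots> = asw a (\<lambda>a' a3. ?s (acou a') (?k g h a3))"
    by (subst comp.sw_counit_right) (simp_all add: lins_A)
  also have "\<dots> = ?k g h a"
    by (subst aco.sw_counit_left) (simp_all add: lins_A)
  finally show ?thesis using 1 by simp
qed

end

section \<open>Maps on tensor products\<close>

lemma tensor_lift_add: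
  "tensor_lift s1 s2 U V (\<lambda>u v. f u v + g u v) x = tensor_lift s1 s2 U V f x + tensor_lift s1 s2 U V g x"
  by (simp add: tensor_lift_def Let_def case_prod_unfold sum_list_addf)

lemma tensor_lift_scale:
  assumes "vector_space t"
  shows "tensor_lift s1 s2 U V (\<lambda>u v. t c (f u v)) x = t c (tensor_lift s1 s2 U V f x)"
proof -
  interpret t: vector_space t by fact
  have "(\<Sum>z\<leftarrow>zs. t c (f (fst z) (snd z))) = t c (\<Sum>z\<leftarrow>zs. f (fst z) (snd z))" for zs
    by (induction zs) (simp_all add: t.scale_right_distrib)
  then show ?thesis
    by (simp add: tensor_lift_def Let_def case_prod_unfold)
qed

lemma tensor_lift_cong:
  assumes "vector_space s1" "module.subspace s1 U" and x: "x \<in> tensor_space s1 s2 U V"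
    and eq: "\<And>u v. u \<in> U \<Longrightarrow> v \<in> V \<Longrightarrow> f u v = g u v"
  shows "tensor_lift s1 s2 U V f x = tensor_lift s1 s2 U V g x"
proof -
  have "set (SOME xs. set xs \<subseteq> U \<times> V \<and> x = (\<Sum>(u, v)\<leftarrow>xs. tensor s1 s2 u v)) \<subseteq> U \<times> V"
    using someI_ex[OF tensor_space_sum_list[OF assms(1-3)]] by blast
  then show ?thesis
    unfolding tensor_lift_def Let_def
    by (intro arg_cong[where f = sum_list] map_cong refl) (auto intro!: eq)
qed

text \<open>The list chosen for \<open>x\<close> does not depend on the parameter \<open>y\<close>,
  so linearity in \<open>y\<close> passes through the sum termwise.\<close>

lemma linear_on_tensor_lift_param:
  assumes "vector_space s1" "module.subspace s1 U" "vector_space t" "module.subspace t W"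
    and "vector_space s2" "module.subspace s2 V"
    and x: "x \<in> tensor_space s1 s2 U V"
    and f: "\<And>u v. u \<in> U \<Longrightarrow> v \<in> V \<Longrightarrow> linear_on r t Y W (f u v)"
    and bil: "\<And>y. y \<in> Y \<Longrightarrow> bilinear_on s1 s2 t U V W (\<lambda>u v. f u v y)"
  shows "linear_on r t Y W (\<lambda>y. tensor_lift s1 s2 U V (\<lambda>u v. f u v y) x)"
proof -
  note cong = tensor_lift_cong[OF assms(1,2) x]
  have "tensor_lift s1 s2 U V (\<lambda>u v. f u v (y + z)) x
      = tensor_lift s1 s2 U V (\<lambda>u v. f u v y) x + tensor_lift s1 s2 U V (\<lambda>u v. f u v z) x"
    if "y \<in> Y" "z \<in> Y" for y z
    unfolding tensor_lift_add[symmetric]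
    by (rule cong) (use f that in \<open>auto simp: linear_on_def\<close>)
  moreover have "tensor_lift s1 s2 U V (\<lambda>u v. f u v (r c y)) x
      = t c (tensor_lift s1 s2 U V (\<lambda>u v. f u v y) x)" if "y \<in> Y" for c y
    unfolding tensor_lift_scale[OF assms(3), symmetric]
    by (rule cong) (use f that in \<open>auto simp: linear_on_def\<close>)
  moreover have "tensor_lift s1 s2 U V (\<lambda>u v. f u v y) x \<in> W" if "y \<in> Y" for y
    using linear_on_tensor_lift[OF assms(1,5,3,2,6,4) bil[OF that]] x
    by (simp add: linear_on_def)
  ultimately show ?thesis by (simp add: linear_on_def)
qed

lemma linear_on_compose:
  assumes "linear_on s t U V f" "linear_on t r V W g"
  shows "linear_on s r U W (\<lambda>x. g (f x))"
  using assms by (simp add: linear_on_def)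

lemma bilinear_on_compose:
  assumes "bilinear_on s1 s2 t U V W f" "linear_on r1 s1 U' U g" "linear_on r2 s2 V' V h"
  shows "bilinear_on r1 r2 t U' V' W (\<lambda>x y. f (g x) (h y))"
  using assms by (simp add: bilinear_on_def linear_on_def)

lemma bilinear_on_linear_on:
  assumes "bilinear_on s1 s2 t U V W f" "linear_on t r W W' g"
  shows "bilinear_on s1 s2 r U V W' (\<lambda>x y. g (f x y))"
  using assms by (simp add: bilinear_on_def linear_on_def)

lemma linear_on_ident: "linear_on s s U U (\<lambda>x. x)"
  by (simp add: linear_on_def)

lemma bilinear_on_tensor_space_eq:
  assumes vs: "vector_space s1" "module.subspace s1 U" "vector_space s1'" "module.subspace s1' U'"
    and f: "bilinear_on tensor_scale tensor_scale t
      (tensor_space s1 s2 U V) (tensor_space s1' s2' U' V') W f"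
    and g: "bilinear_on tensor_scale tensor_scale t
      (tensor_space s1 s2 U V) (tensor_space s1' s2' U' V') W' g"
    and eq: "\<And>u v u' v'. u \<in> U \<Longrightarrow> v \<in> V \<Longrightarrow> u' \<in> U' \<Longrightarrow> v' \<in> V' \<Longrightarrow>
      f (tensor s1 s2 u v) (tensor s1' s2' u' v') = g (tensor s1 s2 u v) (tensor s1' s2' u' v')"
    and x: "x \<in> tensor_space s1 s2 U V" and y: "y \<in> tensor_space s1' s2' U' V'"
  shows "f x y = g x y"
proof -
  have fl: "linear_on tensor_scale t (tensor_space s1' s2' U' V') W (f z)"
    and gl: "linear_on tensor_scale t (tensor_space s1' s2' U' V') W' (g z)"
    if "z \<in> tensor_space s1 s2 U V" for z
    using that f g by (simp_all add: bilinear_on_def)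
  have fr: "linear_on tensor_scale t (tensor_space s1 s2 U V) W (\<lambda>z. f z y)"
    and gr: "linear_on tensor_scale t (tensor_space s1 s2 U V) W' (\<lambda>z. g z y)"
    using y f g by (simp_all add: bilinear_on_def)
  have "f (tensor s1 s2 u v) y = g (tensor s1 s2 u v) y" if "u \<in> U" "v \<in> V" for u v
    using that tensor_in_tensor_space[OF that]
    by (intro linear_on_tensor_space_eq[OF vs(3,4) fl gl _ y] eq) auto
  from linear_on_tensor_space_eq[OF vs(1,2) fr gr this x] show ?thesis by simp
qed


section \<open>The smash product\<close>

context quasimodule_hopf_quasigroup
begin

abbreviation SP :: "('q, 'k, ('a, 'h, 'k) tensor) graded_data" where
  "SP \<equiv> smash_product Q H A act"

abbreviation T :: "'q \<Rightarrow> ('a, 'h, 'k) tensor set" where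
  "T p \<equiv> tensor_space (ascale A) (gscale H) UNIV (gspace H p)"

abbreviation tt :: "('a, 'h, 'k) tensor \<Rightarrow> ('a, 'h, 'k) tensor
    \<Rightarrow> (('a, 'h, 'k) tensor, ('a, 'h, 'k) tensor, 'k) tensor" where
  "tt \<equiv> tensor tensor_scale tensor_scale"

abbreviation lift :: "'q \<Rightarrow> ('a \<Rightarrow> 'h \<Rightarrow> 'w::ab_group_add) \<Rightarrow> ('a, 'h, 'k) tensor \<Rightarrow> 'w" where
  "lift p \<equiv> tensor_lift (ascale A) (gscale H) UNIV (gspace H p)"

lemma gscale_SP [simp]: "gscale SP = tensor_scale"
  and gspace_SP [simp]: "gspace SP p = T p"
  by (simp_all add: smash_product_def)

lemma ta_in [simp]: "h \<in> gspace H p \<Longrightarrow> ta a h \<in> T p"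
  by (simp add: tensor_in_tensor_space)

lemma T_add: "x \<in> T p \<Longrightarrow> y \<in> T p \<Longrightarrow> x + y \<in> T p"
  and T_scale: "x \<in> T p \<Longrightarrow> tensor_scale c x \<in> T p"
proof -
  interpret tv: vector_space tensor_scale by (rule vector_space_tensor_scale)
  show "x \<in> T p \<Longrightarrow> y \<in> T p \<Longrightarrow> x + y \<in> T p" "x \<in> T p \<Longrightarrow> tensor_scale c x \<in> T p"
    using tv.subspace_add[OF subspace_tensor_space] tv.subspace_scale[OF subspace_tensor_space] by blast+
qed

lemmas vsT = vector_space_tensor_scale
lemmas subT = vector_space_tensor_scale subspace_tensor_space

lemmas lift_cong = tensor_lift_cong[OF vector_space_ascale aco.subspace_UNIV]

lemma lift_in_linear:
  assumes t: "vector_space t" "module.subspace t W" and f: "bil (ascale A) (gscale H) t f"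
    and W: "\<And>a h. h \<in> gspace H p \<Longrightarrow> f a h \<in> W"
  shows "linear_on tensor_scale t (T p) W (lift p f)"
proof -
  have "bilinear_on (ascale A) (gscale H) t UNIV (gspace H p) W f"
    using f W by (simp add: multilin_defs bilinear_on_def linear_on_def)
  then show ?thesis
    by (rule linear_on_tensor_lift[OF vector_space_ascale vector_space_gscale t(1)
        aco.subspace_UNIV comp.subspace_C t(2)])
qed

lemma lift_ta:
  assumes t: "vector_space t" and f: "bil (ascale A) (gscale H) t f" and h: "h \<in> gspace H p"
  shows "lift p f (ta a h) = f a h"
  by (rule tensor_lift_tensor[OF vector_space_ascale vector_space_gscale t
      aco.subspace_UNIV comp.subspace_C bil_imp_bilinear_on[OF f] UNIV_I h])

section \<open>Structure maps of the smash product and their values on pure tensors\<close>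

lemma pmult_bil:
  "bil (ascale A) (gscale H) tensor_scale (\<lambda>a h. pmult p q a h b g)"
  "bil (ascale A) (gscale H) tensor_scale (pmult p q a h)"
  by (simp_all add: pmult_def lins_T)

lemma pmult_in [simp]: "qmul Q p q = r \<Longrightarrow> pmult p q a h b g \<in> T r"
  unfolding pmult_def by (intro comp.sw_in_subspace[OF subT] ta_in mu_in)

text \<open>Replaces the given structure maps by variants linear on the ambient spaces; the two
  agree as long as \<open>x\<close> and \<open>y\<close> lie in their components.\<close>

lemma gmult_SP:
  assumes x: "x \<in> T p" and y: "y \<in> T q"
  shows "gmult SP p q x y = lift p (\<lambda>a h. lift q (pmult p q a h) y) x"
  unfolding smash_product_def graded_data.simps smash_lift_def smash_tensor_def
  by (intro lift_cong x y)
    (simp add: gsweedler_eq_sw pmult_def gmult_eq_mu act_eq_ac cong: comp.sw_cong)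

lemma lift_pmult_bil:
  "bil (ascale A) (gscale H) tensor_scale (\<lambda>a h. lift q (pmult p q a h) y)"
proof -
  have "pmult p q (x + x') h = (\<lambda>b g. pmult p q x h b g + pmult p q x' h b g)"
    "pmult p q x (h + h') = (\<lambda>b g. pmult p q x h b g + pmult p q x h' b g)"
    "pmult p q (ascale A c x) h = (\<lambda>b g. tensor_scale c (pmult p q x h b g))"
    "pmult p q x (gscale H c h) = (\<lambda>b g. tensor_scale c (pmult p q x h b g))"
    for x x' h h' c
    using pmult_bil(1) by (simp_all add: multilin_defs fun_eq_iff)
  then show ?thesis
    by (simp add: multilin_defs tensor_lift_add tensor_lift_scale[OF vsT])
qed

lemma gmult_SP_bilinear:
  assumes "qmul Q p q = r"
  shows "bilinear_on tensor_scale tensor_scale tensor_scale (T p) (T q) (T r) (gmult SP p q)"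
proof -
  note bil = lift_pmult_bil
  have lin: "linear_on tensor_scale tensor_scale (T q) (T r) (lift q (pmult p q a h))" for a h
    by (rule lift_in_linear[OF subT pmult_bil(2)]) (simp add: assms)
  have in_T: "lift q (pmult p q a h) y \<in> T r" if "y \<in> T q" for a h y
    using lin that by (simp add: linear_on_def)
  have bil': "bilinear_on (ascale A) (gscale H) tensor_scale UNIV (gspace H p) (T r)
      (\<lambda>a h. lift q (pmult p q a h) y)" if "y \<in> T q" for y
    using bil[of q p y] in_T[OF that] by (simp add: multilin_defs bilinear_on_def linear_on_def)
  have "linear_on tensor_scale tensor_scale (T p) (T r)
      (\<lambda>x. lift p (\<lambda>a h. lift q (pmult p q a h) y) x)" if "y \<in> T q" for y
    by (rule lift_in_linear[OF subT bil]) (rule in_T[OF that])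
  moreover have "linear_on tensor_scale tensor_scale (T q) (T r)
      (\<lambda>y. lift p (\<lambda>a h. lift q (pmult p q a h) y) x)" if "x \<in> T p" for x
    by (rule linear_on_tensor_lift_param[OF vector_space_ascale aco.subspace_UNIV subT
        vector_space_gscale comp.subspace_C that lin bil'])
  ultimately show ?thesis
    by (simp add: bilinear_on_def linear_on_def gmult_SP T_add T_scale)
qed

lemma gmult_SP_left: "qmul Q p q = r \<Longrightarrow> y \<in> T q \<Longrightarrow>
    linear_on tensor_scale tensor_scale (T p) (T r) (\<lambda>x. gmult SP p q x y)"
  and gmult_SP_right: "qmul Q p q = r \<Longrightarrow> x \<in> T p \<Longrightarrow>
    linear_on tensor_scale tensor_scale (T q) (T r) (gmult SP p q x)"
  using gmult_SP_bilinear[of p q r] by (simp_all add: bilinear_on_def)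

lemma gmult_SP_in [simp]: "qmul Q p q = r \<Longrightarrow> x \<in> T p \<Longrightarrow> y \<in> T q \<Longrightarrow> gmult SP p q x y \<in> T r"
  using gmult_SP_right by (simp add: linear_on_def)

lemma gmult_SP_ta [simp]:
  "h \<in> gspace H p \<Longrightarrow> g \<in> gspace H q \<Longrightarrow> gmult SP p q (ta a h) (ta b g) = pmult p q a h b g"
  by (simp only: gmult_SP[OF ta_in ta_in] lift_ta[OF vsT pmult_bil(2)] lift_ta[OF vsT pmult_bil(1)]
      lift_ta[OF vsT lift_pmult_bil])

lemma gone_SP: "gone SP = ta (aone A) (gone H)"
  by (simp add: smash_product_def smash_tensor_def)

text \<open>Agreement with the lift is assumed on \<open>T p\<close> only, since the structure maps
  of the smash product are built from the given maps, which are unconstrained outside the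
  components.\<close>

lemma lift_eqI:
  assumes "\<And>x. x \<in> T p \<Longrightarrow> F x = lift p f x"
    and "vector_space t" "module.subspace t W" "bil (ascale A) (gscale H) t f"
    and "\<And>a h. h \<in> gspace H p \<Longrightarrow> f a h \<in> W"
  shows "linear_on tensor_scale t (T p) W F"
    and "h \<in> gspace H p \<Longrightarrow> F (ta a h) = f a h"
  using lift_in_linear[OF assms(2-5)] lift_ta[OF assms(2,4)] assms(1)
  by (simp_all add: linear_on_def T_add T_scale)

lemma gcomul_SP_linear: "linear_on tensor_scale tensor_scale (T p)
    (tensor_space tensor_scale tensor_scale (T p) (T p)) (gcomul SP p)"
  and gcomul_SP_ta: "h \<in> gspace H p \<Longrightarrow>
    gcomul SP p (ta a h) = asw a (\<lambda>a1 a2. sw p h (\<lambda>h1 h2. tt (ta a1 h1) (ta a2 h2)))"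
proof -
  let ?f = "\<lambda>a h. asw a (\<lambda>a1 a2. sw p h (\<lambda>h1 h2. tt (ta a1 h1) (ta a2 h2)))"
  have 1: "gcomul SP p x = lift p ?f x" if "x \<in> T p" for x
    unfolding smash_product_def graded_data.simps smash_lift_def smash_tensor_def
    by (intro lift_cong that) (simp add: gsweedler_eq_sw asweedler_eq_asw)
  have 2: "bil (ascale A) (gscale H) tensor_scale ?f"
    by (simp add: lins_T)
  have 3: "?f a h \<in> tensor_space tensor_scale tensor_scale (T p) (T p)" for a h
    by (intro aco.sw_in_subspace[OF subT] comp.sw_in_subspace[OF subT] tensor_in_tensor_space ta_in)
  show "linear_on tensor_scale tensor_scale (T p)
    (tensor_space tensor_scale tensor_scale (T p) (T p)) (gcomul SP p)"
    "h \<in> gspace H p \<Longrightarrow> gcomul SP p (ta a h) = ?f a h"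
    by (rule lift_eqI(1)[OF 1 subT 2 3] lift_eqI(2)[OF 1 subT 2 3]; assumption)+
qed

lemma gcounit_SP_linear: "linear_on tensor_scale (*) (T p) UNIV (gcounit SP p)"
  and gcounit_SP_ta [simp]: "h \<in> gspace H p \<Longrightarrow> gcounit SP p (ta a h) = acou a * cou p h"
proof -
  let ?f = "\<lambda>a h. acou a * cou p h"
  have 1: "gcounit SP p x = lift p ?f x" if "x \<in> T p" for x
    unfolding smash_product_def graded_data.simps smash_lift_def
    by (intro lift_cong that) (simp add: comp.counit_eq_cou acounit_eq_acou)
  have 2: "bil (ascale A) (gscale H) (*) ?f"
    by (simp add: lins algebra_simps)
  have 3: "?f a h \<in> UNIV" for a h by simp
  have 4: "module.subspace ((*) :: 'k \<Rightarrow> 'k \<Rightarrow> 'k) UNIV"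
    by (rule subspace_UNIV[OF vector_space_field_mult])
  note lift_eqI = lift_eqI[OF 1 vector_space_field_mult 4 2 3]
  show "linear_on tensor_scale (*) (T p) UNIV (gcounit SP p)"
    by (rule lift_eqI(1))
  show "gcounit SP p (ta a h) = ?f a h" if "h \<in> gspace H p"
    by (rule lift_eqI(2)[OF _ that])
qed

lemma gantipode_SP_linear:
    "linear_on tensor_scale tensor_scale (T p) (T (qinv Q p)) (gantipode SP p)"
  and gantipode_SP_ta [simp]: "h \<in> gspace H p \<Longrightarrow> gantipode SP p (ta a h)
    = sw p h (\<lambda>u v. ta (ac (qinv Q p) (S p v) (aantipode A a)) (S p u))"
proof -
  let ?f = "\<lambda>a h. sw p h (\<lambda>u v. ta (ac (qinv Q p) (S p v) (aantipode A a)) (S p u))"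
  have 1: "gantipode SP p x = lift p ?f x" if "x \<in> T p" for x
    unfolding smash_product_def graded_data.simps smash_lift_def smash_tensor_def
    by (intro lift_cong that)
      (simp add: gsweedler_eq_sw gantipode_eq_S act_eq_ac S_in cong: comp.sw_cong)
  have 2: "bil (ascale A) (gscale H) tensor_scale ?f"
    by (simp add: lins_T)
  have 3: "?f a h \<in> T (qinv Q p)" for a h
    by (intro comp.sw_in_subspace[OF subT] ta_in S_in)
  show "linear_on tensor_scale tensor_scale (T p) (T (qinv Q p)) (gantipode SP p)"
    "h \<in> gspace H p \<Longrightarrow> gantipode SP p (ta a h) = ?f a h"
    by (rule lift_eqI(1)[OF 1 subT 2 3] lift_eqI(2)[OF 1 subT 2 3]; assumption)+
qed

lemma gantipode_SP_in [simp]: "x \<in> T p \<Longrightarrow> gantipode SP p x \<in> T (qinv Q p)"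
  and gcomul_SP_in: "x \<in> T p \<Longrightarrow> gcomul SP p x \<in> tensor_space tensor_scale tensor_scale (T p) (T p)"
  using gantipode_SP_linear gcomul_SP_linear by (simp_all add: linear_on_def)

section \<open>Sweedler sums in the smash product\<close>

context
  fixes t :: "'k \<Rightarrow> 'w::ab_group_add \<Rightarrow> 'w" and W :: "'w set"
  assumes t: "vector_space t" "module.subspace t W"
begin

text \<open>The structure maps of the smash product are not precomposed with projections, so
  bilinearity is tracked here on the components \<open>T p\<close> instead of on the ambient
  space.\<close>

lemma gsweedler_SP_linear:
  assumes f: "bilinear_on tensor_scale tensor_scale t (T p) (T p) W f"
  shows "linear_on tensor_scale t (T p) W (\<lambda>x. gsweedler SP p x f)"
proof -
  have "linear_on tensor_scale t (tensor_space tensor_scale tensor_scale (T p) (T p)) W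
      (tensor_lift tensor_scale tensor_scale (T p) (T p) f)"
    by (rule linear_on_tensor_lift[OF vsT vsT t(1) subspace_tensor_space subspace_tensor_space t(2) f])
  from linear_on_compose[OF gcomul_SP_linear this] show ?thesis
    by (simp add: gsweedler_def sweedler_def)
qed

lemma gsweedler_SP_ta:
  assumes f: "bilinear_on tensor_scale tensor_scale t (T p) (T p) W f" and h: "h \<in> gspace H p"
  shows "gsweedler SP p (ta a h) f = asw a (\<lambda>a1 a2. sw p h (\<lambda>h1 h2. f (ta a1 h1) (ta a2 h2)))"
proof -
  note sub = subspace_tensor_space subspace_tensor_space
  have L: "linear_on tensor_scale t (tensor_space tensor_scale tensor_scale (T p) (T p)) W
      (tensor_lift tensor_scale tensor_scale (T p) (T p) f)"
    by (rule linear_on_tensor_lift[OF vsT vsT t(1) sub t(2) f])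
  have "tensor_lift tensor_scale tensor_scale (T p) (T p) f (tt x y) = f x y"
    if "x \<in> T p" "y \<in> T p" for x y
    by (rule tensor_lift_tensor[OF vsT vsT t(1) sub f that])
  then show ?thesis
    by (simp add: gsweedler_def sweedler_def gcomul_SP_ta h aco.linear_on_sw[OF subT L]
        comp.linear_on_sw[OF subT L] comp.sw_in_subspace[OF subT] tensor_in_tensor_space
        cong: comp.sw_cong)
qed

lemma gsweedler_SP_param:
  assumes x: "x \<in> T p"
    and f: "\<And>u v. u \<in> T p \<Longrightarrow> v \<in> T p \<Longrightarrow> linear_on r t Y W (f u v)"
    and bil: "\<And>y. y \<in> Y \<Longrightarrow> bilinear_on tensor_scale tensor_scale t (T p) (T p) W (\<lambda>u v. f u v y)"
  shows "linear_on r t Y W (\<lambda>y. gsweedler SP p x (\<lambda>u v. f u v y))"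
  using linear_on_tensor_lift_param[OF subT t subT gcomul_SP_in[OF x] f bil]
  by (simp add: gsweedler_def sweedler_def)

lemma gsweedler_SP_bilinear:
  assumes f: "\<And>u v. u \<in> T p \<Longrightarrow> v \<in> T p \<Longrightarrow> linear_on r t Y W (f u v)"
    and bil: "\<And>y. y \<in> Y \<Longrightarrow> bilinear_on tensor_scale tensor_scale t (T p) (T p) W (\<lambda>u v. f u v y)"
  shows "bilinear_on tensor_scale r t (T p) Y W (\<lambda>x y. gsweedler SP p x (\<lambda>u v. f u v y))"
  using gsweedler_SP_param[OF _ f bil] gsweedler_SP_linear[OF bil]
  by (simp add: bilinear_on_def)

end


lemma sweedler_SP: "sweedler tensor_scale (T p) (gcomul SP p) x f = gsweedler SP p x f"
  by (simp add: gsweedler_def)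

lemma tt_sw:
  "tensor tensor_scale tensor_scale X (sw p h F) = sw p h (\<lambda>u v. tensor tensor_scale tensor_scale X (F u v))"
  "tensor tensor_scale tensor_scale X (asw a F') = asw a (\<lambda>u v. tensor tensor_scale tensor_scale X (F' u v))"
  "tensor tensor_scale tensor_scale (sw p h G) Y = sw p h (\<lambda>u v. tensor tensor_scale tensor_scale (G u v) Y)"
  "tensor tensor_scale tensor_scale (asw a G') Y = asw a (\<lambda>u v. tensor tensor_scale tensor_scale (G' u v) Y)"
  using comp.lin_sw[of tensor_scale tensor_scale "tensor tensor_scale tensor_scale X"]
    aco.lin_sw[of tensor_scale tensor_scale "tensor tensor_scale tensor_scale X"]
    comp.lin_sw[of tensor_scale tensor_scale "\<lambda>z. tensor tensor_scale tensor_scale z Y"]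
    aco.lin_sw[of tensor_scale tensor_scale "\<lambda>z. tensor tensor_scale tensor_scale z Y"]
  by (simp_all add: lin_def)

lemma gcounit_scale_bilinear: 
  "bilinear_on tensor_scale tensor_scale tensor_scale (T p) (T q) (T q)
      (\<lambda>X Y. tensor_scale (gcounit SP p X) Y)"
  "bilinear_on tensor_scale tensor_scale tensor_scale (T q) (T p) (T q)
      (\<lambda>X Y. tensor_scale (gcounit SP p Y) X)"
  using gcounit_SP_linear[of p]
  by (simp_all add: bilinear_on_def linear_on_def T_scale mult.commute tensor_scale_left_distrib)

text \<open>Each component is the tensor product of the coalgebras \<open>A\<close> and
  \<open>H\<close> at index p: once the sums over \<open>A\<close> and \<open>H\<close> are
  interchanged, every law splits into the corresponding law of each factor.\<close>

lemma coalgebra_SP: "coalgebra tensor_scale (T p) (gcomul SP p) (gcounit SP p)"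
proof (intro coalgebra.intro coalgebra_axioms.intro, unfold sweedler_SP)
  note eqI = linear_on_tensor_space_eq[OF vector_space_ascale aco.subspace_UNIV]
  let ?TT = "tensor_space tensor_scale tensor_scale (T p) (T p)"
  let ?T3 = "tensor_space tensor_scale tensor_scale (T p) ?TT"
  let ?t3 = "tensor tensor_scale tensor_scale"
  have b1: "bilinear_on tensor_scale tensor_scale tensor_scale (T p) (T p) ?T3 (\<lambda>U V. ?t3 U (tt V Y))"
    if "Y \<in> T p" for Y
    using that by (simp add: bilinear_on_def linear_on_def tensor_in_tensor_space)
  have b2: "bilinear_on tensor_scale tensor_scale tensor_scale (T p) (T p) ?T3
      (\<lambda>X Y. gsweedler SP p X (\<lambda>U V. ?t3 U (tt V Y)))"
    by (rule gsweedler_SP_bilinear[OF subT _ b1]) (simp_all add: linear_on_def tensor_in_tensor_space)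
  have b3: "bilinear_on tensor_scale tensor_scale tensor_scale (T p) (T p) ?T3
      (\<lambda>X Y. ?t3 X (gcomul SP p Y))"
    using gcomul_SP_linear[of p]
    by (simp add: bilinear_on_def linear_on_def tensor_in_tensor_space)
  show "gsweedler SP p x (\<lambda>X Y. gsweedler SP p X (\<lambda>U V. ?t3 U (tt V Y)))
      = gsweedler SP p x (\<lambda>X Y. ?t3 X (gcomul SP p Y))" if "x \<in> T p" for x
  proof (rule eqI[OF gsweedler_SP_linear[OF subT b2] gsweedler_SP_linear[OF subT b3] _ that])
    fix a h assume h: "h \<in> gspace H p"
    have "gsweedler SP p (ta a h) (\<lambda>X Y. gsweedler SP p X (\<lambda>U V. ?t3 U (tt V Y)))
        = asw a (\<lambda>a1 a2. sw p h (\<lambda>h1 h2. asw a1 (\<lambda>u v. sw p h1 (\<lambda>x y.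
            ?t3 (ta u x) (tt (ta v y) (ta a2 h2))))))"
      by (simp add: gsweedler_SP_ta[OF subT b2 h] gsweedler_SP_ta[OF subT b1] cong: comp.sw_cong)
    also have "\<dots> = asw a (\<lambda>a1 a2. asw a1 (\<lambda>u v. sw p h (\<lambda>h1 h2. sw p h1 (\<lambda>x y.
            ?t3 (ta u x) (tt (ta v y) (ta a2 h2))))))"
      unfolding sw_asw_commute ..
    also have "\<dots> = asw a (\<lambda>a1 a2. asw a2 (\<lambda>u v. sw p h (\<lambda>h1 h2. sw p h1 (\<lambda>x y.
            ?t3 (ta a1 x) (tt (ta u y) (ta v h2))))))"
      by (rule aco.sw_coassoc[OF vsT]) (simp add: lins_T)
    also have "\<dots> = asw a (\<lambda>a1 a2. asw a2 (\<lambda>u v. sw p h (\<lambda>h1 h2. sw p h2 (\<lambda>x y.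
            ?t3 (ta a1 h1) (tt (ta u x) (ta v y))))))"
      by (intro aco.sw_cong refl comp.sw_coassoc[OF vsT]) (simp add: lins_T)
    also have "\<dots> = asw a (\<lambda>a1 a2. sw p h (\<lambda>h1 h2. asw a2 (\<lambda>u v. sw p h2 (\<lambda>x y.
            ?t3 (ta a1 h1) (tt (ta u x) (ta v y))))))"
      unfolding sw_asw_commute ..
    also have "\<dots> = gsweedler SP p (ta a h) (\<lambda>X Y. ?t3 X (gcomul SP p Y))"
      by (simp add: gsweedler_SP_ta[OF subT b3 h] gcomul_SP_ta tt_sw cong: comp.sw_cong)
    finally show "gsweedler SP p (ta a h) (\<lambda>X Y. gsweedler SP p X (\<lambda>U V. ?t3 U (tt V Y)))
      = gsweedler SP p (ta a h) (\<lambda>X Y. ?t3 X (gcomul SP p Y))" .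
  qed
  \<comment> \<open>Keeping the two counits as separate scalars lets each be contracted in its own
    sum; the rule that would merge them again is therefore withheld below.\<close>
  have scale: "tensor_scale (acou a1 * cou p h1) x = tensor_scale (acou a1) (tensor_scale (cou p h1) x)"
    for a1 h1 and x :: "('a, 'h, 'k) tensor"
    by simp
  show "gsweedler SP p x (\<lambda>X Y. tensor_scale (gcounit SP p X) Y) = x" if "x \<in> T p" for x
  proof (rule eqI[OF gsweedler_SP_linear[OF subT gcounit_scale_bilinear(1)] linear_on_ident _ that])
    fix a h assume h: "h \<in> gspace H p"
    have "gsweedler SP p (ta a h) (\<lambda>X Y. tensor_scale (gcounit SP p X) Y)
      = asw a (\<lambda>a1 a2. tensor_scale (acou a1) (sw p h (\<lambda>h1 h2. tensor_scale (cou p h1) (ta a2 h2))))"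
      by (simp add: gsweedler_SP_ta[OF subT gcounit_scale_bilinear(1) h] scale comp.sw_scale[OF vsT]
          del: tensor_scale_simps(2) cong: comp.sw_cong)
    also have "\<dots> = asw a (\<lambda>a1 a2. tensor_scale (acou a1) (ta a2 h))"
      using h by (subst comp.sw_counit_left) (simp_all add: lins_T)
    also have "\<dots> = ta a h"
      by (subst aco.sw_counit_left) (simp_all add: lins_T)
    finally show "gsweedler SP p (ta a h) (\<lambda>X Y. tensor_scale (gcounit SP p X) Y) = ta a h" .
  qed
  show "gsweedler SP p x (\<lambda>X Y. tensor_scale (gcounit SP p Y) X) = x" if "x \<in> T p" for x
  proof (rule eqI[OF gsweedler_SP_linear[OF subT gcounit_scale_bilinear(2)] linear_on_ident _ that])
    fix a h assume h: "h \<in> gspace H p"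
    have "gsweedler SP p (ta a h) (\<lambda>X Y. tensor_scale (gcounit SP p Y) X)
      = asw a (\<lambda>a1 a2. tensor_scale (acou a2) (sw p h (\<lambda>h1 h2. tensor_scale (cou p h2) (ta a1 h1))))"
      by (simp add: gsweedler_SP_ta[OF subT gcounit_scale_bilinear(2) h] scale comp.sw_scale[OF vsT]
          del: tensor_scale_simps(2) cong: comp.sw_cong)
    also have "\<dots> = asw a (\<lambda>a1 a2. tensor_scale (acou a2) (ta a1 h))"
      using h by (subst comp.sw_counit_right) (simp_all add: lins_T)
    also have "\<dots> = ta a h"
      by (subst aco.sw_counit_right) (simp_all add: lins_T)
    finally show "gsweedler SP p (ta a h) (\<lambda>X Y. tensor_scale (gcounit SP p Y) X) = ta a h" .
  qed
qed (rule vsT subspace_tensor_space gcomul_SP_linear gcounit_SP_linear)+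

lemma gmult_SP_sw_left:
  assumes "y \<in> T q" "\<And>u v. u \<in> gspace H p' \<Longrightarrow> v \<in> gspace H p' \<Longrightarrow> F u v \<in> T p"
  shows "gmult SP p q (sw p' h F) y = sw p' h (\<lambda>u v. gmult SP p q (F u v) y)"
  by (rule comp.linear_on_sw[OF subT gmult_SP_left[OF refl assms(1)] assms(2)])

lemma gmult_SP_sw_right:
  assumes "x \<in> T p" "\<And>u v. u \<in> gspace H p' \<Longrightarrow> v \<in> gspace H p' \<Longrightarrow> F u v \<in> T q"
  shows "gmult SP p q x (sw p' h F) = sw p' h (\<lambda>u v. gmult SP p q x (F u v))"
  by (rule comp.linear_on_sw[OF subT gmult_SP_right[OF refl assms(1)] assms(2)])

section \<open>Unit, counit and coproduct against the product\<close>

text \<open>On the left the unit of \<open>H\<close> splits as 1 tensor 1 and acts as the identity;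
  on the right h acts on the unit of \<open>A\<close> by eps(h), and the counit law restores
  h.\<close>

lemma gmult_SP_gone:
  assumes "x \<in> T p"
  shows "gmult SP (qone Q) p (gone SP) x = x" and "gmult SP p (qone Q) x (gone SP) = x"
proof -
  note eqI = linear_on_tensor_space_eq[OF vector_space_ascale aco.subspace_UNIV]
  note t = vsT
  have one: "gone SP \<in> T (qone Q)" by (simp add: gone_SP gone_in)
  show "gmult SP (qone Q) p (gone SP) x = x"
  proof (rule eqI[OF gmult_SP_right[OF _ one] linear_on_ident _ assms])
    fix b g assume "g \<in> gspace H p"
    then show "gmult SP (qone Q) p (gone SP) (ta b g) = ta b g"
      by (simp add: gone_SP gone_in pmult_def sw_gone[OF t] lins_T)
  qed simp
  show "gmult SP p (qone Q) x (gone SP) = x"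
  proof (rule eqI[OF gmult_SP_left[OF _ one] linear_on_ident _ assms])
    fix b g assume g: "g \<in> gspace H p"
    have "gmult SP p (qone Q) (ta b g) (gone SP) = sw p g (\<lambda>x y. tensor_scale (cou p x) (ta b (pr p y)))"
      using g by (simp add: gone_SP gone_in pmult_def)
    also have "\<dots> = ta b g"
      using g by (subst comp.sw_counit_left) (simp_all add: lins_T)
    finally show "gmult SP p (qone Q) (ta b g) (gone SP) = ta b g" .
  qed simp
qed

lemma gcounit_gmult_SP:
  assumes "x \<in> T p" "y \<in> T q"
  shows "gcounit SP (qmul Q p q) (gmult SP p q x y) = gcounit SP p x * gcounit SP q y"
proof (rule bilinear_on_tensor_space_eq[OF vector_space_ascale aco.subspace_UNIV
      vector_space_ascale aco.subspace_UNIV _ _ _ assms])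
  show "bilinear_on tensor_scale tensor_scale (*) (T p) (T q) UNIV
      (\<lambda>x y. gcounit SP (qmul Q p q) (gmult SP p q x y))"
    by (rule bilinear_on_linear_on[OF gmult_SP_bilinear[OF refl] gcounit_SP_linear])
  show "bilinear_on tensor_scale tensor_scale (*) (T p) (T q) UNIV
      (\<lambda>x y. gcounit SP p x * gcounit SP q y)"
    using gcounit_SP_linear[of p] gcounit_SP_linear[of q]
    by (simp add: bilinear_on_def linear_on_def algebra_simps)
  fix a h b g assume h: "h \<in> gspace H p" and g: "g \<in> gspace H q"
  have "gcounit SP (qmul Q p q) (pmult p q a h b g)
      = sw p h (\<lambda>x y. gcounit SP (qmul Q p q) (ta (amult A a (ac p x b)) (mu p q y g)))"
    unfolding pmult_def by (intro comp.linear_on_sw[OF subT gcounit_SP_linear] ta_in mu_in refl)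
  also have "\<dots> = sw p h (\<lambda>x y. cou p x * (acou a * acou b * cou p y * cou q g))"
    by (simp add: mu_in mult_ac)
  also have "\<dots> = acou a * acou b * cou p h * cou q g"
    by (subst comp.sw_counit_left) (simp_all add: lins algebra_simps)
  finally show "gcounit SP (qmul Q p q) (gmult SP p q (ta a h) (ta b g))
      = gcounit SP p (ta a h) * gcounit SP q (ta b g)"
    using h g by simp
qed

lemma gcomul_gmult_SP:
  assumes coco: "\<And>p h a. sw p h (\<lambda>h1 h2. tensor (gscale H) (ascale A) h1 (ac p h2 a))
      = sw p h (\<lambda>h1 h2. tensor (gscale H) (ascale A) h2 (ac p h1 a))"
    and "x \<in> T p" "y \<in> T q"
  shows "gcomul SP (qmul Q p q) (gmult SP p q x y)
    = gsweedler SP p x (\<lambda>x1 x2. gsweedler SP q y (\<lambda>y1 y2. tt (gmult SP p q x1 y1) (gmult SP p q x2 y2)))"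
proof (rule bilinear_on_tensor_space_eq[OF vector_space_ascale aco.subspace_UNIV
      vector_space_ascale aco.subspace_UNIV _ _ _ assms(2,3)])
  let ?r = "qmul Q p q"
  let ?TT = "tensor_space tensor_scale tensor_scale (T ?r) (T ?r)"
  show "bilinear_on tensor_scale tensor_scale tensor_scale (T p) (T q) ?TT
      (\<lambda>x y. gcomul SP ?r (gmult SP p q x y))"
    by (rule bilinear_on_linear_on[OF gmult_SP_bilinear[OF refl] gcomul_SP_linear])
  note M = bilinear_on_compose[OF bilinear_on_tensor]
  \<comment> \<open>A nested Sweedler sum needs bilinearity in either pair of legs while the other
    pair is fixed: \<open>b1\<close> serves the inner sum, and \<open>b2\<close> yields bilinearity
    of that inner sum in the outer legs.\<close>
  have b1: "bilinear_on tensor_scale tensor_scale tensor_scale (T q) (T q) ?TT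
      (\<lambda>y1 y2. tt (gmult SP p q x1 y1) (gmult SP p q x2 y2))" if "x1 \<in> T p" "x2 \<in> T p" for x1 x2
    by (rule M[OF gmult_SP_right[OF refl that(1)] gmult_SP_right[OF refl that(2)]])
  have b2: "bilinear_on tensor_scale tensor_scale tensor_scale (T p) (T p) ?TT
      (\<lambda>x1 x2. tt (gmult SP p q x1 y1) (gmult SP p q x2 y2))" if "y1 \<in> T q" "y2 \<in> T q" for y1 y2
    by (rule M[OF gmult_SP_left[OF refl that(1)] gmult_SP_left[OF refl that(2)]])
  have b3: "bilinear_on tensor_scale tensor_scale tensor_scale (T p) (T p) ?TT
      (\<lambda>x1 x2. gsweedler SP q y (\<lambda>y1 y2. tt (gmult SP p q x1 y1) (gmult SP p q x2 y2)))"
    if "y \<in> T q" for y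
    unfolding bilinear_on_def
  proof (intro conjI ballI)
    fix z assume z: "z \<in> T p"
    show "linear_on tensor_scale tensor_scale (T p) ?TT
        (\<lambda>x2. gsweedler SP q y (\<lambda>y1 y2. tt (gmult SP p q z y1) (gmult SP p q x2 y2)))"
      by (rule gsweedler_SP_param[OF subT that _ b1])
        (use b2 z in \<open>auto simp: bilinear_on_def\<close>)
    show "linear_on tensor_scale tensor_scale (T p) ?TT
        (\<lambda>x1. gsweedler SP q y (\<lambda>y1 y2. tt (gmult SP p q x1 y1) (gmult SP p q z y2)))"
      by (rule gsweedler_SP_param[OF subT that _ b1])
        (use b2 z in \<open>auto simp: bilinear_on_def\<close>)
  qed
  show "bilinear_on tensor_scale tensor_scale tensor_scale (T p) (T q) ?TT
      (\<lambda>x y. gsweedler SP p x (\<lambda>x1 x2. gsweedler SP q y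
        (\<lambda>y1 y2. tt (gmult SP p q x1 y1) (gmult SP p q x2 y2))))"
    by (rule gsweedler_SP_bilinear[OF subT gsweedler_SP_linear[OF subT b1] b3])
  fix a h b g assume h: "h \<in> gspace H p" and g: "g \<in> gspace H q"
  have "gcomul SP ?r (gmult SP p q (ta a h) (ta b g)) = gcomul SP ?r (pmult p q a h b g)"
    using h g by simp
  also have "\<dots> = sw p h (\<lambda>x y. gcomul SP ?r (ta (amult A a (ac p x b)) (mu p q y g)))"
    unfolding pmult_def by (intro comp.linear_on_sw[OF subT gcomul_SP_linear] ta_in mu_in refl)
  also have "\<dots> = sw p h (\<lambda>x y. asw (amult A a (ac p x b)) (\<lambda>c1 c2. sw ?r (mu p q y g)
      (\<lambda>k1 k2. tt (ta c1 k1) (ta c2 k2))))"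
    by (simp add: gcomul_SP_ta mu_in)
  also have "\<dots> = asw a (\<lambda>a1 a2. sw p h (\<lambda>x y. asw b (\<lambda>b1 b2. sw q g (\<lambda>g1 g2.
      tt (pmult p q a1 x b1 g1) (pmult p q a2 y b2 g2)))))"
    unfolding pmult_comul[OF coco] pmult_def tt_sw(3) tt_sw(1)
    by (intro aco.sw_cong comp.sw_cong refl sw_sw_commute)
  also have "\<dots> = gsweedler SP p (ta a h) (\<lambda>x1 x2. gsweedler SP q (ta b g)
      (\<lambda>y1 y2. tt (gmult SP p q x1 y1) (gmult SP p q x2 y2)))"
    using g by (simp add: gsweedler_SP_ta[OF subT b3 h] gsweedler_SP_ta[OF subT b1] cong: comp.sw_cong)
  finally show "gcomul SP ?r (gmult SP p q (ta a h) (ta b g))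
    = gsweedler SP p (ta a h) (\<lambda>x1 x2. gsweedler SP q (ta b g)
      (\<lambda>y1 y2. tt (gmult SP p q x1 y1) (gmult SP p q x2 y2)))" .
qed

section \<open>The antipode laws of the smash product\<close>

text \<open>All four antipode laws have this shape; it isolates the linearity needed to reduce each
  of them to pure tensors.\<close>

lemma gsweedler_SP_eq_counitI:
  assumes f: "\<And>u v. u \<in> T p \<Longrightarrow> v \<in> T p \<Longrightarrow> linear_on tensor_scale tensor_scale (T q) (T q) (f u v)"
    and bil: "\<And>y. y \<in> T q \<Longrightarrow>
      bilinear_on tensor_scale tensor_scale tensor_scale (T p) (T p) (T q) (\<lambda>u v. f u v y)"
    and eq: "\<And>a h b g. h \<in> gspace H p \<Longrightarrow> g \<in> gspace H q \<Longrightarrow>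
      asw a (\<lambda>a1 a2. sw p h (\<lambda>h1 h2. f (ta a1 h1) (ta a2 h2) (ta b g)))
      = tensor_scale (acou a * cou p h) (ta b g)"
    and xy: "x \<in> T p" "y \<in> T q"
  shows "gsweedler SP p x (\<lambda>u v. f u v y) = tensor_scale (gcounit SP p x) y"
proof (rule bilinear_on_tensor_space_eq[OF vector_space_ascale aco.subspace_UNIV
      vector_space_ascale aco.subspace_UNIV gsweedler_SP_bilinear[OF subT f bil]
      gcounit_scale_bilinear(1) _ xy])
  fix a h b g assume "h \<in> gspace H p" "g \<in> gspace H q"
  then show "gsweedler SP p (ta a h) (\<lambda>u v. f u v (ta b g)) = tensor_scale (gcounit SP p (ta a h)) (ta b g)"
    by (simp add: gsweedler_SP_ta[OF subT bil] eq)
qed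

lemmas gmult_SP_sws = gmult_SP_sw_left gmult_SP_sw_right comp.sw_in_subspace[OF subT] S_in mu_in

lemma SP_antipode1:
  assumes "x \<in> T p" "y \<in> T q"
  shows "gsweedler SP p x (\<lambda>x1 x2.
      gmult SP (qinv Q p) (qmul Q p q) (gantipode SP p x1) (gmult SP p q x2 y))
    = tensor_scale (gcounit SP p x) y"
proof (rule gsweedler_SP_eq_counitI[OF _ _ _ assms])
  let ?r = "qinv Q p" and ?pq = "qmul Q p q"
  show "linear_on tensor_scale tensor_scale (T q) (T q)
      (\<lambda>y. gmult SP ?r ?pq (gantipode SP p u) (gmult SP p q v y))" if "u \<in> T p" "v \<in> T p" for u v
    by (rule linear_on_compose[OF gmult_SP_right[OF refl] gmult_SP_right]) (simp_all add: that)
  show "bilinear_on tensor_scale tensor_scale tensor_scale (T p) (T p) (T q)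
      (\<lambda>u v. gmult SP ?r ?pq (gantipode SP p u) (gmult SP p q v y))" if "y \<in> T q" for y
    by (rule bilinear_on_compose[OF gmult_SP_bilinear gantipode_SP_linear gmult_SP_left[OF refl that]])
      simp
  fix a h b g assume hg: "h \<in> gspace H p" "g \<in> gspace H q"
  have "gmult SP ?r ?pq (gantipode SP p (ta a1 x)) (gmult SP p q (ta a2 y) (ta b g))
    = sw p x (\<lambda>u v. sw p y (\<lambda>w z. pmult ?r ?pq (ac ?r (S p v) (aantipode A a1)) (S p u)
       (amult A a2 (ac p w b)) (mu p q z g)))" if "x \<in> gspace H p" "y \<in> gspace H p" for a1 a2 x y
  proof -
    have "gmult SP p q (ta a2 y) (ta b g) = sw p y (\<lambda>w z. ta (amult A a2 (ac p w b)) (mu p q z g))"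
      using that hg by (simp add: pmult_def)
    then show ?thesis using that by (simp add: gmult_SP_sws sw_sw_commute[of p y p x])
  qed
  then show "asw a (\<lambda>a1 a2. sw p h (\<lambda>x y.
      gmult SP ?r ?pq (gantipode SP p (ta a1 x)) (gmult SP p q (ta a2 y) (ta b g))))
      = tensor_scale (acou a * cou p h) (ta b g)"
    using hg pmult_antipode1[where q = q and g = g] by (simp cong: comp.sw_cong)
qed

lemma SP_antipode2:
  assumes "x \<in> T p" "y \<in> T q"
  shows "gsweedler SP p x (\<lambda>x1 x2.
      gmult SP p (qmul Q (qinv Q p) q) x1 (gmult SP (qinv Q p) q (gantipode SP p x2) y))
    = tensor_scale (gcounit SP p x) y"
proof (rule gsweedler_SP_eq_counitI[OF _ _ _ assms])
  let ?r = "qinv Q p" and ?rq = "qmul Q (qinv Q p) q"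
  show "linear_on tensor_scale tensor_scale (T q) (T q)
      (\<lambda>y. gmult SP p ?rq u (gmult SP ?r q (gantipode SP p v) y))" if "u \<in> T p" "v \<in> T p" for u v
    by (rule linear_on_compose[OF gmult_SP_right[OF refl] gmult_SP_right]) (simp_all add: that)
  show "bilinear_on tensor_scale tensor_scale tensor_scale (T p) (T p) (T q)
      (\<lambda>u v. gmult SP p ?rq u (gmult SP ?r q (gantipode SP p v) y))" if "y \<in> T q" for y
    by (rule bilinear_on_compose[OF gmult_SP_bilinear linear_on_ident
        linear_on_compose[OF gantipode_SP_linear gmult_SP_left[OF refl that]]]) simp
  fix a h b g assume hg: "h \<in> gspace H p" "g \<in> gspace H q"
  have "gmult SP p ?rq (ta a1 x) (gmult SP ?r q (gantipode SP p (ta a2 y)) (ta b g))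
    = sw p y (\<lambda>u v. sw ?r (S p u) (\<lambda>k l. pmult p ?rq a1 x
        (amult A (ac ?r (S p v) (aantipode A a2)) (ac ?r k b)) (mu ?r q l g)))"
    if "x \<in> gspace H p" "y \<in> gspace H p" for a1 a2 x y
  proof -
    have "gmult SP ?r q (gantipode SP p (ta a2 y)) (ta b g)
        = sw p y (\<lambda>u v. pmult ?r q (ac ?r (S p v) (aantipode A a2)) (S p u) b g)"
      using that hg by (simp add: gmult_SP_sws)
    also have "\<dots> = sw p y (\<lambda>u v. sw ?r (S p u) (\<lambda>k l.
        ta (amult A (ac ?r (S p v) (aantipode A a2)) (ac ?r k b)) (mu ?r q l g)))"
      by (simp add: pmult_def)
    finally show ?thesis using that by (simp add: gmult_SP_sws)
  qed
  then show "asw a (\<lambda>a1 a2. sw p h (\<lambda>x y.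
      gmult SP p ?rq (ta a1 x) (gmult SP ?r q (gantipode SP p (ta a2 y)) (ta b g))))
      = tensor_scale (acou a * cou p h) (ta b g)"
    using hg pmult_antipode2[where q = q and g = g] by (simp cong: comp.sw_cong)
qed

text \<open>Kept apart from the law itself because the converse direction, where the law is given,
  must also expand it on pure tensors.\<close>

lemma SP_antipode3_linear:
  shows "u \<in> T p \<Longrightarrow> v \<in> T p \<Longrightarrow> linear_on tensor_scale tensor_scale (T q) (T q)
      (\<lambda>y. gmult SP (qmul Q q (qinv Q p)) p (gmult SP q (qinv Q p) y (gantipode SP p u)) v)"
    and "y \<in> T q \<Longrightarrow> bilinear_on tensor_scale tensor_scale tensor_scale (T p) (T p) (T q)
      (\<lambda>u v. gmult SP (qmul Q q (qinv Q p)) p (gmult SP q (qinv Q p) y (gantipode SP p u)) v)"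
proof -
  show "linear_on tensor_scale tensor_scale (T q) (T q)
      (\<lambda>y. gmult SP (qmul Q q (qinv Q p)) p (gmult SP q (qinv Q p) y (gantipode SP p u)) v)"
    if "u \<in> T p" "v \<in> T p"
    by (rule linear_on_compose[OF gmult_SP_left[OF refl] gmult_SP_left]) (simp_all add: that)
  show "bilinear_on tensor_scale tensor_scale tensor_scale (T p) (T p) (T q)
      (\<lambda>u v. gmult SP (qmul Q q (qinv Q p)) p (gmult SP q (qinv Q p) y (gantipode SP p u)) v)"
    if "y \<in> T q"
    by (rule bilinear_on_compose[OF gmult_SP_bilinear
        linear_on_compose[OF gantipode_SP_linear gmult_SP_right[OF refl that]] linear_on_ident]) simp
qed

lemma SP_antipode3_ta:
  assumes "x \<in> gspace H p" "y \<in> gspace H p" "g \<in> gspace H q"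
  shows "gmult SP (qmul Q q (qinv Q p)) p (gmult SP q (qinv Q p) (ta b g) (gantipode SP p (ta a1 x))) (ta a2 y)
    = sw p x (\<lambda>u v. sw q g (\<lambda>g1 g2. pmult (qmul Q q (qinv Q p)) p
       (amult A b (ac q g1 (ac (qinv Q p) (S p v) (aantipode A a1)))) (mu q (qinv Q p) g2 (S p u)) a2 y))"
proof -
  let ?r = "qinv Q p"
  have "gmult SP q ?r (ta b g) (gantipode SP p (ta a1 x))
      = sw p x (\<lambda>u v. pmult q ?r b g (ac ?r (S p v) (aantipode A a1)) (S p u))"
    using assms by (simp add: gmult_SP_sws)
  also have "\<dots> = sw p x (\<lambda>u v. sw q g (\<lambda>g1 g2.
      ta (amult A b (ac q g1 (ac ?r (S p v) (aantipode A a1)))) (mu q ?r g2 (S p u))))"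
    by (simp add: pmult_def)
  finally show ?thesis using assms by (simp add: gmult_SP_sws)
qed

lemma SP_antipode3:
  assumes "\<And>g h a. ac q g (ac (qinv Q p) (S p h) a)
      = ac (qmul Q q (qinv Q p)) (mu q (qinv Q p) g (S p h)) a"
    and "x \<in> T p" "y \<in> T q"
  shows "gsweedler SP p x (\<lambda>x1 x2.
      gmult SP (qmul Q q (qinv Q p)) p (gmult SP q (qinv Q p) y (gantipode SP p x1)) x2)
    = tensor_scale (gcounit SP p x) y"
proof (rule gsweedler_SP_eq_counitI[OF _ _ _ assms(2,3)])
  show "linear_on tensor_scale tensor_scale (T q) (T q)
      (\<lambda>y. gmult SP (qmul Q q (qinv Q p)) p (gmult SP q (qinv Q p) y (gantipode SP p u)) v)"
    if "u \<in> T p" "v \<in> T p" for u v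
    by (rule SP_antipode3_linear(1)[OF that])
  show "bilinear_on tensor_scale tensor_scale tensor_scale (T p) (T p) (T q)
      (\<lambda>u v. gmult SP (qmul Q q (qinv Q p)) p (gmult SP q (qinv Q p) y (gantipode SP p u)) v)"
    if "y \<in> T q" for y
    by (rule SP_antipode3_linear(2)[OF that])
  fix a h b g assume "h \<in> gspace H p" "g \<in> gspace H q"
  then show "asw a (\<lambda>a1 a2. sw p h (\<lambda>x y. gmult SP (qmul Q q (qinv Q p)) p
      (gmult SP q (qinv Q p) (ta b g) (gantipode SP p (ta a1 x))) (ta a2 y)))
      = ts (acou a * cou p h) (ta b g)"
    using pmult_antipode3[OF assms(1)]
    by (simp add: SP_antipode3_ta del: gantipode_SP_ta cong: comp.sw_cong)
qed

lemma SP_antipode4: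
  assumes act: "\<And>g h a. ac (qmul Q q p) g (ac (qinv Q p) (S p h) a)
    = ac (qmul Q (qmul Q q p) (qinv Q p)) (mu (qmul Q q p) (qinv Q p) g (S p h)) a"
    and xy: "x \<in> T p" "y \<in> T q"
  shows "gsweedler SP p x (\<lambda>x1 x2.
      gmult SP (qmul Q q p) (qinv Q p) (gmult SP q p y x1) (gantipode SP p x2))
    = tensor_scale (gcounit SP p x) y"
proof (rule gsweedler_SP_eq_counitI[OF _ _ _ xy])
  let ?r = "qinv Q p" and ?qp = "qmul Q q p"
  show "linear_on tensor_scale tensor_scale (T q) (T q)
      (\<lambda>y. gmult SP ?qp ?r (gmult SP q p y u) (gantipode SP p v))" if "u \<in> T p" "v \<in> T p" for u v
    by (rule linear_on_compose[OF gmult_SP_left[OF refl] gmult_SP_left]) (simp_all add: that)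
  show "bilinear_on tensor_scale tensor_scale tensor_scale (T p) (T p) (T q)
      (\<lambda>u v. gmult SP ?qp ?r (gmult SP q p y u) (gantipode SP p v))" if "y \<in> T q" for y
    by (rule bilinear_on_compose[OF gmult_SP_bilinear gmult_SP_right[OF refl that] gantipode_SP_linear])
      simp
  fix a h b g assume hg: "h \<in> gspace H p" "g \<in> gspace H q"
  have "gmult SP ?qp ?r (gmult SP q p (ta b g) (ta a1 x)) (gantipode SP p (ta a2 y))
    = sw q g (\<lambda>g1 g2. sw p y (\<lambda>u v. pmult ?qp ?r (amult A b (ac q g1 a1)) (mu q p g2 x)
        (ac ?r (S p v) (aantipode A a2)) (S p u)))" if "x \<in> gspace H p" "y \<in> gspace H p" for a1 a2 x y
  proof -
    have "gmult SP q p (ta b g) (ta a1 x) = sw q g (\<lambda>g1 g2. ta (amult A b (ac q g1 a1)) (mu q p g2 x))"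
      using that hg by (simp add: pmult_def)
    then show ?thesis using that by (simp add: gmult_SP_sws sw_sw_commute[of p y q g])
  qed
  then show "asw a (\<lambda>a1 a2. sw p h (\<lambda>x y.
      gmult SP ?qp ?r (gmult SP q p (ta b g) (ta a1 x)) (gantipode SP p (ta a2 y))))
      = tensor_scale (acou a * cou p h) (ta b g)"
    using hg pmult_antipode4[OF act] by (simp cong: comp.sw_cong)
qed

section \<open>The two directions of the equivalence\<close>

lemma ac_ac_S_if_graded_hopf_quasigroup_SP:
  assumes "graded_hopf_quasigroup Q SP"
  shows "ac q g (ac (qinv Q p) (S p h) a) = ac (qmul Q q (qinv Q p)) (mu q (qinv Q p) g (S p h)) a"
proof (rule ac_ac_S_if_pmult_antipode3)
  fix a h g
  have "gsweedler SP p (ta a (pr p h)) (\<lambda>x1 x2. gmult SP (qmul Q q (qinv Q p)) p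
      (gmult SP q (qinv Q p) (ta (aone A) (pr q g)) (gantipode SP p x1)) x2)
    = ts (acou a * cou p h) (ta (aone A) (pr q g))"
    using graded_hopf_quasigroup.antipode3[OF assms, of "ta a (pr p h)" p "ta (aone A) (pr q g)" q]
    by simp
  then show "asw a (\<lambda>a1 a2. sw p h (\<lambda>x y. sw p x (\<lambda>u v. sw q g (\<lambda>g1 g2.
     pmult (qmul Q q (qinv Q p)) p
       (amult A (aone A) (ac q g1 (ac (qinv Q p) (S p v) (aantipode A a1)))) (mu q (qinv Q p) g2 (S p u)) a2 y))))
   = ts (acou a * cou p h) (ta (aone A) (pr q g))"
    \<comment> \<open>The simplification rules for products in \<open>A\<close> are withheld so that
      the factor \<open>amult A (aone A)\<close>, which the target formula displays, is not
      removed.\<close>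
    by (simp add: gsweedler_SP_ta[OF subT SP_antipode3_linear(2)] SP_antipode3_ta
        del: amult_simps gantipode_SP_ta cong: comp.sw_cong)
qed

lemma graded_hopf_quasigroup_SP:
  assumes "\<And>p h a. sw p h (\<lambda>h1 h2. tensor (gscale H) (ascale A) h1 (ac p h2 a))
      = sw p h (\<lambda>h1 h2. tensor (gscale H) (ascale A) h2 (ac p h1 a))"
    and "\<And>p q g h a. ac q g (ac (qinv Q p) (S p h) a)
      = ac (qmul Q q (qinv Q p)) (mu q (qinv Q p) g (S p h)) a"
  shows "graded_hopf_quasigroup Q SP"
proof (intro graded_hopf_quasigroup.intro graded_hopf_quasigroup_axioms.intro,
    unfold gscale_SP gspace_SP)
  show "gone SP \<in> T (qone Q)" "gcounit SP (qone Q) (gone SP) = 1"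
    by (simp_all add: gone_SP gone_in)
  show "gcomul SP (qone Q) (gone SP) = tt (gone SP) (gone SP)"
    by (simp add: gone_SP gone_in gcomul_SP_ta asw_aone[OF vsT] sw_gone[OF vsT] lins_T)
\<comment> \<open>The fourth antipode law at p and q uses (2) with \<open>qmul Q q p\<close> in
  place of q, so (2) must be available for all pairs of indices.\<close>
qed (rule quasigroup_axioms coalgebra_SP gmult_SP_bilinear[OF refl] gmult_SP_gone
    gcomul_gmult_SP[OF assms(1)] gcounit_gmult_SP gantipode_SP_linear
    SP_antipode1 SP_antipode2 SP_antipode3[OF assms(2)] SP_antipode4[OF assms(2)]; assumption?)+

end

theorem theorem6p4:
  fixes Q :: "'q quasigroup_data"
    and H :: "('q, 'k::field, 'h::ab_group_add) graded_data"
    and A :: "('k, 'a::ab_group_add) hopf_data"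
    and act :: "'q \<Rightarrow> 'h \<Rightarrow> 'a \<Rightarrow> 'a"
  assumes "quasigroup Q"
    and "graded_hopf_quasigroup Q H"
    and "quasimodule_hopf_quasigroup Q H A act"
    and "\<forall>p. \<forall>h \<in> gspace H p. \<forall>a.
      gsweedler H p h (\<lambda>h1 h2. tensor (gscale H) (ascale A) h1 (act p h2 a))
      = gsweedler H p h (\<lambda>h1 h2. tensor (gscale H) (ascale A) h2 (act p h1 a))"
  shows "graded_hopf_quasigroup Q (smash_product Q H A act) \<longleftrightarrow>
    (\<forall>p q. \<forall>h \<in> gspace H p. \<forall>g \<in> gspace H q. \<forall>a.
      act q g (act (qinv Q p) (gantipode H p h) a)
      = act (qmul Q q (qinv Q p)) (gmult H q (qinv Q p) g (gantipode H p h)) a)"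
proof -
  interpret quasimodule_hopf_quasigroup Q H A act by fact
  have coco: "sw p h (\<lambda>h1 h2. tensor (gscale H) (ascale A) h1 (ac p h2 a))
      = sw p h (\<lambda>h1 h2. tensor (gscale H) (ascale A) h2 (ac p h1 a))" for p h a
    using assms(4)[rule_format, of "pr p h" p a]
    by (simp add: gsweedler_eq_sw act_eq_ac cong: comp.sw_cong)
  have act_iff: "act q g (act (qinv Q p) (gantipode H p h) a)
      = act (qmul Q q (qinv Q p)) (gmult H q (qinv Q p) g (gantipode H p h)) a
    \<longleftrightarrow> ac q g (ac (qinv Q p) (S p h) a)
      = ac (qmul Q q (qinv Q p)) (mu q (qinv Q p) g (S p h)) a"
    if "h \<in> gspace H p" "g \<in> gspace H q" for p q h g a
    using that by (simp add: gantipode_eq_S gmult_eq_mu act_eq_ac S_in mu_in)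
  show ?thesis
  proof
    assume "graded_hopf_quasigroup Q (smash_product Q H A act)"
    then show "\<forall>p q. \<forall>h \<in> gspace H p. \<forall>g \<in> gspace H q. \<forall>a.
      act q g (act (qinv Q p) (gantipode H p h) a)
      = act (qmul Q q (qinv Q p)) (gmult H q (qinv Q p) g (gantipode H p h)) a"
      by (simp add: act_iff ac_ac_S_if_graded_hopf_quasigroup_SP)
  next
    assume *: "\<forall>p q. \<forall>h \<in> gspace H p. \<forall>g \<in> gspace H q. \<forall>a.
      act q g (act (qinv Q p) (gantipode H p h) a)
      = act (qmul Q q (qinv Q p)) (gmult H q (qinv Q p) g (gantipode H p h)) a"
    \<comment> \<open>\<open>ac\<close>, \<open>mu\<close> and \<open>S\<close> see only the
      projections of their arguments in \<open>H\<close>, so (2) on the components extends to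
      arbitrary ambient \<open>h\<close> and \<open>g\<close>.\<close>
    have "ac q g (ac (qinv Q p) (S p h) a)
        = ac (qmul Q q (qinv Q p)) (mu q (qinv Q p) g (S p h)) a" for p q g h a
      using * act_iff[of "pr p h" p "pr q g" q a] by simp
    with coco show "graded_hopf_quasigroup Q (smash_product Q H A act)"
      by (rule graded_hopf_quasigroup_SP)
  qed
qed

end
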